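(* Let $g\ge 2$ be an integer. Consider the Diophantine equation $$L_k=d_1\frac{g^\ell-1}{g-1}\cdot d_2\frac{g^m-1}{g-1}\cdot d_3\frac{g^n-1}{g-1}$$ in positive integers $k,d_1,d_2,d_3,\ell,m,n$ with $1\le d_1,d_2,d_3\le g-1$, $n\ge 1$ and $\ell\le m\le n$. This equation has only finitely many solutions. Namely, every solution satisfies $$\ell\le m\le n<7.73\times 10^{47}\log^9 g\quad\text{and}\quad k<7.73\times 10^{48}\log^{10} g.$$
   Context: $(L_n)_{n\ge 0}$ is the Lucas sequence: $L_0=2$, $L_1=1$, $L_{n+2}=L_{n+1}+L_n$. $\log$ denotes the natural logarithm. A repdigit in base $g$ is a number of the form $d\,\frac{g^m-1}{g-1}$ with $m\ge1$ and $1\le d\le g-1$. *)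

theory Defs
  imports Complex_Main
begin

fun lucas :: "nat \<Rightarrow> nat" where
  "lucas 0 = 2"
| "lucas (Suc 0) = 1"
| "lucas (Suc (Suc n)) = lucas (Suc n) + lucas n"

text \<open>The base-g repdigit d (g^m - 1)/(g - 1) (exact division for g >= 2).\<close>
definition repdigit :: "nat \<Rightarrow> nat \<Rightarrow> nat \<Rightarrow> nat" where
  "repdigit g d m = d * ((g ^ m - 1) div (g - 1))"

end

theory Submission
  imports Defs
    "HOL-Computational_Algebra.Computational_Algebra"
    "HOL-Computational_Algebra.Field_as_Ring"
    "Jordan_Normal_Form.Determinant"
begin

text \<open>Let \<open>\<phi>\<close> be the golden ratio. Since \<open>L\<^sub>k\<close> is very close to \<open>\<phi>\<^sup>k\<close>, replacing one, two or
  three of the factors \<open>g\<^sup>j - 1\<close> by \<open>g\<^sup>j\<close> shows that a linear form \<open>k ln \<phi> - N ln g - ln c\<close> with rational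
  \<open>c\<close> is at most \<open>10 g\<^bsup>-n\<^esup>\<close>, \<open>10 g\<^bsup>-m\<^esup>\<close> or \<open>10 g\<^bsup>-l\<^esup>\<close>; the logarithmic height of \<open>c\<close> is of order
  \<open>(l + m + 6) ln g\<close>, \<open>(l + 6) ln g\<close> or \<open>6 ln g\<close>. A lower bound for such forms that is proportional to this
  height bounds \<open>n\<close> in terms of \<open>l + m\<close>, then \<open>m\<close> in terms of \<open>l\<close>, and finally \<open>l\<close> itself.

  The lower bound is Baker's method in a real-variable form. If the linear form is tiny, then
  \<open>\<phi>\<^bsup>t\<^sub>1\<^esup> g\<^bsup>t\<^sub>2\<^esup> c\<^sup>s\<close> is almost the exponential of a linear function of \<open>x\<^sub>1 = t\<^sub>1 + k s\<close> and \<open>x\<^sub>2 = t\<^sub>2 - N s\<close>.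
  The pigeonhole principle, applied to Taylor coefficients, yields a nonzero integer polynomial in \<open>x\<^sub>1\<close>, \<open>x\<^sub>2\<close>
  and this exponential that is small at all points of a box. Its values there lie in \<open>\<int>[\<phi>]\<close> up to a
  denominator, so by the norm they vanish. Eliminating the exponential leaves a polynomial in \<open>x\<^sub>1, x\<^sub>2\<close>
  of small degree with too many zeros for Bezout's theorem, unless many of the points \<open>(x\<^sub>1, x\<^sub>2)\<close> are collinear;
  in that case the same argument along the line, with polynomials in one variable, gives the contradiction.\<close>

section \<open>Bivariate polynomials\<close>

text \<open>Since ln c differs by a tiny amount from k ln phi - N ln g, three logarithms reduce to
  two: ln phi * x1 + ln g * x2 approximates the logarithm of phi^t1 g^t2 c^s. There is no complex
  analysis and no extrapolation; so many Taylor coefficients are made small at once that the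
  function is small on the doubled box immediately. The size of L is the crux. Binomial polynomials
  of degree below K take values up to about (k / (K h))^K times a constant power, and controlling
  them costs about (2/3) K ln (k / h) in the logarithm of the coefficients. This has to be paid by
  8^(-n1) with n1 = K L / 4, so L must be of the order of ln (k / h). The box must contain more than
  (K L)^2 points while its sides are inversely proportional to ln phi, ln g and h; so K is
  proportional to L^2 h ln g, and the lower bound has exponent L^3 h ln g, linear in the height h.
  Each of the three bounds therefore still contains the cube of a logarithm of n, which is removed
  by the choice of L. The argument ends with a multiple of (ln g)^6; since ln g >= ln 2, this fits
  under the ninth power.\<close>

definition ev2 :: "real poly poly \<Rightarrow> real \<Rightarrow> real \<Rightarrow> real" where
  "ev2 f x y = poly (poly f [:x:]) y"

lemma ev2_simps [simp]:
  "ev2 0 x y = 0" "ev2 1 x y = 1" "ev2 (f + g) x y = ev2 f x y + ev2 g x y"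
  "ev2 (- f) x y = - ev2 f x y"
  "ev2 (f - g) x y = ev2 f x y - ev2 g x y" "ev2 (f * g) x y = ev2 f x y * ev2 g x y"
  "ev2 (f ^ n) x y = ev2 f x y ^ n" "ev2 [:c:] x y = poly c y"
  "ev2 (pCons c f) x y = poly c y + x * ev2 f x y"
  "ev2 (Polynomial.smult c f) x y = poly c y * ev2 f x y"
  by (simp_all add: ev2_def)

lemma ev2_sum [simp]: "ev2 (\<Sum>i\<in>A. f i) x y = (\<Sum>i\<in>A. ev2 (f i) x y)"
  by (simp add: ev2_def poly_sum)

lemma ev2_altdef:
  "ev2 f x y = (\<Sum>i\<le>degree f. \<Sum>j\<le>degree (coeff f i). coeff (coeff f i) j * x ^ i * y ^ j)"
proof -
  have "ev2 f x y = (\<Sum>i\<le>degree f. poly (coeff f i) y * x ^ i)"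
    unfolding ev2_def by (simp add: poly_altdef[of f] poly_sum)
  also have "\<dots> = (\<Sum>i\<le>degree f. \<Sum>j\<le>degree (coeff f i). coeff (coeff f i) j * x ^ i * y ^ j)"
    by (simp add: poly_altdef sum_distrib_right sum_distrib_left mult_ac)
  finally show ?thesis .
qed

lemma ev2_zero_imp:
  assumes "\<And>x y. ev2 f x y = 0"
  shows "f = 0"
proof (rule ccontr)
  assume "f \<noteq> 0"
  then have fin: "finite {a. poly f a = 0}" by (rule poly_roots_finite)
  have "poly f [:x:] = 0" for x
    using assms by (simp add: ev2_def poly_all_0_iff_0[symmetric])
  then have "range (\<lambda>x::real. [:x:]) \<subseteq> {a. poly f a = 0}" by auto
  then have "finite (range (\<lambda>x::real. [:x:]))" using fin finite_subset by blast
  moreover have "inj (\<lambda>x::real. [:x:])" by (auto simp: inj_def)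
  ultimately have "finite (UNIV :: real set)" using finite_imageD by blast
  then show False using infinite_UNIV_char_0 by blast
qed

lemma ev2_eqI:
  assumes "\<And>x y. ev2 f x y = ev2 g x y"
  shows "f = g"
  using ev2_zero_imp[of "f - g"] assms by simp

definition comp2 :: "real poly poly \<Rightarrow> real poly poly \<Rightarrow> real poly poly \<Rightarrow> real poly poly" where
  "comp2 f A B = (\<Sum>i\<le>degree f. \<Sum>j\<le>degree (coeff f i). [:[:coeff (coeff f i) j:]:] * A ^ i * B ^ j)"

lemma ev2_comp2 [simp]: "ev2 (comp2 f A B) x y = ev2 f (ev2 A x y) (ev2 B x y)"
  unfolding comp2_def by (simp add: ev2_altdef[of f] mult.assoc)

lemma ev2_line_poly:
  "\<exists>q. \<forall>t. poly q t = ev2 f (poly p t) (poly r t)"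
proof
  show "\<forall>t. poly (\<Sum>i\<le>degree f. \<Sum>j\<le>degree (coeff f i). Polynomial.smult (coeff (coeff f i) j) (p ^ i * r ^ j)) t
    = ev2 f (poly p t) (poly r t)"
    by (simp add: ev2_altdef poly_sum mult_ac)
qed

definition shift2 :: "real \<Rightarrow> real \<Rightarrow> real poly poly \<Rightarrow> real poly poly" where
  "shift2 a b f = comp2 f [:[:a:], 1:] [:[:b, 1:]:]"

lemma ev2_shift2 [simp]: "ev2 (shift2 a b f) x y = ev2 f (x + a) (y + b)"
  unfolding shift2_def by (simp add: algebra_simps)

lemma shift2_mult: "shift2 a b (f * g) = shift2 a b f * shift2 a b g"
  by (rule ev2_eqI) simp

lemma shift2_shift2: "shift2 a b (shift2 c d f) = shift2 (a + c) (b + d) f"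
  by (rule ev2_eqI) (simp add: algebra_simps)

lemma shift2_0 [simp]: "shift2 0 0 f = f" "shift2 a b 0 = 0" "shift2 a b 1 = 1"
  by (rule ev2_eqI, simp)+

lemma shift2_inverse [simp]:
  "shift2 a b (shift2 (- a) (- b) f) = f" "shift2 (- a) (- b) (shift2 a b f) = f"
  by (simp_all add: shift2_shift2)

lemma shift2_eq_0_iff [simp]: "shift2 a b f = 0 \<longleftrightarrow> f = 0"
  by (metis shift2_0(2) shift2_inverse(2))

lemma shift2_dvd: "f dvd g \<Longrightarrow> shift2 a b f dvd shift2 a b g"
  by (auto simp: dvd_def shift2_mult)

lemma shift2_dvd_iff: "shift2 a b f dvd shift2 a b g \<longleftrightarrow> f dvd g"
  by (metis shift2_dvd shift2_inverse(2))

lemma prime_elem_shift2: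
  assumes "prime_elem f"
  shows "prime_elem (shift2 a b f)"
proof (rule prime_elemI)
  show "shift2 a b f \<noteq> 0" using assms by auto
  show "\<not> shift2 a b f dvd 1"
    using assms shift2_dvd_iff[of a b f 1] by auto
next
  fix u v assume "shift2 a b f dvd u * v"
  then have "f dvd shift2 (-a) (-b) u * shift2 (-a) (-b) v"
    by (metis shift2_dvd shift2_inverse(2) shift2_mult)
  then have "f dvd shift2 (-a) (-b) u \<or> f dvd shift2 (-a) (-b) v"
    using assms prime_elem_dvd_mult_iff by blast
  then show "shift2 a b f dvd u \<or> shift2 a b f dvd v"
    by (metis shift2_dvd shift2_inverse(1))
qed

text \<open>The substitution \<open>Y \<mapsto> X Y\<close> is injective on monomials and turns the total degree into
  the degree in the outer variable \<open>X\<close>, which is additive under multiplication.\<close>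

definition homog :: "real poly poly \<Rightarrow> real poly poly" where
  "homog f = comp2 f [:0, 1:] [:0, [:0, 1:]:]"

definition tdeg :: "real poly poly \<Rightarrow> nat" where
  "tdeg f = degree (homog f)"

lemma ev2_homog [simp]: "ev2 (homog f) x y = ev2 f x (x * y)"
  unfolding homog_def by simp

lemma homog_mult: "homog (f * g) = homog f * homog g"
  by (rule ev2_eqI) simp

lemma homog_0 [simp]: "homog 0 = 0" "homog 1 = 1"
  by (rule ev2_eqI, simp)+

lemma homog_coeff:
  "homog f = (\<Sum>i\<le>degree f. \<Sum>j\<le>degree (coeff f i). monom (monom (coeff (coeff f i) j) j) (i + j))"
proof (rule ev2_eqI)
  fix x y :: real
  have *: "ev2 (monom (monom c j) n) x y = c * x ^ n * y ^ j" for c j n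
    by (simp add: ev2_def poly_monom)
  show "ev2 (homog f) x y = ev2 (\<Sum>i\<le>degree f. \<Sum>j\<le>degree (coeff f i).
      monom (monom (coeff (coeff f i) j) j) (i + j)) x y"
    by (simp add: * ev2_altdef[of f] power_add power_mult_distrib mult_ac)
qed

lemma coeff_homog: "coeff (coeff (homog f) (i + j)) j = coeff (coeff f i) j"
proof -
  have "coeff (coeff (homog f) (i + j)) j =
    (\<Sum>i'\<le>degree f. \<Sum>j'\<le>degree (coeff f i'). if i' = i \<and> j' = j then coeff (coeff f i) j else 0)"
    unfolding homog_coeff by (simp add: coeff_sum) (intro sum.cong refl, auto)
  also have "\<dots> = (\<Sum>i'\<le>degree f. if i' = i then coeff (coeff f i) j else 0)"
    by (intro sum.cong refl) (auto simp: coeff_eq_0 sum.delta)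
  also have "\<dots> = coeff (coeff f i) j"
    by (auto simp: sum.delta coeff_eq_0)
  finally show ?thesis .
qed

lemma le_tdeg: "coeff (coeff f i) j \<noteq> 0 \<Longrightarrow> i + j \<le> tdeg f"
  unfolding tdeg_def using coeff_homog[of f i j] by (intro le_degree) auto

lemma tdeg_le:
  assumes "\<And>i j. coeff (coeff f i) j \<noteq> 0 \<Longrightarrow> i + j \<le> d"
  shows "tdeg f \<le> d"
  unfolding tdeg_def homog_coeff
proof (intro degree_sum_le)
  fix i j
  show "degree (monom (monom (coeff (coeff f i) j) j) (i + j)) \<le> d"
  proof (cases "coeff (coeff f i) j = 0")
    case False
    then show ?thesis using assms[OF False] degree_monom_le[of "monom (coeff (coeff f i) j) j" "i + j"]
      by linarith
  qed simp
qed auto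

lemma homog_eq_0_iff [simp]: "homog f = 0 \<longleftrightarrow> f = 0"
  by (metis coeff_homog homog_0(1) coeff_0 poly_eqI)

lemma tdeg_mult: "f \<noteq> 0 \<Longrightarrow> g \<noteq> 0 \<Longrightarrow> tdeg (f * g) = tdeg f + tdeg g"
  unfolding tdeg_def by (simp add: homog_mult degree_mult_eq)

lemma tdeg_mult_le: "tdeg (f * g) \<le> tdeg f + tdeg g"
  unfolding tdeg_def homog_mult by (rule degree_mult_le)

lemma tdeg_0 [simp]: "tdeg 0 = 0" "tdeg 1 = 0"
  by (simp_all add: tdeg_def)

lemma tdeg_minus [simp]: "tdeg (- f) = tdeg f"
proof -
  have "homog (- f) = - homog f" by (rule ev2_eqI) simp
  then show ?thesis by (simp add: tdeg_def)
qed

lemma tdeg_power_le: "tdeg (f ^ n) \<le> n * tdeg f"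
proof (induction n)
  case (Suc n)
  then show ?case using tdeg_mult_le[of f "f ^ n"] by simp
qed simp

lemma tdeg_sum_le:
  assumes "finite A" "\<And>i. i \<in> A \<Longrightarrow> tdeg (f i) \<le> d"
  shows "tdeg (\<Sum>i\<in>A. f i) \<le> d"
proof -
  have "homog (\<Sum>i\<in>A. f i) = (\<Sum>i\<in>A. homog (f i))" by (rule ev2_eqI) simp
  then show ?thesis unfolding tdeg_def using assms by (auto simp: tdeg_def intro!: degree_sum_le)
qed

lemma tdeg_prod_le: "tdeg (\<Prod>i\<in>A. f i) \<le> (\<Sum>i\<in>A. tdeg (f i))"
proof (induction A rule: infinite_finite_induct)
  case (insert x F)
  then show ?case using tdeg_mult_le[of "f x" "prod f F"] by simp
qed simp_all

lemma degree_le_tdeg: "degree f \<le> tdeg f"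
proof (cases "f = 0")
  case False
  then have "coeff (coeff f (degree f)) (degree (coeff f (degree f))) \<noteq> 0" by simp
  from le_tdeg[OF this] show ?thesis by simp
qed auto

lemma degree_coeff_le_tdeg: "coeff f i \<noteq> 0 \<Longrightarrow> i + degree (coeff f i) \<le> tdeg f"
  by (rule le_tdeg) simp

lemma tdeg_const: "tdeg [:[:c:]:] = 0"
proof -
  have "tdeg [:[:c:]:] \<le> 0" by (rule tdeg_le) (auto simp: coeff_pCons split: nat.splits if_splits)
  then show ?thesis by simp
qed

lemma tdeg_eq_0_imp: "tdeg f = 0 \<Longrightarrow> \<exists>c. f = [:[:c:]:]"
proof -
  assume 0: "tdeg f = 0"
  have "coeff (coeff f i) j = 0" if "i + j > 0" for i j
    using le_tdeg[of f i j] 0 that by auto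
  then have "f = [:[:coeff (coeff f 0) 0:]:]"
    by (intro poly_eqI) (auto simp: coeff_pCons split: nat.splits)
  then show ?thesis by blast
qed

lemma tdeg_comp2_le:
  assumes "tdeg A \<le> 1" "tdeg B \<le> 1"
  shows "tdeg (comp2 f A B) \<le> tdeg f"
  unfolding comp2_def
proof (intro tdeg_sum_le)
  fix i j
  show "tdeg ([:[:coeff (coeff f i) j:]:] * A ^ i * B ^ j) \<le> tdeg f"
  proof (cases "coeff (coeff f i) j = 0")
    case False
    have "tdeg ([:[:coeff (coeff f i) j:]:] * A ^ i * B ^ j) \<le> 0 + i * tdeg A + j * tdeg B"
      using tdeg_mult_le[of "[:[:coeff (coeff f i) j:]:] * A ^ i" "B ^ j"]
        tdeg_mult_le[of "[:[:coeff (coeff f i) j:]:]" "A ^ i"]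
        tdeg_power_le[of A i] tdeg_power_le[of B j] tdeg_const[of "coeff (coeff f i) j"] by linarith
    also have "\<dots> \<le> i + j" using assms mult_le_mono2[of "tdeg A" 1 i] mult_le_mono2[of "tdeg B" 1 j] by linarith
    also have "\<dots> \<le> tdeg f" by (rule le_tdeg[OF False])
    finally show ?thesis .
  qed auto
qed auto

lemma tdeg_shift2_le: "tdeg (shift2 a b f) \<le> tdeg f"
  unfolding shift2_def
  by (intro tdeg_comp2_le; rule tdeg_le) (auto simp: coeff_pCons split: nat.splits if_splits)

section \<open>Bezout's theorem by the Sylvester resultant\<close>

text \<open>In a Sylvester matrix the degree of an entry drops as its column index grows. Along any
  permutation the column indices sum to 0 + 1 + ... + (n - 1), so this amount is saved in every term
  of the determinant. A plain row-wise degree bound would miss the Bezout number.\<close>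

lemma degree_det_le_perm:
  fixes A :: "'a :: idom poly mat" and w :: "nat \<Rightarrow> nat \<Rightarrow> nat"
  assumes A: "A \<in> carrier_mat n n"
    and w: "\<And>i j. i < n \<Longrightarrow> j < n \<Longrightarrow> A $$ (i, j) \<noteq> 0 \<Longrightarrow> degree (A $$ (i, j)) + j \<le> r i"
    and d: "(\<Sum>i<n. r i) \<le> d + (\<Sum>i<n. i)"
  shows "degree (det A) \<le> d"
  unfolding det_def'[OF A]
proof (intro degree_sum_le)
  show "finite {p. p permutes {0..<n}}" by (simp add: finite_permutations)
next
  fix p assume p: "p \<in> {p. p permutes {0..<n}}"
  have sg: "degree (signof p * q) = degree q" for q :: "'a poly"
    by (cases p rule: sign_cases) simp_all
  show "degree (signof p * (\<Prod>i = 0..<n. A $$ (i, p i))) \<le> d"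
  proof (cases "\<exists>i<n. A $$ (i, p i) = 0")
    case True
    then have "(\<Prod>i = 0..<n. A $$ (i, p i)) = 0" by (intro prod_zero) auto
    then show ?thesis by (simp only: mult_zero_right degree_0)
  next
    case False
    have pi: "p i < n" if "i < n" for i
      using p that permutes_in_image[of p "{0..<n}" i] by auto
    have "degree (\<Prod>i = 0..<n. A $$ (i, p i)) \<le> (\<Sum>i = 0..<n. degree (A $$ (i, p i)))"
      using degree_prod_sum_le[of "{0..<n}" "\<lambda>i. A $$ (i, p i)"] by (simp add: o_def)
    moreover have "(\<Sum>i = 0..<n. degree (A $$ (i, p i))) + (\<Sum>i = 0..<n. p i) \<le> (\<Sum>i = 0..<n. r i)"
      unfolding sum.distrib[symmetric] using False w pi by (intro sum_mono) auto
    moreover have "(\<Sum>i = 0..<n. p i) = (\<Sum>i = 0..<n. i)"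
      using p sum.permute[of p "{0..<n}" "\<lambda>i. i"] by simp
    ultimately show ?thesis using d unfolding sg by (simp add: lessThan_atLeast0)
  qed
qed

lemma sum_lessThan_add:
  fixes f :: "nat \<Rightarrow> nat"
  shows "(\<Sum>i<m+n. f i) = (\<Sum>i<m. f i) + (\<Sum>i<n. f (m + i))"
  by (induction n) simp_all

text \<open>\<open>r\<close> is the resultant of \<open>f\<close> and \<open>q\<close> with respect
  to the outer variable. If it vanished, there would be a nontrivial relation A f + B q = 0 with deg
  B < deg f; then the prime \<open>f\<close> divides B, so B = 0 and A = 0.\<close>

lemma bezout_elimination:
  fixes f q :: "real poly poly"
  assumes f: "prime_elem f" and nd: "\<not> f dvd q" and pos: "degree f + degree q > 0"
  obtains r where "r \<noteq> 0" "degree r \<le> tdeg f * tdeg q"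
    "\<And>x y. ev2 f x y = 0 \<Longrightarrow> ev2 q x y = 0 \<Longrightarrow> poly r y = 0"
proof -
  define m where "m = degree f"
  define n where "n = degree q"
  define N where "N = n + m"
  define R where "R i = (if i < n then monom 1 i * f else monom 1 (i - n) * q)" for i
  define S where "S = mat N N (\<lambda>(i, j). coeff (R i) j)"
  have S: "S \<in> carrier_mat N N" by (simp add: S_def)
  have N: "N > 0" using pos by (auto simp: N_def m_def n_def)
  have f0: "f \<noteq> 0" and q0: "q \<noteq> 0" using f nd by auto
  have degR: "degree (R i) < N" if "i < N" for i
    using that f0 q0 unfolding R_def N_def m_def n_def
    by (auto simp: degree_mult_eq degree_monom_eq monom_eq_0_iff)
  have "det S \<noteq> 0"
  proof
    assume "det S = 0"
    then have "det S\<^sup>T = 0" using det_transpose[OF S] by simp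
    then obtain v where v: "v \<in> carrier_vec N" "v \<noteq> 0\<^sub>v N" "S\<^sup>T *\<^sub>v v = 0\<^sub>v N"
      using det_0_iff_vec_prod_zero[of "S\<^sup>T" N] S by auto
    have vS: "(\<Sum>i<N. v $ i * coeff (R i) j) = 0" if "j < N" for j
    proof -
      have "(S\<^sup>T *\<^sub>v v) $ j = (\<Sum>i<N. S\<^sup>T $$ (j, i) * v $ i)"
        using that S v(1) by (simp add: scalar_prod_def lessThan_atLeast0)
      also have "\<dots> = (\<Sum>i<N. v $ i * coeff (R i) j)"
        using that S by (intro sum.cong refl) (simp add: S_def mult.commute)
      finally show ?thesis using v(3) that by simp
    qed
    define A where "A = (\<Sum>i<n. monom (v $ i) i)"
    define B where "B = (\<Sum>i<m. monom (v $ (n + i)) i)"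
    have cA: "coeff A i = (if i < n then v $ i else 0)" for i
      unfolding A_def by (simp add: coeff_sum sum.delta')
    have cB: "coeff B i = (if i < m then v $ (n + i) else 0)" for i
      unfolding B_def by (simp add: coeff_sum sum.delta')
    have "(\<Sum>i<N. Polynomial.smult (v $ i) (R i)) = 0"
    proof (rule poly_eqI)
      fix j
      show "coeff (\<Sum>i<N. Polynomial.smult (v $ i) (R i)) j = coeff 0 j"
      proof (cases "j < N")
        case True
        then show ?thesis using vS by (simp add: coeff_sum)
      next
        case False
        then have "coeff (R i) j = 0" if "i < N" for i
          using degR[OF that] by (intro coeff_eq_0) simp
        then show ?thesis by (simp add: coeff_sum)
      qed
    qed
    also have "(\<Sum>i<N. Polynomial.smult (v $ i) (R i)) =
      (\<Sum>i<n. Polynomial.smult (v $ i) (R i)) + (\<Sum>i<m. Polynomial.smult (v $ (n + i)) (R (n + i)))"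
      unfolding N_def by (induction m) simp_all
    also have "(\<Sum>i<n. Polynomial.smult (v $ i) (R i)) = A * f"
      unfolding A_def sum_distrib_right by (intro sum.cong refl) (simp add: R_def smult_monom flip: mult_smult_left)
    also have "(\<Sum>i<m. Polynomial.smult (v $ (n + i)) (R (n + i))) = B * q"
      unfolding B_def sum_distrib_right by (intro sum.cong refl) (simp add: R_def smult_monom flip: mult_smult_left)
    finally have eq: "A * f + B * q = 0" .
    then have "B * q = (- A) * f" by (metis add.commute eq_neg_iff_add_eq_0 minus_mult_left)
    then have "f dvd B * q" by (metis dvd_triv_right)
    then have "f dvd B" using nd prime_elem_dvd_mult_iff[OF f] by auto
    have B0: "B = 0"
    proof (rule ccontr)
      assume "B \<noteq> 0"
      then have "m \<le> degree B" using \<open>f dvd B\<close> dvd_imp_degree_le m_def by blast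
      moreover have "coeff B (degree B) \<noteq> 0" using \<open>B \<noteq> 0\<close> by simp
      ultimately show False unfolding cB by simp
    qed
    then have A0: "A = 0" using eq f0 by simp
    have "v = 0\<^sub>v N"
    proof (rule eq_vecI)
      fix i assume "i < dim_vec (0\<^sub>v N :: real poly vec)"
      then have i: "i < N" by simp
      show "v $ i = 0\<^sub>v N $ i"
      proof (cases "i < n")
        case True
        then show ?thesis using cA[of i] A0 i by simp
      next
        case False
        then obtain i' where "i = n + i'" "i' < m"
          using i unfolding N_def by (metis add_less_cancel_left le_add_diff_inverse not_less)
        then show ?thesis using cB[of i'] B0 i by simp
      qed
    qed (use v(1) in auto)
    then show False using v(2) by simp
  qed
  moreover have "degree (det S) \<le> tdeg f * tdeg q"
  proof (rule degree_det_le_perm[OF S, where r = "\<lambda>i. if i < n then tdeg f + i else tdeg q + (i - n)"])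
    fix i j assume ij: "i < N" "j < N" "S $$ (i, j) \<noteq> 0"
    then have nz: "coeff (R i) j \<noteq> 0" by (simp add: S_def)
    show "degree (S $$ (i, j)) + j \<le> (if i < n then tdeg f + i else tdeg q + (i - n))"
    proof (cases "i < n")
      case True
      then have "j \<ge> i" "coeff f (j - i) \<noteq> 0" "coeff (R i) j = coeff f (j - i)"
        using nz by (auto simp: R_def coeff_monom_mult split: if_splits)
      then show ?thesis using degree_coeff_le_tdeg[of f "j - i"] True ij by (simp add: S_def)
    next
      case False
      then have "j \<ge> i - n" "coeff q (j - (i - n)) \<noteq> 0" "coeff (R i) j = coeff q (j - (i - n))"
        using nz by (auto simp: R_def coeff_monom_mult split: if_splits)
      then show ?thesis using degree_coeff_le_tdeg[of q "j - (i - n)"] False ij by (simp add: S_def)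
    qed
  next
    have le: "m \<le> tdeg f" "n \<le> tdeg q" unfolding m_def n_def by (rule degree_le_tdeg)+
    have "(\<Sum>i<N. if i < n then tdeg f + i else tdeg q + (i - n)) =
      (\<Sum>i<n. tdeg f + i) + (\<Sum>i<m. tdeg q + i)"
      unfolding N_def sum_lessThan_add by simp
    also have "\<dots> = n * tdeg f + m * tdeg q + (\<Sum>i<n. i) + (\<Sum>i<m. i)"
      by (simp add: sum.distrib)
    \<comment> \<open>This is (tdeg f - m) (tdeg q - n) >= 0.\<close>
    also have "\<dots> \<le> tdeg f * tdeg q + m * n + (\<Sum>i<n. i) + (\<Sum>i<m. i)"
    proof -
      obtain a b where ab: "tdeg f = m + a" "tdeg q = n + b" using le le_Suc_ex by metis
      show ?thesis unfolding ab by (simp add: algebra_simps)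
    qed
    also have "\<dots> = tdeg f * tdeg q + (\<Sum>i<N. i)"
      unfolding N_def sum_lessThan_add by (simp add: sum.distrib algebra_simps)
    finally show "(\<Sum>i<N. if i < n then tdeg f + i else tdeg q + (i - n)) \<le> tdeg f * tdeg q + (\<Sum>i<N. i)" .
  qed
  moreover have "poly (det S) y = 0" if "ev2 f x y = 0" "ev2 q x y = 0" for x y
  proof -
    interpret comm_ring_hom "\<lambda>p. poly p y" by unfold_locales auto
    define M where "M = map_mat (\<lambda>p. poly p y) S"
    \<comment> \<open>At a common zero all row polynomials vanish, so the vector of powers of x lies
      in the kernel; it is nonzero because it begins with 1.\<close>
    define w where "w = vec N (\<lambda>j. x ^ j)"
    have M: "M \<in> carrier_mat N N" using S by (simp add: M_def)
    have "M *\<^sub>v w = 0\<^sub>v N"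
    proof (rule eq_vecI)
      fix i assume "i < dim_vec (0\<^sub>v N :: real vec)"
      then have i: "i < N" by simp
      have "(M *\<^sub>v w) $ i = (\<Sum>j<N. poly (coeff (R i) j) y * x ^ j)"
        using i M by (simp add: scalar_prod_def lessThan_atLeast0 M_def w_def S_def)
      also have "\<dots> = (\<Sum>j\<le>degree (R i). poly (coeff (R i) j) y * x ^ j)"
        using degR[OF i] by (intro sum.mono_neutral_right) (auto simp: coeff_eq_0)
      also have "\<dots> = ev2 (R i) x y" by (simp add: ev2_def poly_altdef[of "R i"] poly_sum)
      also have "\<dots> = 0" using that by (simp add: R_def)
      finally show "(M *\<^sub>v w) $ i = 0\<^sub>v N $ i" using i by simp
    qed (use M in auto)
    moreover have "w \<noteq> 0\<^sub>v N"
    proof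
      assume "w = 0\<^sub>v N"
      then have "w $ 0 = 0" using N by simp
      then show False using N by (simp add: w_def)
    qed
    moreover have "w \<in> carrier_vec N" by (simp add: w_def)
    ultimately have "det M = 0"
      using det_0_iff_vec_prod_zero[OF M] by blast
    then show ?thesis unfolding M_def by simp
  qed
  ultimately show ?thesis using that by blast
qed

text \<open>The zeros are counted through the resultant, a polynomial in y alone; this is why the
  points of \<open>Z\<close> must have distinct second coordinates.\<close>

lemma bezout_card_le:
  fixes f q :: "real poly poly"
  assumes f: "prime_elem f" and nd: "\<not> f dvd q"
    and Z: "finite Z" "inj_on snd Z" "\<And>x y. (x, y) \<in> Z \<Longrightarrow> ev2 f x y = 0 \<and> ev2 q x y = 0"
  shows "card Z \<le> tdeg f * tdeg q"
proof (cases "degree f + degree q > 0")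
  case True
  obtain r where r: "r \<noteq> 0" "degree r \<le> tdeg f * tdeg q"
    "\<And>x y. ev2 f x y = 0 \<Longrightarrow> ev2 q x y = 0 \<Longrightarrow> poly r y = 0"
    using bezout_elimination[OF f nd True] by blast
  have "card Z = card (snd ` Z)" using Z by (simp add: card_image)
  also have "\<dots> \<le> card {y. poly r y = 0}"
    using r(1) Z(3) r(3) by (intro card_mono poly_roots_finite) (fastforce+)
  also have "\<dots> \<le> degree r" by (rule card_poly_roots_bound[OF r(1)])
  finally show ?thesis using r(2) by simp
next
  \<comment> \<open>Both polynomials depend on y only. At a common root y the prime \<open>f\<close>
    would divide the linear factor Y - y, which divides \<open>q\<close>.\<close>
  case False
  then obtain f0 q0 where fq: "f = [:f0:]" "q = [:q0:]"
    by (metis add_is_0 degree_0_id gr0I degree_eq_zeroE)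
  have "Z = {}"
  proof (rule ccontr)
    assume "Z \<noteq> {}"
    then obtain x y where "(x, y) \<in> Z" by auto
    then have y: "poly f0 y = 0" "poly q0 y = 0" using Z(3)[of x y] by (auto simp: fq)
    then obtain c where c: "f0 = [:-y, 1:] * c" by (auto simp: poly_eq_0_iff_dvd dvd_def)
    have "f = [:[:-y, 1:]:] * [:c:]" by (simp add: fq c)
    then have "f dvd [:[:-y, 1:]:] \<or> f dvd [:c:]"
      using f by (metis dvd_refl prime_elem_dvd_mult_iff)
    then show False
    proof
      assume "f dvd [:[:-y, 1:]:]"
      moreover have "[:[:-y, 1:]:] dvd q" using y(2)
        by (auto simp: fq poly_eq_0_iff_dvd const_poly_dvd_const_poly_iff)
      ultimately show False using nd dvd_trans by blast
    next
      assume "f dvd [:c:]"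
      then have "f0 dvd c" by (simp add: fq const_poly_dvd_const_poly_iff)
      moreover have "c \<noteq> 0" "f0 \<noteq> 0" using f c fq by auto
      ultimately have "degree f0 \<le> degree c" by (simp add: dvd_imp_degree_le)
      then show False using c \<open>c \<noteq> 0\<close> by (simp add: degree_mult_eq del: mult_pCons_left)
    qed
  qed
  then show ?thesis by simp
qed

section \<open>Zeros on lines and grids, and the number of prime factors\<close>

lemma infinite_zeros_line:
  assumes "\<And>n::nat. ev2 f (x0 + real n * a) (y0 + real n * b) = 0"
  shows "ev2 f (x0 + t * a) (y0 + t * b) = 0"
proof -
  obtain q where q: "\<And>t. poly q t = ev2 f (poly [:x0, a:] t) (poly [:y0, b:] t)"
    using ev2_line_poly[of f "[:x0, a:]" "[:y0, b:]"] by blast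
  have "poly q (real n) = 0" for n using assms[of n] by (simp add: q)
  then have "range real \<subseteq> {t. poly q t = 0}" by auto
  moreover have "infinite (range real)"
    using finite_imageD[of real UNIV] by (auto simp: inj_def)
  ultimately have "q = 0" using poly_roots_finite finite_subset by blast
  then show ?thesis using q[of t] by simp
qed

text \<open>The zeros first spread from the grid to parallel lines, then across these lines to the
  whole plane.\<close>

lemma zero_on_grid_imp_zero:
  fixes a b c d :: real
  assumes grid: "\<And>m n::nat. ev2 f (x0 + real m * a + real n * c) (y0 + real m * b + real n * d) = 0"
    and ind: "a * d \<noteq> b * c"
  shows "f = 0"
proof (rule ev2_zero_imp)
  have 1: "ev2 f (x0 + real n * c + s * a) (y0 + real n * d + s * b) = 0" for n s
    by (rule infinite_zeros_line) (use grid in \<open>simp add: add_ac\<close>)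
  have 2: "ev2 f (x0 + s * a + t * c) (y0 + s * b + t * d) = 0" for s t
    by (rule infinite_zeros_line) (use 1 in \<open>simp add: add_ac\<close>)
  fix x y
  let ?D = "a * d - b * c"
  define s where "s = ((x - x0) * d - (y - y0) * c) / ?D"
  define t where "t = ((y - y0) * a - (x - x0) * b) / ?D"
  have "?D \<noteq> 0" using ind by simp
  have "s * a + t * c = (((x - x0) * d - (y - y0) * c) * a + ((y - y0) * a - (x - x0) * b) * c) / ?D"
    by (simp add: s_def t_def add_divide_distrib)
  also have "((x - x0) * d - (y - y0) * c) * a + ((y - y0) * a - (x - x0) * b) * c = (x - x0) * ?D"
    by (simp add: algebra_simps)
  finally have "x = x0 + s * a + t * c" using \<open>?D \<noteq> 0\<close> by simp
  have "s * b + t * d = (((x - x0) * d - (y - y0) * c) * b + ((y - y0) * a - (x - x0) * b) * d) / ?D"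
    by (simp add: s_def t_def add_divide_distrib)
  also have "((x - x0) * d - (y - y0) * c) * b + ((y - y0) * a - (x - x0) * b) * d = (y - y0) * ?D"
    by (simp add: algebra_simps)
  finally have "y = y0 + s * b + t * d" using \<open>?D \<noteq> 0\<close> by simp
  with \<open>x = _\<close> show "ev2 f x y = 0" using 2[of s t] by simp
qed

text \<open>\<open>prime\<close> includes being normalised, so distinct members of \<open>A\<close>
  are not associated and their product divides \<open>Q\<close>. Each contributes at least 1 to the
  total degree, since nonzero real constants are units.\<close>

lemma card_prime_divisors_le:
  fixes Q :: "real poly poly"
  assumes Q: "Q \<noteq> 0" and A: "finite A"
    "\<And>p. p \<in> A \<Longrightarrow> prime p \<and> p dvd Q"
  shows "card A \<le> tdeg Q"
proof -
  have "\<Prod>A dvd Q" using A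
  proof (induction A rule: finite_induct)
    case (insert p A)
    then obtain R where R: "Q = \<Prod>A * R" by (auto simp: dvd_def)
    have "\<not> p dvd \<Prod>A"
    proof
      assume "p dvd \<Prod>A"
      then obtain q where "q \<in> A" "p dvd q"
        using insert.prems insert.hyps prime_dvd_prod_iff[of A p "\<lambda>x. x"] by auto
      then have "p = q" using insert.prems primes_dvd_imp_eq by blast
      then show False using \<open>q \<in> A\<close> insert.hyps by simp
    qed
    then have "p dvd R" using insert.prems R prime_dvd_mult_iff by blast
    then show ?case using R insert.hyps by (auto simp: dvd_def mult_ac)
  qed simp
  then obtain R where R: "Q = \<Prod>A * R" by (auto simp: dvd_def)
  have "card A \<le> (\<Sum>p\<in>A. tdeg p)"
  proof -
    have "1 \<le> tdeg p" if "p \<in> A" for p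
    proof (rule ccontr)
      assume "\<not> 1 \<le> tdeg p"
      then obtain c where c: "p = [:[:c:]:]" using tdeg_eq_0_imp[of p] by auto
      moreover have "p \<noteq> 0" using A(2)[OF that] not_prime_0 by blast
      ultimately have "p * [:[:1 / c:]:] = 1" by (simp add: one_pCons)
      then have "p dvd 1" by (metis dvd_triv_left)
      then show False using A that not_prime_unit by blast
    qed
    then show ?thesis using sum_mono[of A "\<lambda>_. 1" tdeg] by simp
  qed
  also have "(\<Sum>p\<in>A. tdeg p) = tdeg (\<Prod>A)"
    using A
  proof (induction A rule: finite_induct)
    case (insert p A)
    then have "p \<noteq> 0" "\<Prod>A \<noteq> 0"
      using not_prime_0 by (metis insertI1, metis insertI2 prod_zero_iff)
    then show ?case using insert by (simp add: tdeg_mult)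
  qed simp
  also have "\<dots> \<le> tdeg Q" using Q R by (auto simp: tdeg_mult)
  finally show ?thesis .
qed

lemma pigeonhole_fiber:
  assumes "finite W" "finite C" "f ` W \<subseteq> C" "W \<noteq> {}" "card C \<le> D"
  obtains c where "card W \<le> card {w \<in> W. f w = c} * D"
proof -
  have "\<exists>c\<in>C. card W \<le> card {w \<in> W. f w = c} * D"
  proof (rule ccontr)
    assume "\<not> ?thesis"
    then have lt: "card {w \<in> W. f w = c} * D < card W" if "c \<in> C" for c using that by auto
    have C: "C \<noteq> {}" using assms by auto
    have "W = (\<Union>c\<in>C. {w \<in> W. f w = c})" using assms by auto
    then have "card W \<le> (\<Sum>c\<in>C. card {w \<in> W. f w = c})"
      using card_UN_le[OF \<open>finite C\<close>, of "\<lambda>c. {w \<in> W. f w = c}"] by simp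
    then have "card W * D \<le> (\<Sum>c\<in>C. card {w \<in> W. f w = c} * D)"
      by (simp add: sum_distrib_right[symmetric])
    also have "\<dots> < (\<Sum>c\<in>C. card W)"
      using C \<open>finite C\<close> lt by (intro sum_strict_mono) auto
    also have "\<dots> \<le> card W * D" using assms(5) by simp
    finally show False by simp
  qed
  then show ?thesis using that by blast
qed

section \<open>Zero estimates\<close>

text \<open>A Bezout-type zero estimate on sumsets: by Bezout's theorem some prime factor of \<open>Q\<close>
  divides all translates of \<open>Q\<close> by points of \<open>W\<close>, so many of its own translates coincide, and its
  zero set is invariant under the corresponding differences, which must then be parallel.\<close>

lemma zero_estimate_sumset:
  fixes Q :: "real poly poly" and W :: "(real \<times> real) set"
  assumes Q: "Q \<noteq> 0" "tdeg Q \<le> D"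
    and W: "finite W" "inj_on snd W" "(0, 0) \<in> W" "card W > D * D"
    and zero: "\<And>x y x' y'. (x, y) \<in> W \<Longrightarrow> (x', y') \<in> W \<Longrightarrow> ev2 Q (x + x') (y + y') = 0"
  obtains S where "S \<subseteq> W" "card W \<le> card S * D"
    "\<And>x0 y0 x1 y1 x2 y2. (x0, y0) \<in> S \<Longrightarrow> (x1, y1) \<in> S \<Longrightarrow> (x2, y2) \<in> S \<Longrightarrow>
      (x1 - x0) * (y2 - y0) = (y1 - y0) * (x2 - x0)"
proof -
  define Z where "Z f = {(x, y) \<in> W. ev2 f x y = 0}" for f
  have finZ: "finite (Z f)" for f using W(1) by (auto simp: Z_def intro: finite_subset)
  have ZQ: "Z Q = W" using zero[OF _ W(3)] by (auto simp: Z_def)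
  \<comment> \<open>The total degree is additive over prime factors and the number of zeros
    subadditive; if every prime factor had at most \<open>tdeg p * D\<close> zeros in
    \<open>W\<close>, then \<open>W\<close> would have at most \<open>D * D\<close> points.\<close>
  obtain f where f: "prime f" "f dvd Q" "card (Z f) > tdeg f * D"
  proof (rule ccontr)
    assume "\<not> thesis"
    then have small: "card (Z p) \<le> tdeg p * D" if "prime p" "p dvd Q" for p
      using that \<open>\<And>f. prime f \<Longrightarrow> f dvd Q \<Longrightarrow> tdeg f * D < card (Z f) \<Longrightarrow> thesis\<close> not_less by blast
    have "R dvd Q \<Longrightarrow> card (Z R) \<le> tdeg R * D" if "R \<noteq> 0" for R using that
    proof (induction R rule: prime_divisors_induct)
      case (unit x)
      then obtain c where c: "x * c = 1" by (auto simp: dvd_def)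
      have "Z x = {}"
      proof -
        have "ev2 x a b \<noteq> 0" for a b
          using arg_cong[OF c, of "\<lambda>g. ev2 g a b"] by auto
        then show ?thesis by (auto simp: Z_def)
      qed
      then show ?case by simp
    next
      case (factor p x)
      then have "Z (p * x) \<subseteq> Z p \<union> Z x" by (auto simp: Z_def)
      then have "card (Z (p * x)) \<le> card (Z p) + card (Z x)"
        using finZ by (meson card_Un_le card_mono finite_UnI order.trans)
      also have "\<dots> \<le> tdeg p * D + tdeg x * D"
        using factor small[of p] by (intro add_mono) (auto dest: dvd_mult_left dvd_mult_right)
      also have "\<dots> = tdeg (p * x) * D" using factor by (simp add: tdeg_mult algebra_simps)
      finally show ?case .
    qed simp
    from this[OF Q(1)] have "card W \<le> tdeg Q * D" by (simp add: ZQ)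
    also have "\<dots> \<le> D * D" using Q(2) by simp
    finally show False using W(4) by simp
  qed
  then have pf: "prime_elem f" by auto
  have "Z f \<noteq> {}" using f(3) by auto
  then obtain z1 z2 where z: "ev2 f z1 z2 = 0" by (auto simp: Z_def)
  have dv: "f dvd shift2 a b Q" if ab: "(a, b) \<in> W" for a b
  proof (rule ccontr)
    assume nd: "\<not> f dvd shift2 a b Q"
    have "card (Z f) \<le> tdeg f * tdeg (shift2 a b Q)"
    proof (rule bezout_card_le[OF pf nd finZ])
      show "inj_on snd (Z f)" using W(2) by (rule inj_on_subset) (auto simp: Z_def)
      show "\<And>x y. (x, y) \<in> Z f \<Longrightarrow> ev2 f x y = 0 \<and> ev2 (shift2 a b Q) x y = 0"
        using zero ab by (auto simp: Z_def)
    qed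
    also have "\<dots> \<le> tdeg f * D" using tdeg_shift2_le[of a b Q] Q(2) by (intro mult_left_mono) auto
    finally show False using f(3) by simp
  qed
  \<comment> \<open>Translated back, all these divisibilities concern \<open>Q\<close> itself: the
    normalised translates of \<open>f\<close> are primes dividing \<open>Q\<close>, so at most
    \<open>D\<close> of them are distinct.\<close>
  define F where "F w = normalize (shift2 (- fst w) (- snd w) f)" for w
  have F: "prime (F w) \<and> F w dvd Q" if "w \<in> W" for w
  proof -
    obtain a b where w: "w = (a, b)" by force
    have "prime_elem (shift2 (- a) (- b) f)" by (rule prime_elem_shift2[OF pf])
    moreover have "shift2 (- a) (- b) f dvd Q"
      using shift2_dvd[OF dv[of a b], of "- a" "- b"] that w by simp
    ultimately show ?thesis by (auto simp: F_def w)
  qed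
  have "card (F ` W) \<le> D"
    using card_prime_divisors_le[OF Q(1), of "F ` W"] F W(1) Q(2) by fastforce
  then obtain c where c: "card W \<le> card {w \<in> W. F w = c} * D"
    using pigeonhole_fiber[of W "F ` W" F D] W(1,3) by blast
  define S where "S = {w \<in> W. F w = c}"
  have inv: "ev2 f (x + (a' - a)) (y + (b' - b)) = 0"
    if S: "(a, b) \<in> S" "(a', b') \<in> S" and xy: "ev2 f x y = 0" for a b a' b' x y
  proof -
    have "normalize (shift2 (- a) (- b) f) = normalize (shift2 (- a') (- b') f)"
      using S by (auto simp: S_def F_def)
    then have "shift2 (- a) (- b) f dvd shift2 (- a') (- b') f"
      by (simp add: associated_iff_dvd)
    then obtain u where "shift2 (- a') (- b') f = shift2 (- a) (- b) f * u" by (auto simp: dvd_def)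
    from arg_cong[OF this, of "\<lambda>g. ev2 g (x + a') (y + b')"]
    have "ev2 f x y = ev2 f (x + (a' - a)) (y + (b' - b)) * ev2 u (x + a') (y + b')"
      by (simp add: algebra_simps)
    moreover from \<open>normalize _ = _\<close> have "shift2 (- a') (- b') f dvd shift2 (- a) (- b) f"
      by (simp add: associated_iff_dvd)
    then obtain u' where "shift2 (- a) (- b) f = shift2 (- a') (- b') f * u'" by (auto simp: dvd_def)
    from arg_cong[OF this, of "\<lambda>g. ev2 g (x + a') (y + b')"]
    have "ev2 f (x + (a' - a)) (y + (b' - b)) = ev2 f x y * ev2 u' (x + a') (y + b')"
      by (simp add: algebra_simps)
    ultimately show ?thesis using xy by simp
  qed
  have inv_n: "ev2 f (x + real n * (a' - a)) (y + real n * (b' - b)) = 0"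
    if S: "(a, b) \<in> S" "(a', b') \<in> S" and xy: "ev2 f x y = 0" for a b a' b' x y n
  proof (induction n)
    case (Suc n)
    from inv[OF S Suc] show ?case by (simp add: algebra_simps)
  qed (simp add: xy)
  show ?thesis
  proof (rule that)
    show "S \<subseteq> W" by (auto simp: S_def)
    show "card W \<le> card S * D" using c by (simp add: S_def)
    fix x0 y0 x1 y1 x2 y2
    assume S: "(x0, y0) \<in> S" "(x1, y1) \<in> S" "(x2, y2) \<in> S"
    show "(x1 - x0) * (y2 - y0) = (y1 - y0) * (x2 - x0)"
    proof (rule ccontr)
      assume "(x1 - x0) * (y2 - y0) \<noteq> (y1 - y0) * (x2 - x0)"
      moreover have "ev2 f (z1 + real m * (x1 - x0) + real n * (x2 - x0))
          (z2 + real m * (y1 - y0) + real n * (y2 - y0)) = 0" for m n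
        by (intro inv_n S z)
      ultimately have "f = 0" by (intro zero_on_grid_imp_zero)
      then show False using f(1) by simp
    qed
  qed
qed

section \<open>Descartes' bound and generalised Vandermonde determinants\<close>

lemma rolle_card_roots:
  fixes f :: "real poly"
  assumes "pderiv f \<noteq> 0" "finite A" "\<And>y. y \<in> A \<Longrightarrow> y > 0 \<and> poly f y = 0"
  shows "card A \<le> card {y. y > 0 \<and> poly (pderiv f) y = 0} + 1"
proof (cases "A = {}")
  case False
  define nx where "nx a = Min {b \<in> A. b > a}" for a
  define B where "B = A - {Max A}"
  have nx: "nx a \<in> A" "a < nx a" "\<And>b. b \<in> A \<Longrightarrow> a < b \<Longrightarrow> nx a \<le> b" if "a \<in> B" for a
  proof -
    have "a \<in> A" "a \<noteq> Max A" using that by (auto simp: B_def)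
    then have "Max A \<in> {b \<in> A. b > a}" using assms(2) False by (simp add: less_le)
    then have "Min {b \<in> A. b > a} \<in> {b \<in> A. b > a}"
      using assms(2) by (intro Min_in) auto
    then show "nx a \<in> A" "a < nx a" by (auto simp: nx_def)
    show "nx a \<le> b" if "b \<in> A" "a < b" for b
      unfolding nx_def using that assms(2) by (intro Min_le) auto
  qed
  have "\<exists>z. a < z \<and> z < nx a \<and> poly (pderiv f) z = 0" if "a \<in> B" for a
  proof -
    have "a \<in> A" using that by (simp add: B_def)
    then have eq: "poly f a = poly f (nx a)" using assms(3) nx(1)[OF that] by simp
    have lt: "a < nx a" using nx(2)[OF that] .
    obtain z where "a < z" "z < nx a" "poly f (nx a) - poly f a = (nx a - a) * poly (pderiv f) z"
      using poly_MVT[OF lt, of f] by blast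
    then show ?thesis using eq lt by auto
  qed
  then obtain z where z: "\<And>a. a \<in> B \<Longrightarrow> a < z a \<and> z a < nx a \<and> poly (pderiv f) (z a) = 0" by metis
  have "inj_on z B"
  proof (rule linorder_inj_onI')
    fix a b assume ab: "a \<in> B" "b \<in> B" "a < b"
    then have "nx a \<le> b" using nx(3)[of a b] by (auto simp: B_def)
    then show "z a \<noteq> z b" using z[OF ab(1)] z[OF ab(2)] by auto
  qed
  then have "card B = card (z ` B)" by (simp add: card_image)
  also have "\<dots> \<le> card {y. y > 0 \<and> poly (pderiv f) y = 0}"
  proof (intro card_mono)
    show "finite {y. 0 < y \<and> poly (pderiv f) y = 0}"
      using poly_roots_finite[OF assms(1)] by (auto intro: finite_subset)
    show "z ` B \<subseteq> {y. 0 < y \<and> poly (pderiv f) y = 0}"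
    proof (intro image_subsetI CollectI conjI)
      fix a assume a: "a \<in> B"
      then have "a > 0" using assms(3) by (auto simp: B_def)
      then show "0 < z a" using z[OF a] by auto
      show "poly (pderiv f) (z a) = 0" using z[OF a] by auto
    qed
  qed
  finally show ?thesis
    using assms(2) False by (simp add: B_def)
qed simp

text \<open>A factor X can be removed without changing either side. If the constant term is nonzero,
  differentiation removes exactly this one coefficient and, by Rolle, loses at most one positive
  root.\<close>

lemma descartes_card_pos_roots:
  fixes f :: "real poly"
  assumes "f \<noteq> 0"
  shows "card {y. y > 0 \<and> poly f y = 0} < card {i. coeff f i \<noteq> 0}"
  using assms
proof (induction "degree f" arbitrary: f rule: less_induct)
  case less
  have fin: "finite {i. coeff g i \<noteq> 0}" for g :: "real poly"
    using MOST_coeff_eq_0[of g] by (simp add: MOST_iff_finiteNeg)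
  show ?case
  proof (cases "degree f = 0")
    case True
    then obtain c where c: "f = [:c:]" by (metis degree_eq_zeroE)
    then have "c \<noteq> 0" using less.prems by simp
    then have *: "{y. y > 0 \<and> poly f y = 0} = {}" "{i. coeff f i \<noteq> 0} = {0}"
      using coeff_eq_0[of "[:c:]"] by (auto simp: c)
    show ?thesis unfolding * by simp
  next
    case deg: False
    obtain c g where g: "f = pCons c g" by (cases f) auto
    have "g \<noteq> 0" using g deg by auto
    show ?thesis
    proof (cases "c = 0")
      case True
      then have "card {y. y > 0 \<and> poly g y = 0} < card {i. coeff g i \<noteq> 0}"
        using \<open>g \<noteq> 0\<close> g by (intro less.hyps) auto
      moreover have "{y. y > 0 \<and> poly f y = 0} = {y. y > 0 \<and> poly g y = 0}"
        by (auto simp: g True)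
      moreover have "{i. coeff f i \<noteq> 0} = Suc ` {i. coeff g i \<noteq> 0}"
      proof (intro Set.set_eqI iffI)
        fix i assume "i \<in> {i. coeff f i \<noteq> 0}"
        then show "i \<in> Suc ` {i. coeff g i \<noteq> 0}" by (cases i) (auto simp: g True)
      qed (auto simp: g)
      ultimately show ?thesis by (simp add: card_image)
    next
      case False
      have pd: "pderiv f \<noteq> 0" using deg by (simp add: pderiv_eq_0_iff)
      have "{i. coeff f i \<noteq> 0} = insert 0 (Suc ` {i. coeff (pderiv f) i \<noteq> 0})"
      proof (intro Set.set_eqI iffI)
        fix i assume "i \<in> {i. coeff f i \<noteq> 0}"
        then show "i \<in> insert 0 (Suc ` {i. coeff (pderiv f) i \<noteq> 0})"
          by (cases i) (auto simp: coeff_pderiv)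
      qed (use False in \<open>auto simp: coeff_pderiv g\<close>)
      then have "card {i. coeff f i \<noteq> 0} = card {i. coeff (pderiv f) i \<noteq> 0} + 1"
        using fin by (simp add: card_image)
      moreover have "card {y. y > 0 \<and> poly (pderiv f) y = 0} < card {i. coeff (pderiv f) i \<noteq> 0}"
        using deg pd by (intro less.hyps) (auto simp: degree_pderiv)
      moreover have "card {y. y > 0 \<and> poly f y = 0} \<le> card {y. y > 0 \<and> poly (pderiv f) y = 0} + 1"
      proof (rule rolle_card_roots[OF pd])
        show "finite {y. 0 < y \<and> poly f y = 0}"
          using poly_roots_finite[OF less.prems] by (auto intro: finite_subset)
      qed auto
      ultimately show ?thesis by simp
    qed
  qed
qed

text \<open>A kernel vector would give a nonzero polynomial with at most n terms and n positive
  roots, against Descartes' bound. The factors \<open>l c\<close> will be leading coefficients of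
  the polynomials to be eliminated.\<close>

lemma gen_vandermonde_det:
  fixes y l :: "nat \<Rightarrow> real" and e :: "nat \<Rightarrow> nat"
  assumes y: "\<And>i. i < n \<Longrightarrow> y i > 0" "inj_on y {..<n}" and e: "inj_on e {..<n}"
    and l: "\<And>c. c < n \<Longrightarrow> l c \<noteq> 0"
  shows "det (mat n n (\<lambda>(i, c). l c * y i ^ e c)) \<noteq> 0"
proof
  let ?A = "mat n n (\<lambda>(i, c). l c * y i ^ e c)"
  assume "det ?A = 0"
  then obtain v where v: "v \<in> carrier_vec n" "v \<noteq> 0\<^sub>v n" "?A *\<^sub>v v = 0\<^sub>v n"
    using det_0_iff_vec_prod_zero[of ?A n] by auto
  define f where "f = (\<Sum>c<n. monom (l c * v $ c) (e c))"
  have coeff_f: "coeff f (e c) = l c * v $ c" if "c < n" for c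
  proof -
    have "coeff f (e c) = (\<Sum>c'<n. if c' = c then l c * v $ c else 0)"
      unfolding f_def coeff_sum using that e by (intro sum.cong) (auto dest: inj_onD)
    then show ?thesis using that by (simp add: sum.delta)
  qed
  have "f \<noteq> 0"
  proof
    assume "f = 0"
    then have "v $ c = 0" if "c < n" for c using coeff_f[OF that] l[OF that] by simp
    then have "v = 0\<^sub>v n" using v(1) by (intro eq_vecI) auto
    then show False using v(2) by simp
  qed
  have root: "poly f (y i) = 0" if "i < n" for i
  proof -
    have "poly f (y i) = (?A *\<^sub>v v) $ i"
      using that v(1) by (simp add: f_def poly_sum poly_monom scalar_prod_def lessThan_atLeast0 mult_ac)
    then show ?thesis using v(3) that by simp
  qed
  have "n = card (y ` {..<n})" using y(2) by (simp add: card_image)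
  also have "\<dots> \<le> card {z. z > 0 \<and> poly f z = 0}"
    using root y(1) poly_roots_finite[OF \<open>f \<noteq> 0\<close>]
    by (intro card_mono) (auto intro: finite_subset[of _ "{z. poly f z = 0}"])
  also have "\<dots> < card {i. coeff f i \<noteq> 0}" by (rule descartes_card_pos_roots[OF \<open>f \<noteq> 0\<close>])
  also have "\<dots> \<le> card (e ` {..<n})"
  proof (intro card_mono subsetI)
    fix i assume "i \<in> {i. coeff f i \<noteq> 0}"
    then have "\<exists>c<n. coeff (monom (l c * v $ c) (e c)) i \<noteq> 0"
      unfolding f_def coeff_sum by (metis (mono_tags, lifting) lessThan_iff mem_Collect_eq sum.neutral)
    then show "i \<in> e ` {..<n}" by (auto split: if_splits)
  qed simp
  also have "\<dots> \<le> n" using card_image_le[of "{..<n}" e] by simp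
  finally show False by simp
qed

section \<open>Elimination of the exponential\<close>

lemma coeff_mult_top:
  fixes p q :: "'a :: comm_semiring_0 poly"
  assumes "degree p \<le> a" "degree q \<le> b"
  shows "coeff (p * q) (a + b) = coeff p a * coeff q b"
proof (cases "degree p = a \<and> degree q = b")
  case True
  then show ?thesis using coeff_mult_degree_sum by blast
next
  case False
  then have "degree p < a \<or> degree q < b" using assms by auto
  then have "coeff p a * coeff q b = 0" by (auto simp: coeff_eq_0)
  moreover have "coeff (p * q) (a + b) = 0"
    using False assms degree_mult_le[of p q] by (intro coeff_eq_0) linarith
  ultimately show ?thesis by simp
qed

lemma coeff_prod_top:
  fixes f :: "'b \<Rightarrow> 'a :: comm_ring_1 poly"
  assumes "finite A" "\<And>i. i \<in> A \<Longrightarrow> degree (f i) \<le> m i"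
  shows "coeff (\<Prod>i\<in>A. f i) (\<Sum>i\<in>A. m i) = (\<Prod>i\<in>A. coeff (f i) (m i)) \<and>
    degree (\<Prod>i\<in>A. f i) \<le> (\<Sum>i\<in>A. m i)"
  using assms
proof (induction A rule: finite_induct)
  case (insert x A)
  then have IH: "coeff (prod f A) (sum m A) = (\<Prod>i\<in>A. coeff (f i) (m i))" "degree (prod f A) \<le> sum m A"
    "degree (f x) \<le> m x" by auto
  have "coeff (f x * prod f A) (m x + sum m A) = coeff (f x) (m x) * coeff (prod f A) (sum m A)"
    using IH by (intro coeff_mult_top) auto
  moreover have "degree (f x * prod f A) \<le> m x + sum m A"
    using IH degree_mult_le[of "f x" "prod f A"] by linarith
  ultimately show ?case using insert.hyps IH by simp
qed simp

text \<open>Every term of the determinant takes one entry from each column, so all terms have the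
  same degree bound, and taking the coefficient at that bound commutes with the determinant.\<close>

lemma coeff_det_top:
  fixes A :: "'a :: comm_ring_1 poly mat"
  assumes A: "A \<in> carrier_mat n n"
    and m: "\<And>i c. i < n \<Longrightarrow> c < n \<Longrightarrow> degree (A $$ (i, c)) \<le> m c"
  shows "coeff (det A) (\<Sum>c<n. m c) = det (mat n n (\<lambda>(i, c). coeff (A $$ (i, c)) (m c)))"
proof -
  let ?B = "mat n n (\<lambda>(i, c). coeff (A $$ (i, c)) (m c))"
  have "coeff (signof p * (\<Prod>i = 0..<n. A $$ (i, p i))) (\<Sum>c<n. m c) =
      signof p * (\<Prod>i = 0..<n. ?B $$ (i, p i))" if p: "p permutes {0..<n}" for p
  proof -
    have pi: "p i < n" if "i < n" for i
      using p that permutes_in_image[of p "{0..<n}" i] by auto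
    have "(\<Sum>c<n. m c) = (\<Sum>i = 0..<n. m (p i))"
      using sum.permute[OF p, of m] by (simp add: lessThan_atLeast0)
    moreover have "coeff (\<Prod>i = 0..<n. A $$ (i, p i)) (\<Sum>i = 0..<n. m (p i)) =
        (\<Prod>i = 0..<n. coeff (A $$ (i, p i)) (m (p i)))"
      using coeff_prod_top[of "{0..<n}" "\<lambda>i. A $$ (i, p i)" "\<lambda>i. m (p i)"] m pi by auto
    moreover have "(\<Prod>i = 0..<n. coeff (A $$ (i, p i)) (m (p i))) = (\<Prod>i = 0..<n. ?B $$ (i, p i))"
      using pi by (intro prod.cong) auto
    ultimately show ?thesis by (cases p rule: sign_cases) simp_all
  qed
  then show ?thesis
    by (simp add: det_def'[OF A] det_def'[of ?B n] coeff_sum)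
qed

text \<open>Eliminating \<open>y\<close> from the relations \<open>\<Sum>\<^sub>j P\<^sub>j(x) y\<^sup>j = 0\<close> at \<open>L\<close> translates of a point: \<open>Q\<close> is a
  determinant, and its leading coefficient is a generalised Vandermonde determinant.\<close>

lemma eliminate_exponential:
  fixes P :: "nat \<Rightarrow> real poly poly" and a b y :: "nat \<Rightarrow> real"
  assumes nz: "\<exists>j<L. P j \<noteq> 0" and deg: "\<And>j. j < L \<Longrightarrow> tdeg (P j) \<le> d"
    and y: "\<And>i. i < L \<Longrightarrow> y i > 0" "inj_on y {..<L}"
  obtains Q where "Q \<noteq> 0" "tdeg Q \<le> d * L"
    "\<And>X Y z. z \<noteq> 0 \<Longrightarrow>
      (\<And>i. i < L \<Longrightarrow> (\<Sum>j<L. ev2 (P j) (X + a i) (Y + b i) * (y i * z) ^ j) = 0) \<Longrightarrow> ev2 Q X Y = 0"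
proof -
  \<comment> \<open>A zero polynomial \<open>P j\<close> would produce a zero column. Only the other
    indices are kept, and then as many translates as there are indices in \<open>J\<close>
    suffice.\<close>
  define J where "J = {j. j < L \<and> P j \<noteq> 0}"
  have "finite J" by (simp add: J_def)
  define n where "n = card J"
  obtain e where e: "bij_betw e {..<n} J"
    using ex_bij_betw_nat_finite[OF \<open>finite J\<close>] unfolding n_def lessThan_atLeast0 by blast
  have eJ: "e c < L" "P (e c) \<noteq> 0" if "c < n" for c
    using bij_betwE[OF e] that by (auto simp: J_def)
  have "J \<noteq> {}" using nz by (auto simp: J_def)
  then have n: "n > 0" using \<open>finite J\<close> by (simp add: n_def card_gt_0_iff)
  have nL: "n \<le> L" unfolding n_def using card_mono[of "{..<L}" J] by (auto simp: J_def)
  define A where "A = mat n n (\<lambda>(i, c). shift2 (a i) (b i) (P (e c)) * [:[:y i ^ e c:]:])"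
  have A: "A \<in> carrier_mat n n" by (simp add: A_def)
  define p where "p c = lead_coeff (P (e c))" for c
  \<comment> \<open>A translation preserves the outer degree, and the outer leading coefficient
    feels only its second component.\<close>
  have lc1: "degree (shift2 u v f) \<le> degree f \<and>
      coeff (shift2 u v f) (degree f) = pcompose (lead_coeff f) [:v, 1:]" for u v f
  proof -
    define g where "g = pcompose (map_poly (\<lambda>c. pcompose c [:v, 1:]) f) [:[:u:], 1:]"
    have "ev2 g x t = ev2 (shift2 u v f) x t" for x t
    proof -
      have "poly (poly (map_poly (\<lambda>c. pcompose c [:v, 1:]) f) [:x:]) t = ev2 f x (t + v)" for x
        by (induction f) (auto simp: map_poly_pCons poly_pcompose ev2_def add.commute)
      note * = this[of "x + u"]
      have "ev2 g x t = poly (poly (map_poly (\<lambda>c. pcompose c [:v, 1:]) f) [:x + u:]) t"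
        by (simp add: g_def ev2_def poly_pcompose add.commute)
      then show ?thesis using * by simp
    qed
    then have g: "shift2 u v f = g" by (intro ev2_eqI) simp
    have dm: "degree (map_poly (\<lambda>c. pcompose c [:v, 1:]) f) = degree f"
    proof (cases "f = 0")
      case False
      then show ?thesis by (intro degree_map_poly) (simp add: pcompose_eq_0_iff)
    qed simp
    have dg: "degree g = degree f" unfolding g_def by (simp add: degree_pcompose dm)
    moreover have "lead_coeff g = pcompose (lead_coeff f) [:v, 1:]"
      unfolding g_def by (simp add: lead_coeff_comp dm coeff_map_poly)
    ultimately show ?thesis using g by auto
  qed
  \<comment> \<open>Leading coefficients are taken twice, in the outer and then in the inner
    variable. After that no trace of the translations is left, and the matrix is a generalised
    Vandermonde matrix.\<close>
  define B where "B = mat n n (\<lambda>(i, c). pcompose (p c) [:b i, 1:] * [:y i ^ e c:])"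
  have B: "B \<in> carrier_mat n n" by (simp add: B_def)
  have "coeff (det A) (\<Sum>c<n. degree (P (e c))) = det B"
  proof -
    have "degree (A $$ (i, c)) \<le> degree (P (e c))" if "i < n" "c < n" for i c
      using that lc1[of "a i" "b i" "P (e c)"]
      by (simp add: A_def mult.commute[of _ "[:_:]"] degree_smult_le le_trans[OF degree_smult_le])
    from coeff_det_top[OF A this] have "coeff (det A) (\<Sum>c<n. degree (P (e c))) =
      det (mat n n (\<lambda>(i, c). coeff (A $$ (i, c)) (degree (P (e c)))))" by simp
    also have "mat n n (\<lambda>(i, c). coeff (A $$ (i, c)) (degree (P (e c)))) = B"
      using lc1 by (intro eq_matI) (auto simp: A_def B_def p_def)
    finally show ?thesis .
  qed
  moreover have "coeff (det B) (\<Sum>c<n. degree (p c)) \<noteq> 0"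
  proof -
    have "degree (B $$ (i, c)) \<le> degree (p c)" if "i < n" "c < n" for i c
      using that by (simp add: B_def degree_pcompose le_trans[OF degree_smult_le])
    from coeff_det_top[OF B this] have "coeff (det B) (\<Sum>c<n. degree (p c)) =
      det (mat n n (\<lambda>(i, c). coeff (B $$ (i, c)) (degree (p c))))" by simp
    also have "mat n n (\<lambda>(i, c). coeff (B $$ (i, c)) (degree (p c))) =
       mat n n (\<lambda>(i, c). lead_coeff (p c) * y i ^ e c)"
    proof (intro eq_matI)
      fix i c assume "i < dim_row (mat n n (\<lambda>(i, c). lead_coeff (p c) * y i ^ e c))"
        "c < dim_col (mat n n (\<lambda>(i, c). lead_coeff (p c) * y i ^ e c))"
      moreover have "coeff (pcompose (p c) [:b i, 1:]) (degree (p c)) = lead_coeff (p c)"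
        using lead_coeff_comp[of "[:b i, 1:]" "p c"] by (simp add: degree_pcompose)
      ultimately show "mat n n (\<lambda>(i, c). coeff (B $$ (i, c)) (degree (p c))) $$ (i, c) =
        mat n n (\<lambda>(i, c). lead_coeff (p c) * y i ^ e c) $$ (i, c)"
        by (simp add: B_def)
    qed auto
    finally show ?thesis
      using gen_vandermonde_det[of n y e "\<lambda>c. lead_coeff (p c)"] y e eJ nL
      by (auto simp: bij_betw_def p_def inj_on_def)
  qed
  ultimately have det0: "det A \<noteq> 0" by (metis coeff_0)
  have "tdeg (det A) \<le> d * L"
    unfolding det_def'[OF A]
  proof (intro tdeg_sum_le)
    show "finite {p. p permutes {0..<n}}" by (simp add: finite_permutations)
    fix q assume q: "q \<in> {p. p permutes {0..<n}}"
    have "tdeg (\<Prod>i = 0..<n. A $$ (i, q i)) \<le> (\<Sum>i = 0..<n. tdeg (A $$ (i, q i)))"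
      by (rule tdeg_prod_le)
    also have "\<dots> \<le> (\<Sum>i = 0..<n. d)"
    proof (intro sum_mono)
      fix i assume "i \<in> {0..<n}"
      moreover from this have "q i < n" using q permutes_in_image[of q "{0..<n}" i] by auto
      ultimately show "tdeg (A $$ (i, q i)) \<le> d"
        using tdeg_mult_le[of "shift2 (a i) (b i) (P (e (q i)))" "[:[:y i ^ e (q i):]:]"]
          tdeg_shift2_le[of "a i" "b i" "P (e (q i))"] deg[of "e (q i)"] eJ(1)[of "q i"]
          tdeg_const[of "y i ^ e (q i)"]
        by (simp add: A_def del: mult_pCons_right)
    qed
    also have "\<dots> \<le> d * L" using nL by simp
    finally have *: "tdeg (\<Prod>i = 0..<n. A $$ (i, q i)) \<le> d * L" .
    then show "tdeg (signof q * (\<Prod>i = 0..<n. A $$ (i, q i))) \<le> d * L"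
      using * by (cases q rule: sign_cases) simp_all
  qed
  moreover have "ev2 (det A) X Y = 0" if z: "z \<noteq> 0" and
    zero: "\<And>i. i < L \<Longrightarrow> (\<Sum>j<L. ev2 (P j) (X + a i) (Y + b i) * (y i * z) ^ j) = 0" for X Y z
  proof -
    interpret comm_ring_hom "\<lambda>f. ev2 f X Y" by unfold_locales auto
    define M where "M = map_mat (\<lambda>f. ev2 f X Y) A"
    define w where "w = vec n (\<lambda>c. z ^ e c)"
    have M: "M \<in> carrier_mat n n" using A by (simp add: M_def)
    have "M *\<^sub>v w = 0\<^sub>v n"
    proof (rule eq_vecI)
      fix i assume "i < dim_vec (0\<^sub>v n :: real vec)"
      then have i: "i < n" by simp
      have "(M *\<^sub>v w) $ i = (\<Sum>c<n. ev2 (P (e c)) (X + a i) (Y + b i) * (y i * z) ^ e c)"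
        using i M by (simp add: scalar_prod_def lessThan_atLeast0 M_def w_def A_def power_mult_distrib mult_ac)
      also have "\<dots> = (\<Sum>j\<in>J. ev2 (P j) (X + a i) (Y + b i) * (y i * z) ^ j)"
        by (rule sum.reindex_bij_betw[OF e])
      also have "\<dots> = (\<Sum>j<L. ev2 (P j) (X + a i) (Y + b i) * (y i * z) ^ j)"
        by (intro sum.mono_neutral_left) (auto simp: J_def)
      also have "\<dots> = 0" using zero i nL by simp
      finally show "(M *\<^sub>v w) $ i = 0\<^sub>v n $ i" using i by simp
    qed (use M in auto)
    moreover have "w \<noteq> 0\<^sub>v n"
    proof
      assume "w = 0\<^sub>v n"
      then have "w $ 0 = 0" using n by simp
      then show False using n z by (simp add: w_def)
    qed
    moreover have "w \<in> carrier_vec n" by (simp add: w_def)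
    ultimately have "det M = 0" using det_0_iff_vec_prod_zero[OF M] by blast
    then show ?thesis unfolding M_def by simp
  qed
  ultimately show ?thesis using that det0 by blast
qed

section \<open>Zero estimates for exponential polynomials in the binomial basis\<close>

text \<open>This is "A choose n". It takes integer values wherever \<open>A\<close> does, although
  its coefficients are damped by 1 / n!; hence it is a cheaper basis than the powers of
  \<open>A\<close>.\<close>

definition gbinom2 :: "real poly poly \<Rightarrow> nat \<Rightarrow> real poly poly" where
  "gbinom2 A n = [:[:1 / fact n:]:] * (\<Prod>i<n. A - [:[:real i:]:])"

lemma ev2_prod: "ev2 (\<Prod>i\<in>A. f i) x y = (\<Prod>i\<in>A. ev2 (f i) x y)"
  by (induction A rule: infinite_finite_induct) simp_all

lemma ev2_gbinom2: "ev2 (gbinom2 A n) x y = (ev2 A x y gchoose n)"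
  unfolding gbinom2_def by (simp add: ev2_prod gbinomial_prod_rev lessThan_atLeast0 field_simps)

lemma tdeg_gbinom2_le:
  assumes "tdeg A \<le> 1"
  shows "tdeg (gbinom2 A n) \<le> n"
proof -
  have "tdeg (A - [:[:c:]:]) \<le> 1" for c
  proof -
    have "homog (A - [:[:c:]:]) = homog A - homog [:[:c:]:]" by (rule ev2_eqI) simp
    then show ?thesis
      using assms tdeg_const[of c] degree_diff_le_max[of "homog A" "homog [:[:c:]:]"]
      by (simp add: tdeg_def)
  qed
  then have "(\<Sum>i<n. tdeg (A - [:[:real i:]:])) \<le> (\<Sum>i<n. 1)" by (intro sum_mono)
  then show ?thesis
    using tdeg_mult_le[of "[:[:1 / fact n:]:]" "\<Prod>i<n. A - [:[:real i:]:]"]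
      tdeg_prod_le[of "\<lambda>i. A - [:[:real i:]:]" "{..<n}"] tdeg_const[of "1 / fact n"]
    unfolding gbinom2_def by simp
qed

text \<open>The system is triangular: at (m, n) only the pairs with a <= m and b <= n
  contribute.\<close>

lemma binomial_sum_eq_0_imp:
  fixes q :: "nat \<Rightarrow> nat \<Rightarrow> real"
  assumes zero: "\<And>m n. (\<Sum>(a, b)\<in>{(a, b). a + b < K}. q a b * real (m choose a) * real (n choose b)) = 0"
  shows "m + n < K \<Longrightarrow> q m n = 0"
proof (induction "m + n" arbitrary: m n rule: less_induct)
  case less
  have fin: "finite {(a, b). a + b < K}"
    by (rule finite_subset[of _ "{..<K} \<times> {..<K}"]) auto
  have "(\<Sum>(a, b)\<in>{(a, b). a + b < K}. q a b * real (m choose a) * real (n choose b)) =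
     (\<Sum>(a, b)\<in>{(a, b). a + b < K}. if (a, b) = (m, n) then q m n else 0)"
  proof (rule sum.cong[OF refl])
    fix p assume "p \<in> {(a, b). a + b < K}"
    then obtain a b where p: "p = (a, b)" "a + b < K" by auto
    have "q a b * real (m choose a) * real (n choose b) = 0" if ne: "(a, b) \<noteq> (m, n)"
    proof (cases "a \<le> m \<and> b \<le> n")
      case True
      then have "a + b < m + n" using ne by (cases "a = m") auto
      then show ?thesis using less.hyps[of a b] p by simp
    qed (auto simp: binomial_eq_0_iff)
    then show "(case p of (a, b) \<Rightarrow> q a b * real (m choose a) * real (n choose b)) =
      (case p of (a, b) \<Rightarrow> if (a, b) = (m, n) then q m n else 0)"
      by (auto simp: p)
  qed
  also have "\<dots> = q m n" 
    using less.prems sum.delta[OF fin, of "(m, n)" "\<lambda>_. q m n"] by (simp add: case_prod_unfold prod_eq_iff)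
  finally show ?case using zero[of m n] by simp
qed

text \<open>This makes x1 + sqrt 2 * x2 injective on integer points, as the Bezout count needs
  distinct second coordinates.\<close>

lemma sqrt2_indep:
  fixes a b :: int
  assumes "real_of_int a = sqrt 2 * real_of_int b"
  shows "a = 0 \<and> b = 0"
proof (cases "b = 0")
  case False
  have "(real_of_int a)\<^sup>2 = 2 * (real_of_int b)\<^sup>2" by (simp add: assms power_mult_distrib)
  then have eq: "a\<^sup>2 = 2 * b\<^sup>2" by (metis of_int_eq_iff of_int_mult of_int_numeral of_int_power)
  then have "a \<noteq> 0" using False by auto
  have "2 * multiplicity 2 a = multiplicity 2 (a\<^sup>2)"
    using \<open>a \<noteq> 0\<close> by (simp add: prime_elem_multiplicity_power_distrib)
  also have "\<dots> = multiplicity 2 (2 * b\<^sup>2)" by (simp add: eq)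
  also have "\<dots> = 1 + 2 * multiplicity 2 b"
    using False by (simp add: prime_elem_multiplicity_mult_distrib prime_elem_multiplicity_power_distrib)
  finally show ?thesis by presburger
qed (use assms in simp)

text \<open>A step in direction \<open>t1\<close> multiplies \<open>Y\<close> by
  \<open>\<alpha>\<close> and moves (X1, X2) by (1, 0); the \<open>L\<close> steps of this kind feed
  the elimination of \<open>Y\<close>. The doubled sides of the box provide the sums of two points
  of \<open>W\<close>. The points are placed at (X1, X1 + sqrt 2 * X2) to separate them by the
  second coordinate.\<close>

lemma zero_estimate_box:
  fixes k N K L r1 r2 r3 :: nat and \<alpha> g c :: real and q :: "nat \<Rightarrow> nat \<Rightarrow> nat \<Rightarrow> real"
  defines "X1 \<equiv> \<lambda>(t1, t2, s). real t1 + real k * real s"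
    and "X2 \<equiv> \<lambda>(t1 :: nat, t2, s). real t2 - real N * real s"
    and "Y \<equiv> \<lambda>(t1, t2, s). \<alpha> ^ t1 * g ^ t2 * c ^ s"
    and "W \<equiv> {..<r1} \<times> {..<r2} \<times> {..<r3}"
    and "D \<equiv> (K - 1) * L"
  assumes pos: "\<alpha> > 1" "g > 0" "c > 0" and r: "r1 \<le> k" "D * D < r1 * r2 * r3"
    and nz: "a0 + b0 < K" "j0 < L" "q a0 b0 j0 \<noteq> 0"
    and zero: "\<And>t1 t2 s. t1 < 2 * r1 + L \<Longrightarrow> t2 < 2 * r2 \<Longrightarrow> s < 2 * r3 \<Longrightarrow>
      (\<Sum>j<L. \<Sum>(a, b)\<in>{(a, b). a + b < K}. q a b j * (X1 (t1, t2, s) gchoose a) * (X2 (t1, t2, s) gchoose b)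
        * Y (t1, t2, s) ^ j) = 0"
  obtains S where "S \<subseteq> W" "r1 * r2 * r3 \<le> card S * D"
    "\<And>p0 p1 p2. p0 \<in> S \<Longrightarrow> p1 \<in> S \<Longrightarrow> p2 \<in> S \<Longrightarrow>
      (X1 p1 - X1 p0) * (X2 p2 - X2 p0) = (X2 p1 - X2 p0) * (X1 p2 - X1 p0)"
proof -
  let ?I = "{(a, b). a + b < K}"
  define A where "A = ([:0, 1:] :: real poly poly)"
  \<comment> \<open>At the point (x, x + sqrt 2 * z) this polynomial has the value z.\<close>
  define B where "B = ([:[:0, 1 / sqrt 2:], [:- 1 / sqrt 2:]:] :: real poly poly)"
  have td: "tdeg A \<le> 1" "tdeg B \<le> 1"
    unfolding A_def B_def by (rule tdeg_le; auto simp: coeff_pCons split: nat.splits if_splits)+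
  define P where "P j = (\<Sum>(a, b)\<in>?I. [:[:q a b j:]:] * gbinom2 A a * gbinom2 B b)" for j
  have fin: "finite ?I" by (rule finite_subset[of _ "{..<K} \<times> {..<K}"]) auto
  have evP: "ev2 (P j) x (x + sqrt 2 * z) = (\<Sum>(a, b)\<in>?I. q a b j * (x gchoose a) * (z gchoose b))"
    for j x z
  proof -
    have "ev2 B x y = (y - x) / sqrt 2" for y
      by (simp add: B_def diff_divide_distrib)
    then have "ev2 A x (x + sqrt 2 * z) = x" "ev2 B x (x + sqrt 2 * z) = z"
      by (simp_all add: A_def)
    then show ?thesis unfolding P_def by (simp add: case_prod_beta ev2_gbinom2 mult.assoc)
  qed
  have "tdeg (P j) \<le> K - 1" for j
    unfolding P_def
  proof (intro tdeg_sum_le fin)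
    fix p assume "p \<in> ?I"
    then obtain a b where p: "p = (a, b)" "a + b < K" by auto
    have "tdeg ([:[:q a b j:]:] * gbinom2 A a * gbinom2 B b) \<le> 0 + a + b"
      using tdeg_mult_le[of "[:[:q a b j:]:] * gbinom2 A a" "gbinom2 B b"]
        tdeg_mult_le[of "[:[:q a b j:]:]" "gbinom2 A a"] tdeg_const[of "q a b j"]
        tdeg_gbinom2_le[OF td(1), of a] tdeg_gbinom2_le[OF td(2), of b] by linarith
    then show "tdeg (case p of (a, b) \<Rightarrow> [:[:q a b j:]:] * gbinom2 A a * gbinom2 B b) \<le> K - 1"
      using p by simp
  qed
  moreover have "P j0 \<noteq> 0"
  proof
    assume "P j0 = 0"
    then have "(\<Sum>(a, b)\<in>?I. q a b j0 * real (m choose a) * real (n choose b)) = 0" for m n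
      using evP[of j0 "real m" "real n"] by (simp add: binomial_gbinomial)
    from binomial_sum_eq_0_imp[OF this nz(1)] nz(3) show False by simp
  qed
  moreover have "inj_on (\<lambda>i. \<alpha> ^ i) {..<L}" using pos by (auto simp: inj_on_def)
  moreover have a0: "\<alpha> ^ i > 0" for i using pos by simp
  ultimately obtain Q where Q: "Q \<noteq> 0" "tdeg Q \<le> (K - 1) * L" "\<And>x y z. z \<noteq> 0 \<Longrightarrow>
      (\<And>i. i < L \<Longrightarrow> (\<Sum>j<L. ev2 (P j) (x + real i) (y + real i) * (\<alpha> ^ i * z) ^ j) = 0) \<Longrightarrow> ev2 Q x y = 0"
    using eliminate_exponential[of L P "K - 1" "\<lambda>i. \<alpha> ^ i" real real] nz(2) a0 by blast
  define \<phi> where "\<phi> p = (X1 p, X1 p + sqrt 2 * X2 p)" for p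
  have Qz: "ev2 Q (X1 p) (X1 p + sqrt 2 * X2 p) = 0"
    if p: "p = (t1, t2, s)" "t1 < 2 * r1" "t2 < 2 * r2" "s < 2 * r3" for p t1 t2 s
  proof (rule Q(3)[of "Y p"])
    show "Y p \<noteq> 0" using pos by (simp add: p Y_def)
    fix i assume i: "i < L"
    let ?p = "(t1 + i, t2, s)"
    have "(\<Sum>j<L. \<Sum>(a, b)\<in>?I. q a b j * (X1 ?p gchoose a) * (X2 ?p gchoose b) * Y ?p ^ j) = 0"
      using i p by (intro zero) auto
    also have "(\<Sum>j<L. \<Sum>(a, b)\<in>?I. q a b j * (X1 ?p gchoose a) * (X2 ?p gchoose b) * Y ?p ^ j) =
      (\<Sum>j<L. ev2 (P j) (X1 ?p) (X1 ?p + sqrt 2 * X2 ?p) * Y ?p ^ j)"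
      by (simp add: evP sum_distrib_right case_prod_beta)
    finally show "(\<Sum>j<L. ev2 (P j) (X1 p + real i) (X1 p + sqrt 2 * X2 p + real i) * (\<alpha> ^ i * Y p) ^ j) = 0"
      by (simp add: p X1_def X2_def Y_def add_ac power_add mult_ac)
  qed
  have inj: "t1 = t1' \<and> t2 = t2' \<and> s = s'"
    if t: "t1 < r1" "t1' < r1" and eq: "snd (\<phi> (t1, t2, s)) = snd (\<phi> (t1', t2', s'))" for t1 t2 s t1' t2' s'
  proof -
    let ?a = "int t1 + int k * int s - (int t1' + int k * int s')"
    let ?b = "(int t2' - int N * int s') - (int t2 - int N * int s)"
    have "real_of_int ?a = sqrt 2 * real_of_int ?b"
      using eq by (simp add: \<phi>_def X1_def X2_def algebra_simps)
    from sqrt2_indep[OF this] have ab: "?a = 0" "?b = 0" by auto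
    then have e: "t1 + k * s = t1' + k * s'"
      by (metis eq_iff_diff_eq_0 of_nat_add of_nat_eq_iff of_nat_mult)
    \<comment> \<open>Thus s is the quotient and t1 the remainder of X1 on division by k.\<close>
    have "t1 < k" "t1' < k" using t r(1) by auto
    then have "s = (t1 + k * s) div k" "s' = (t1' + k * s') div k" by auto
    then have "s = s'" using e by simp
    then show ?thesis using e ab(2) by simp
  qed
  have injW: "inj_on (snd \<circ> \<phi>) W"
  proof (rule inj_onI)
    fix p p' assume "p \<in> W" "p' \<in> W" "(snd \<circ> \<phi>) p = (snd \<circ> \<phi>) p'"
    moreover obtain t1 t2 s t1' t2' s' where "p = (t1, t2, s)" "p' = (t1', t2', s')" by (metis prod_cases3)
    ultimately show "p = p'" using inj[of t1 t1' t2 s t2' s'] by (simp add: W_def)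
  qed
  have inj\<phi>: "inj_on \<phi> W" and injs: "inj_on snd (\<phi> ` W)"
    using inj_on_imageI2[OF injW] inj_on_imageI[OF injW] by blast+
  have card: "card (\<phi> ` W) = r1 * r2 * r3"
    using inj\<phi> by (simp add: card_image W_def card_cartesian_product)
  have "0 < r1 * r2 * r3" using r(2) by linarith
  then have rpos: "0 < r1" "0 < r2" "0 < r3" by simp_all
  have "\<phi> (0, 0, 0) = (0, 0)" by (simp add: \<phi>_def X1_def X2_def)
  then have zW: "(0, 0) \<in> \<phi> ` W" using rpos by (force simp: W_def)
  have zs: "ev2 Q (x + x') (y + y') = 0" if xy: "(x, y) \<in> \<phi> ` W" "(x', y') \<in> \<phi> ` W" for x y x' y'
  proof -
    obtain t1 t2 s where 1: "t1 < r1" "t2 < r2" "s < r3" "(x, y) = \<phi> (t1, t2, s)"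
      using xy(1) by (auto simp: W_def)
    obtain u1 u2 v where 2: "u1 < r1" "u2 < r2" "v < r3" "(x', y') = \<phi> (u1, u2, v)"
      using xy(2) by (auto simp: W_def)
    have e: "x + x' = X1 (t1 + u1, t2 + u2, s + v)"
      "y + y' = X1 (t1 + u1, t2 + u2, s + v) + sqrt 2 * X2 (t1 + u1, t2 + u2, s + v)"
      using 1(4) 2(4) by (simp_all add: \<phi>_def X1_def X2_def algebra_simps)
    show ?thesis unfolding e by (rule Qz[OF refl]) (use 1 2 in auto)
  qed
  have cW: "D * D < card (\<phi> ` W)" using r(2) card by simp
  have fW: "finite (\<phi> ` W)" by (simp add: W_def)
  have tQ: "tdeg Q \<le> D" using Q(2) by (simp add: D_def)
  obtain S where S: "S \<subseteq> \<phi> ` W" "card (\<phi> ` W) \<le> card S * D"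
    "\<And>x0 y0 x1 y1 x2 y2. (x0, y0) \<in> S \<Longrightarrow> (x1, y1) \<in> S \<Longrightarrow> (x2, y2) \<in> S \<Longrightarrow>
      (x1 - x0) * (y2 - y0) = (y1 - y0) * (x2 - x0)"
    by (rule zero_estimate_sumset[OF Q(1) tQ fW injs zW cW zs]) (assumption | blast)+
  define T where "T = {p \<in> W. \<phi> p \<in> S}"
  have ST: "S = \<phi> ` T" using S(1) by (auto simp: T_def)
  have "card S = card T" unfolding ST using inj\<phi> by (intro card_image) (auto simp: T_def inj_on_def)
  show ?thesis
  proof (rule that[of T])
    show "T \<subseteq> W" by (auto simp: T_def)
    show "r1 * r2 * r3 \<le> card T * D" using S(2) card \<open>card S = card T\<close> by simp
    fix p0 p1 p2 assume p: "p0 \<in> T" "p1 \<in> T" "p2 \<in> T"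
    have "(X1 p1 - X1 p0) * ((X1 p2 + sqrt 2 * X2 p2) - (X1 p0 + sqrt 2 * X2 p0)) =
       ((X1 p1 + sqrt 2 * X2 p1) - (X1 p0 + sqrt 2 * X2 p0)) * (X1 p2 - X1 p0)"
      using p by (intro S(3)) (auto simp: T_def \<phi>_def)
    then have "sqrt 2 * ((X1 p1 - X1 p0) * (X2 p2 - X2 p0)) = sqrt 2 * ((X2 p1 - X2 p0) * (X1 p2 - X1 p0))"
      by (simp add: algebra_simps)
    then show "(X1 p1 - X1 p0) * (X2 p2 - X2 p0) = (X2 p1 - X2 p0) * (X1 p2 - X1 p0)" by simp
  qed
qed

text \<open>Here L elements of \<open>S\<close> with distinct values of \<open>y\<close> take over
  the part of the powers of \<open>\<alpha>\<close>. What remains after elimination has degree at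
  most (K - 1) L in x but vanishes at all values \<open>x p\<close>.\<close>

lemma zero_estimate_line:
  fixes x y :: "'p \<Rightarrow> real" and q :: "nat \<Rightarrow> nat \<Rightarrow> real"
  assumes S: "finite S" "inj_on x S" "\<And>p. p \<in> S \<Longrightarrow> y p > 0" "L \<le> card (y ` S)" "(K - 1) * L < card S"
    and nz: "i0 < K" "j0 < L" "q i0 j0 \<noteq> 0"
    and zero: "\<And>p p'. p \<in> S \<Longrightarrow> p' \<in> S \<Longrightarrow>
      (\<Sum>j<L. \<Sum>i<K. q i j * ((x p + x p' - x0) gchoose i) * (y p * y p') ^ j) = 0"
  shows False
proof -
  define A where "A = ([:[:- x0:], 1:] :: real poly poly)"
  have td: "tdeg A \<le> 1"
    unfolding A_def by (rule tdeg_le; auto simp: coeff_pCons split: nat.splits if_splits)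
  define P where "P j = (\<Sum>i<K. [:[:q i j:]:] * gbinom2 A i)" for j
  have evP: "ev2 (P j) u v = (\<Sum>i<K. q i j * ((u - x0) gchoose i))" for j u v
    unfolding P_def by (simp add: ev2_gbinom2 A_def)
  have "tdeg (P j) \<le> K - 1" for j
    unfolding P_def
  proof (intro tdeg_sum_le)
    fix i assume "i \<in> {..<K}"
    then show "tdeg ([:[:q i j:]:] * gbinom2 A i) \<le> K - 1"
      using tdeg_mult_le[of "[:[:q i j:]:]" "gbinom2 A i"] tdeg_const[of "q i j"]
        tdeg_gbinom2_le[OF td, of i] by auto
  qed simp
  moreover have "P j0 \<noteq> 0"
  proof
    assume "P j0 = 0"
    then have z: "(\<Sum>i<K. q i j0 * real (m choose i)) = 0" for m
      using evP[of j0 "real m + x0" 0] by (simp add: binomial_gbinomial)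
    have "m < K \<Longrightarrow> q m j0 = 0" for m
    proof (induction m rule: less_induct)
      case (less m)
      have "(\<Sum>i<K. q i j0 * real (m choose i)) = (\<Sum>i<K. if i = m then q m j0 else 0)"
        using less by (intro sum.cong refl) (auto simp: binomial_eq_0_iff not_less)
      then show ?case using z[of m] less.prems by simp
    qed
    then show False using nz by blast
  qed
  moreover obtain T where T: "T \<subseteq> y ` S" "card T = L" "finite T"
    using obtain_subset_with_card_n[OF S(4)] by metis
  obtain e where e: "bij_betw e {..<L} T"
    using ex_bij_betw_nat_finite[OF T(3)] unfolding T(2) lessThan_atLeast0 by blast
  have "\<exists>p\<in>S. y p = e i" if "i < L" for i
    using bij_betwE[OF e] that T(1) by fastforce
  then obtain w where w: "\<And>i. i < L \<Longrightarrow> w i \<in> S \<and> y (w i) = e i" by metis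
  have "inj_on (\<lambda>i. y (w i)) {..<L}"
    using w e by (auto simp: inj_on_def bij_betw_def)
  ultimately obtain Q where Q: "Q \<noteq> 0" "tdeg Q \<le> (K - 1) * L" "\<And>u v z. z \<noteq> 0 \<Longrightarrow>
      (\<And>i. i < L \<Longrightarrow> (\<Sum>j<L. ev2 (P j) (u + x (w i)) (v + 0) * (y (w i) * z) ^ j) = 0) \<Longrightarrow> ev2 Q u v = 0"
    using eliminate_exponential[of L P "K - 1" "\<lambda>i. y (w i)" "\<lambda>i. x (w i)" "\<lambda>_. 0"] nz(2) w S(3) by blast
  have zQ: "ev2 Q (x p) v = 0" if "p \<in> S" for p v
  proof (rule Q(3)[of "y p"])
    show "y p \<noteq> 0" using S(3)[OF that] by simp
    fix i assume "i < L"
    then have "w i \<in> S" using w by simp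
    from zero[OF that this] show "(\<Sum>j<L. ev2 (P j) (x p + x (w i)) (v + 0) * (y (w i) * y p) ^ j) = 0"
      by (simp add: evP sum_distrib_right mult.commute[of "y (w i)"])
  qed
  \<comment> \<open>\<open>Q\<close> vanishes at (x p, v) for every v, so the second variable may be
    frozen at a value for which a nonzero polynomial remains.\<close>
  obtain u0 v0 where uv: "ev2 Q u0 v0 \<noteq> 0" using Q(1) ev2_zero_imp by blast
  define R where "R = map_poly (\<lambda>c. poly c v0) Q"
  have R: "poly R u = ev2 Q u v0" for u
    unfolding R_def by (induction Q) (auto simp: map_poly_pCons)
  then have "R \<noteq> 0" using uv by (metis poly_0)
  have "card S = card (x ` S)" using S(2) by (simp add: card_image)
  also have "\<dots> \<le> card {u. poly R u = 0}"
    using R zQ \<open>R \<noteq> 0\<close> by (intro card_mono poly_roots_finite) auto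
  also have "\<dots> \<le> degree R" by (rule card_poly_roots_bound[OF \<open>R \<noteq> 0\<close>])
  also have "\<dots> \<le> degree Q" unfolding R_def by (rule map_poly_degree_leq)
  also have "\<dots> \<le> (K - 1) * L" using degree_le_tdeg[of Q] Q(2) by linarith
  finally show False using S(5) by simp
qed

section \<open>The auxiliary function\<close>

text \<open>The box principle with an individual number \<open>M e\<close> of cells for each linear
  form, so that forms that need little accuracy cost little. The forms are real and are only made
  small.\<close>

lemma siegel_real:
  fixes c :: "'e \<Rightarrow> 'i \<Rightarrow> real" and X :: "'i \<Rightarrow> nat" and M :: "'e \<Rightarrow> nat" and \<rho> :: "'e \<Rightarrow> real"
  assumes fin: "finite I" "finite E" and M: "\<And>e. e \<in> E \<Longrightarrow> M e \<ge> 1"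
    and \<rho>: "\<And>e. e \<in> E \<Longrightarrow> (\<Sum>i\<in>I. real (X i) * \<bar>c e i\<bar>) \<le> \<rho> e"
    and lt: "(\<Prod>e\<in>E. M e) < (\<Prod>i\<in>I. X i + 1)"
  obtains p :: "'i \<Rightarrow> int" where "\<exists>i\<in>I. p i \<noteq> 0" "\<And>i. i \<in> I \<Longrightarrow> \<bar>p i\<bar> \<le> int (X i)"
    "\<And>e. e \<in> E \<Longrightarrow> \<bar>\<Sum>i\<in>I. real_of_int (p i) * c e i\<bar> \<le> \<rho> e / real (M e)"
proof -
  define F where "F = PiE I (\<lambda>i. {..X i})"
  \<comment> \<open>The least value of the form on the box of admissible \<open>q\<close>; after
    subtracting it the values fill a range of length at most \<open>\<rho> e\<close>.\<close>
  define lo where "lo e = (\<Sum>i\<in>I. real (X i) * min (c e i) 0)" for e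
  define v where "v e q = (\<Sum>i\<in>I. real (q i) * c e i) - lo e" for e q
  define r where "r e q = v e q * real (M e) / \<rho> e" for e q
  \<comment> \<open>The cap at \<open>M e - 1\<close> puts the right end of the range into the last
    cell.\<close>
  define cell where "cell q = (\<lambda>e\<in>E. min (M e - 1) (nat \<lfloor>r e q\<rfloor>))" for q
  have v: "0 \<le> v e q" "v e q \<le> \<rho> e" if "e \<in> E" "q \<in> F" for e q
  proof -
    have q: "q i \<le> X i" if "i \<in> I" for i using \<open>q \<in> F\<close> that by (auto simp: F_def)
    have veq: "v e q = (\<Sum>i\<in>I. real (q i) * c e i - real (X i) * min (c e i) 0)"
      by (simp add: v_def lo_def sum_subtractf)
    have b: "0 \<le> real (q i) * c e i - real (X i) * min (c e i) 0 \<and>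
        real (q i) * c e i - real (X i) * min (c e i) 0 \<le> real (X i) * \<bar>c e i\<bar>" if "i \<in> I" for i
    proof (cases "c e i \<ge> 0")
      case True
      then show ?thesis using q[OF that] by (simp add: min_def mult_right_mono)
    next
      case False
      then have "real (X i) * c e i \<le> real (q i) * c e i" "real (q i) * c e i \<le> 0"
        using q[OF that] by (auto intro: mult_right_mono_neg simp: mult_nonneg_nonpos)
      then show ?thesis using False by (simp add: min_def)
    qed
    show "0 \<le> v e q" unfolding veq using b by (intro sum_nonneg) auto
    have "v e q \<le> (\<Sum>i\<in>I. real (X i) * \<bar>c e i\<bar>)"
      unfolding veq using b by (intro sum_mono) auto
    then show "v e q \<le> \<rho> e" using \<rho>[OF \<open>e \<in> E\<close>] by linarith
  qed
  have r: "real (cell q e) \<le> r e q \<and> r e q \<le> real (cell q e) + 1" if e: "e \<in> E" and q: "q \<in> F" for e q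
  proof -
    have "0 \<le> r e q" using v[OF e q] by (simp add: r_def)
    have "r e q \<le> real (M e)"
    \<comment> \<open>If \<open>\<rho> e\<close> is 0, then \<open>r e q\<close> is 0 by the
      convention x / 0 = 0.\<close>
    proof (cases "\<rho> e = 0")
      case False
      then have "\<rho> e > 0" using v[OF e q] by linarith
      then show ?thesis using v[OF e q] using mult_right_mono[of "v e q" "\<rho> e" "real (M e)"]
        by (simp add: r_def divide_le_eq mult.commute)
    qed (simp add: r_def)
    then show ?thesis
      using \<open>0 \<le> r e q\<close> e M[OF e] unfolding cell_def min_def by (auto simp: of_nat_diff) linarith+
  qed
  have "card (cell ` F) \<le> card (PiE E (\<lambda>e. {..<M e}))"
    using fin M by (intro card_mono finite_PiE) (auto simp: cell_def min_def Suc_le_eq intro!: restrict_PiE_iff[THEN iffD2])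
  also have "\<dots> = (\<Prod>e\<in>E. M e)" using fin by (simp add: card_PiE)
  also have "\<dots> < card F" using lt fin by (simp add: F_def card_PiE)
  finally have "\<not> inj_on cell F" by (rule pigeonhole)
  then obtain q q' where q: "q \<in> F" "q' \<in> F" "q \<noteq> q'" "cell q = cell q'" by (auto simp: inj_on_def)
  show ?thesis
  proof (rule that[of "\<lambda>i. int (q i) - int (q' i)"])
    show "\<exists>i\<in>I. int (q i) - int (q' i) \<noteq> 0"
    proof (rule ccontr)
      assume "\<not> ?thesis"
      then have "q i = q' i" if "i \<in> I" for i using that by auto
      then show False using q(1-3) PiE_ext[of q I "\<lambda>i. {..X i}" q'] by (auto simp: F_def)
    qed
    show "\<bar>int (q i) - int (q' i)\<bar> \<le> int (X i)" if "i \<in> I" for i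
    proof -
      have "q i \<le> X i" "q' i \<le> X i" using q that by (auto simp: F_def)
      then show ?thesis by linarith
    qed
    fix e assume e: "e \<in> E"
    have eq: "(\<Sum>i\<in>I. real_of_int (int (q i) - int (q' i)) * c e i) = v e q - v e q'"
      by (simp add: v_def left_diff_distrib sum_subtractf)
    have "\<bar>v e q - v e q'\<bar> \<le> \<rho> e / real (M e)"
    proof (cases "\<rho> e = 0")
      case True
      then show ?thesis using v[OF e q(1)] v[OF e q(2)] by simp
    next
      case False
      then have "\<rho> e > 0" using v[OF e q(1)] by linarith
      have "\<bar>r e q - r e q'\<bar> \<le> 1" using r[OF e q(1)] r[OF e q(2)] q(4) by (simp add: abs_le_iff)
      moreover have "r e q - r e q' = (v e q - v e q') * (real (M e) / \<rho> e)"
        by (simp add: r_def left_diff_distrib diff_divide_distrib)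
      ultimately have "\<bar>v e q - v e q'\<bar> * (real (M e) / \<rho> e) \<le> 1"
        using \<open>\<rho> e > 0\<close> by (simp add: abs_mult)
      then show ?thesis using \<open>\<rho> e > 0\<close> M[OF e] by (simp add: field_simps)
    qed
    then show "\<bar>\<Sum>i\<in>I. real_of_int (int (q i) - int (q' i)) * c e i\<bar> \<le> \<rho> e / real (M e)"
      unfolding eq .
  qed
qed

lemma power_le_fact_exp: "x \<ge> 0 \<Longrightarrow> x ^ n / fact n \<le> exp (x :: real)"
proof -
  assume x: "x \<ge> 0"
  have "(\<Sum>i\<in>{n}. x ^ i / fact i) \<le> (\<Sum>i. x ^ i / fact i)"
    using x summable_exp_generic[of x] by (intro sum_le_suminf) (auto simp: field_simps)
  then show ?thesis by (simp add: exp_def field_simps)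
qed

text \<open>All omitted terms have degree at least N, so passing from |x| to E |x| gains a factor
  E^N in each of them.\<close>

lemma exp_truncate:
  fixes x E :: real
  assumes "E \<ge> 1"
  shows "\<bar>exp x - (\<Sum>n<N. x ^ n / fact n)\<bar> \<le> exp (E * \<bar>x\<bar>) / E ^ N"
proof -
  have s: "summable (\<lambda>n. x ^ n / fact n)" for x :: real
    using summable_exp_generic[of x] by (simp add: field_simps)
  have e: "exp x = (\<Sum>n. x ^ n / fact n)" for x :: real
    by (simp add: exp_def field_simps)
  have "exp x - (\<Sum>n<N. x ^ n / fact n) = (\<Sum>n. x ^ (n + N) / fact (n + N))"
    unfolding e using suminf_minus_initial_segment[OF s, of x N] by simp
  also have "\<bar>\<dots>\<bar> \<le> (\<Sum>n. \<bar>x ^ (n + N) / fact (n + N)\<bar>)"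
  proof (rule summable_rabs)
    have "summable (\<lambda>n. \<bar>x\<bar> ^ (n + N) / fact (n + N))" using s[of "\<bar>x\<bar>"] summable_ignore_initial_segment by blast
    then show "summable (\<lambda>n. \<bar>x ^ (n + N) / fact (n + N)\<bar>)" by (simp add: power_abs)
  qed
  also have "\<dots> \<le> (\<Sum>n. (E * \<bar>x\<bar>) ^ (n + N) / fact (n + N) / E ^ N)"
  proof (rule suminf_le)
    show "\<bar>x ^ (n + N) / fact (n + N)\<bar> \<le> (E * \<bar>x\<bar>) ^ (n + N) / fact (n + N) / E ^ N" for n
    proof -
      have "1 \<le> E ^ n" using assms by simp
      then have "\<bar>x\<bar> ^ (n + N) \<le> E ^ n * \<bar>x\<bar> ^ (n + N)"
        using mult_right_mono[of 1 "E ^ n" "\<bar>x\<bar> ^ (n + N)"] by simp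
      also have "\<dots> = (E * \<bar>x\<bar>) ^ (n + N) / E ^ N"
        using assms by (simp add: power_mult_distrib power_add)
      finally show ?thesis by (simp add: power_abs divide_right_mono field_simps)
    qed
    have s': "summable (\<lambda>n. x ^ (n + N) / fact (n + N))" for x :: real
      using s[of x] summable_ignore_initial_segment by blast
    show "summable (\<lambda>n. \<bar>x ^ (n + N) / fact (n + N)\<bar>)" using s'[of "\<bar>x\<bar>"] by (simp add: power_abs)
    show "summable (\<lambda>n. (E * \<bar>x\<bar>) ^ (n + N) / fact (n + N) / E ^ N)"
      using s'[of "E * \<bar>x\<bar>"] by (rule summable_divide)
  qed
  also have "\<dots> = (\<Sum>n. (E * \<bar>x\<bar>) ^ (n + N) / fact (n + N)) / E ^ N"
    by (rule suminf_divide) (use s[of "E * \<bar>x\<bar>"] summable_ignore_initial_segment in blast)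
  also have "\<dots> \<le> exp (E * \<bar>x\<bar>) / E ^ N"
  proof (rule divide_right_mono)
    have "0 \<le> (\<Sum>n<N. (E * \<bar>x\<bar>) ^ n / fact n)" using assms by (intro sum_nonneg) auto
    then show "(\<Sum>n. (E * \<bar>x\<bar>) ^ (n + N) / fact (n + N)) \<le> exp (E * \<bar>x\<bar>)"
      unfolding e using suminf_minus_initial_segment[OF s, of "E * \<bar>x\<bar>" N] by simp
  qed (use assms in simp)
  finally show ?thesis .
qed

text \<open>Siegel's lemma applied to the Taylor coefficients of \<open>h\<^sub>i(u, w) e\<^bsup>j(\<ell>\<^sub>0 + A w)\<^esup>\<close>: the coefficient of
  \<open>w\<^sup>m\<close> decays like \<open>E\<^bsup>-m\<^esup>\<close>, so it only needs \<open>E\<^bsup>n\<^sub>1 - m\<^esup>\<close> cells.\<close>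

lemma auxiliary_function:
  fixes I :: "'i set" and d :: "'i \<Rightarrow> nat \<Rightarrow> nat \<Rightarrow> real" and h :: "'i \<Rightarrow> 'p \<Rightarrow> real"
    and u w :: "'p \<Rightarrow> real" and Bd :: "'i \<Rightarrow> real" and P :: "'p set" and E Ku R n1 L :: nat
    and U W Y G A l0 :: real
  assumes I: "finite I" and pos: "E \<ge> 2" "U > 0" "W > 0" "Y > 0" "G > 0"
    and Bd: "\<And>i. i \<in> I \<Longrightarrow> Bd i > 0"
    and h: "\<And>i p. i \<in> I \<Longrightarrow> p \<in> P \<Longrightarrow> h i p = (\<Sum>a<Ku. \<Sum>r<R. d i a r * u p ^ a * w p ^ r)"
    and norm: "\<And>i. i \<in> I \<Longrightarrow> (\<Sum>a<Ku. \<Sum>r<R. \<bar>d i a r\<bar> * U ^ a * (real E * W) ^ r) \<le> Bd i"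
    and u: "\<And>p. p \<in> P \<Longrightarrow> \<bar>u p\<bar> \<le> U" and w: "\<And>p. p \<in> P \<Longrightarrow> \<bar>w p\<bar> \<le> W"
    and G: "\<And>j. j < L \<Longrightarrow> exp (real j * l0 + real j * \<bar>A\<bar> * (real E * W)) \<le> G"
    and big: "real E ^ (Ku * (n1 * (n1 + 1) div 2)) < (\<Prod>i\<in>I. Y / Bd i) ^ L"
  obtains q :: "'i \<Rightarrow> nat \<Rightarrow> int" where "\<exists>i\<in>I. \<exists>j<L. q i j \<noteq> 0"
    "\<And>i j. i \<in> I \<Longrightarrow> j < L \<Longrightarrow> \<bar>real_of_int (q i j)\<bar> \<le> Y / Bd i"
    "\<And>p. p \<in> P \<Longrightarrow> \<bar>\<Sum>i\<in>I. \<Sum>j<L. real_of_int (q i j) * (h i p * exp (real j * (l0 + A * w p)))\<bar>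
       \<le> (real Ku * real n1 + 1) * (real (card I) * real L) * Y * G / real E ^ n1"
proof -
  define X where "X = (\<lambda>(i, j :: nat). nat \<lfloor>Y / Bd i\<rfloor>)"
  define J where "J = I \<times> {..<L}"
  define Ee where "Ee = {..<Ku} \<times> {..<n1}"
  define M where "M = (\<lambda>(a :: nat, m). E ^ (n1 - m))"
  \<comment> \<open>The coefficient of (u / U)^a (w / W)^m in h_i exp (j (l0 + A w)); the scaled
    variables u / U and w / W are at most 1 in absolute value.\<close>
  define c where "c = (\<lambda>(a, m) (i, j). exp (real j * l0) * U ^ a * W ^ m *
    (\<Sum>r<R. if r \<le> m then d i a r * ((real j * A) ^ (m - r) / fact (m - r)) else 0))"
  define \<rho> where "\<rho> = (\<lambda>(a :: nat, m). real (card I) * real L * Y * G / real E ^ m)"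
  have finJ: "finite J" "finite Ee" using I by (auto simp: J_def Ee_def)
  have X: "real (X (i, j)) \<le> Y / Bd i" if "i \<in> I" for i j
    using Bd[OF that] pos by (simp add: X_def)
  \<comment> \<open>A Cauchy estimate at the radius E W, carried out on absolute values of
    coefficients instead of by complex integration.\<close>
  have ch: "\<bar>c (a, m) (i, j)\<bar> * real E ^ m \<le> Bd i * G" if "a < Ku" "i \<in> I" "j < L" for a m i j
  proof -
    let ?x = "real j * \<bar>A\<bar> * (real E * W)"
    have "\<bar>c (a, m) (i, j)\<bar> * real E ^ m = exp (real j * l0) * U ^ a * (real E * W) ^ m *
      \<bar>\<Sum>r<R. if r \<le> m then d i a r * ((real j * A) ^ (m - r) / fact (m - r)) else 0\<bar>"
      using pos by (simp add: c_def abs_mult power_mult_distrib)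
    also have "\<dots> \<le> exp (real j * l0) * U ^ a * (real E * W) ^ m *
      (\<Sum>r<R. \<bar>if r \<le> m then d i a r * ((real j * A) ^ (m - r) / fact (m - r)) else 0\<bar>)"
      using pos by (intro mult_left_mono sum_abs) auto
    also have "\<dots> = exp (real j * l0) * (\<Sum>r<R. U ^ a * (real E * W) ^ m *
       \<bar>if r \<le> m then d i a r * ((real j * A) ^ (m - r) / fact (m - r)) else 0\<bar>)"
      by (simp add: sum_distrib_left mult_ac)
    also have "\<dots> \<le> exp (real j * l0) * (\<Sum>r<R. \<bar>d i a r\<bar> * U ^ a * (real E * W) ^ r * exp ?x)"
    proof (intro mult_left_mono sum_mono)
      fix r
      show "U ^ a * (real E * W) ^ m * \<bar>if r \<le> m then d i a r * ((real j * A) ^ (m - r) / fact (m - r)) else 0\<bar>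
        \<le> \<bar>d i a r\<bar> * U ^ a * (real E * W) ^ r * exp ?x"
      proof (cases "r \<le> m")
        case True
        then have "(real E * W) ^ m = (real E * W) ^ r * (real E * W) ^ (m - r)"
          by (simp flip: power_add)
        then have "U ^ a * (real E * W) ^ m * \<bar>d i a r * ((real j * A) ^ (m - r) / fact (m - r))\<bar> =
          \<bar>d i a r\<bar> * U ^ a * (real E * W) ^ r * (?x ^ (m - r) / fact (m - r))"
          by (simp add: abs_mult power_mult_distrib power_abs mult_ac)
        also have "\<dots> \<le> \<bar>d i a r\<bar> * U ^ a * (real E * W) ^ r * exp ?x"
          using pos by (intro mult_left_mono power_le_fact_exp) auto
        finally show ?thesis using True by simp
      qed (use pos in auto)
    qed auto
    also have "\<dots> = (\<Sum>r<R. \<bar>d i a r\<bar> * U ^ a * (real E * W) ^ r) * exp (real j * l0 + ?x)"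
      by (simp add: sum_distrib_right sum_distrib_left exp_add mult_ac)
    also have "\<dots> \<le> Bd i * G"
    proof (intro mult_mono G that)
      have "(\<Sum>r<R. \<bar>d i a r\<bar> * U ^ a * (real E * W) ^ r) \<le> (\<Sum>a<Ku. \<Sum>r<R. \<bar>d i a r\<bar> * U ^ a * (real E * W) ^ r)"
        using that pos by (intro member_le_sum) (auto intro!: sum_nonneg)
      then show "(\<Sum>r<R. \<bar>d i a r\<bar> * U ^ a * (real E * W) ^ r) \<le> Bd i"
        using norm[OF that(2)] by linarith
    qed (use Bd[OF that(2)] in auto)
    finally show ?thesis .
  qed
  have M1: "M e \<ge> 1" if "e \<in> Ee" for e using pos by (auto simp: M_def split: prod.splits)
  have \<rho>: "(\<Sum>z\<in>J. real (X z) * \<bar>c e z\<bar>) \<le> \<rho> e" if e: "e \<in> Ee" for e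
  proof -
    obtain a m where am: "e = (a, m)" "a < Ku" using e by (auto simp: Ee_def)
    have "(\<Sum>z\<in>J. real (X z) * \<bar>c e z\<bar>) \<le> (\<Sum>z\<in>J. Y * G / real E ^ m)"
    proof (intro sum_mono)
      fix z assume "z \<in> J"
      then obtain i j where z: "z = (i, j)" "i \<in> I" "j < L" by (auto simp: J_def)
      have "real (X z) * \<bar>c e z\<bar> * real E ^ m \<le> (Y / Bd i) * (Bd i * G)"
        unfolding mult.assoc[of "real (X z)"] using X[OF z(2)] ch[OF am(2) z(2,3)] z(1) am(1) pos Bd[OF z(2)]
        by (intro mult_mono[of "real (X z)"]) auto
      also have "\<dots> = Y * G" using Bd[OF z(2)] by simp
      finally show "real (X z) * \<bar>c e z\<bar> \<le> Y * G / real E ^ m" using pos by (simp add: le_divide_eq)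
    qed
    also have "\<dots> = \<rho> e" by (simp add: J_def \<rho>_def am card_cartesian_product)
    finally show ?thesis .
  qed
  have "(\<Prod>e\<in>Ee. M e) = E ^ (Ku * (n1 * (n1 + 1) div 2))"
  proof -
    have "(\<Prod>m<n1. E ^ (n1 - m)) = E ^ (n1 * (n1 + 1) div 2)"
    proof -
      have "(\<Sum>m<n1. n1 - m) = (\<Sum>m<n1. Suc m)"
        by (subst sum.nat_diff_reindex[symmetric]) (intro sum.cong, auto)
      also have "\<dots> = n1 * (n1 + 1) div 2" by (induction n1) auto
      finally show ?thesis by (simp only: power_sum[symmetric])
    qed
    then show ?thesis
      by (simp add: Ee_def M_def prod.cartesian_product[symmetric] power_mult mult.commute flip: power_mult)
  qed
  moreover have "real E ^ (Ku * (n1 * (n1 + 1) div 2)) < real (\<Prod>z\<in>J. X z + 1)"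
  proof -
    have "(\<Prod>i\<in>I. Y / Bd i) ^ L = (\<Prod>i\<in>I. \<Prod>j<L. Y / Bd i)"
      by (simp add: prod_power_distrib)
    also have "\<dots> = (\<Prod>z\<in>J. Y / Bd (fst z))"
      by (simp only: J_def prod.cartesian_product case_prod_unfold)
    also have "\<dots> \<le> (\<Prod>z\<in>J. real (X z + 1))"
    proof (intro prod_mono conjI)
      fix z assume "z \<in> J"
      then have i: "fst z \<in> I" by (auto simp: J_def)
      show "0 \<le> Y / Bd (fst z)" using Bd[OF i] pos by simp
      show "Y / Bd (fst z) \<le> real (X z + 1)" by (cases z) (simp add: X_def, linarith)
    qed
    finally show ?thesis using big by (simp add: of_nat_prod)
  qed
  ultimately have "real (\<Prod>e\<in>Ee. M e) < real (\<Prod>z\<in>J. X z + 1)" by simp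
  then have "(\<Prod>e\<in>Ee. M e) < (\<Prod>z\<in>J. X z + 1)" by (simp only: of_nat_less_iff)
  from siegel_real[of J Ee M X c \<rho>, OF finJ M1 \<rho> this]
  obtain q where q: "\<exists>z\<in>J. q z \<noteq> 0" "\<And>z. z \<in> J \<Longrightarrow> \<bar>q z\<bar> \<le> int (X z)"
    "\<And>e. e \<in> Ee \<Longrightarrow> \<bar>\<Sum>z\<in>J. real_of_int (q z) * c e z\<bar> \<le> \<rho> e / real (M e)" by blast
  have qX: "\<bar>real_of_int (q (i, j))\<bar> \<le> Y / Bd i" if "i \<in> I" "j < L" for i j
    using q(2)[of "(i, j)"] X[OF that(1), of j] that by (simp add: J_def)
  define T where "T = real (card I) * real L * Y * G / real E ^ n1"
  have main: "\<bar>h i p * exp (real j * (l0 + A * w p)) - (\<Sum>(a, m)\<in>Ee. c (a, m) (i, j) * (u p / U) ^ a * (w p / W) ^ m)\<bar>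
      \<le> Bd i * G / real E ^ n1" if i: "i \<in> I" and j: "j < L" and p: "p \<in> P" for i j p
  proof -
    define x where "x = real j * A * w p"
    define tr where "tr N = (\<Sum>n<N. x ^ n / fact n)" for N
    have "(\<Sum>(a, m)\<in>Ee. c (a, m) (i, j) * (u p / U) ^ a * (w p / W) ^ m) =
      (\<Sum>a<Ku. \<Sum>m<n1. c (a, m) (i, j) * (u p / U) ^ a * (w p / W) ^ m)"
      by (simp add: Ee_def sum.cartesian_product)
    also have "\<dots> = (\<Sum>a<Ku. \<Sum>r<R. exp (real j * l0) * d i a r * u p ^ a * w p ^ r * tr (n1 - r))"
    proof (rule sum.cong[OF refl])
      fix a
      have "(\<Sum>m<n1. c (a, m) (i, j) * (u p / U) ^ a * (w p / W) ^ m) =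
        (\<Sum>m<n1. \<Sum>r<R. exp (real j * l0) * d i a r * u p ^ a *
          (if r \<le> m then (real j * A) ^ (m - r) / fact (m - r) * w p ^ m else 0))"
        using pos by (intro sum.cong refl) (simp add: c_def power_divide sum_distrib_left sum_distrib_right
            mult_ac if_distrib cong: if_cong)
      also have "\<dots> = (\<Sum>r<R. exp (real j * l0) * d i a r * u p ^ a *
          (\<Sum>m<n1. if r \<le> m then (real j * A) ^ (m - r) / fact (m - r) * w p ^ m else 0))"
        by (subst sum.swap) (simp add: sum_distrib_left)
      also have "\<dots> = (\<Sum>r<R. exp (real j * l0) * d i a r * u p ^ a * (w p ^ r * tr (n1 - r)))"
      proof (intro sum.cong refl arg_cong2[where f = "(*)"])
        fix r
        have "(\<Sum>m<n1. if r \<le> m then (real j * A) ^ (m - r) / fact (m - r) * w p ^ m else 0) =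
          (\<Sum>m\<in>{r..<n1}. (real j * A) ^ (m - r) / fact (m - r) * w p ^ m)"
          by (intro sum.mono_neutral_cong_right) auto
        also have "\<dots> = (\<Sum>n<n1 - r. (real j * A) ^ n / fact n * w p ^ (r + n))"
          by (rule sum.reindex_bij_witness[of _ "\<lambda>n. r + n" "\<lambda>m. m - r"]) auto
        also have "\<dots> = w p ^ r * tr (n1 - r)"
          by (simp add: tr_def x_def sum_distrib_left power_add power_mult_distrib mult_ac)
        finally show "(\<Sum>m<n1. if r \<le> m then (real j * A) ^ (m - r) / fact (m - r) * w p ^ m else 0) =
          w p ^ r * tr (n1 - r)" .
      qed
      finally show "(\<Sum>m<n1. c (a, m) (i, j) * (u p / U) ^ a * (w p / W) ^ m) =
        (\<Sum>r<R. exp (real j * l0) * d i a r * u p ^ a * w p ^ r * tr (n1 - r))"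
        by (simp add: mult_ac)
    qed
    finally have S: "(\<Sum>(a, m)\<in>Ee. c (a, m) (i, j) * (u p / U) ^ a * (w p / W) ^ m) =
      (\<Sum>a<Ku. \<Sum>r<R. exp (real j * l0) * d i a r * u p ^ a * w p ^ r * tr (n1 - r))" .
    have "h i p * exp (real j * (l0 + A * w p)) =
      (\<Sum>a<Ku. \<Sum>r<R. exp (real j * l0) * d i a r * u p ^ a * w p ^ r * exp x)"
      by (simp add: h[OF i p] sum_distrib_left sum_distrib_right x_def distrib_left exp_add mult_ac)
    then have "\<bar>h i p * exp (real j * (l0 + A * w p)) - (\<Sum>(a, m)\<in>Ee. c (a, m) (i, j) * (u p / U) ^ a * (w p / W) ^ m)\<bar>
      = \<bar>\<Sum>a<Ku. \<Sum>r<R. exp (real j * l0) * d i a r * u p ^ a * w p ^ r * (exp x - tr (n1 - r))\<bar>"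
      unfolding S by (simp add: right_diff_distrib sum_subtractf)
    also have "\<dots> \<le> (\<Sum>a<Ku. \<Sum>r<R. \<bar>exp (real j * l0) * d i a r * u p ^ a * w p ^ r * (exp x - tr (n1 - r))\<bar>)"
      by (intro order.trans[OF sum_abs] sum_mono sum_abs)
    also have "\<dots> \<le> (\<Sum>a<Ku. \<Sum>r<R. \<bar>d i a r\<bar> * U ^ a * (real E * W) ^ r * (G / real E ^ n1))"
    proof (intro sum_mono)
      fix a r
      have 1: "\<bar>u p\<bar> ^ a \<le> U ^ a" "\<bar>w p\<bar> ^ r \<le> W ^ r" using u[OF p] w[OF p] by (auto intro: power_mono)
      have "\<bar>exp x - tr (n1 - r)\<bar> \<le> exp (real E * \<bar>x\<bar>) / real E ^ (n1 - r)"
        unfolding tr_def using pos by (intro exp_truncate) simp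
      also have "\<dots> \<le> exp (real j * \<bar>A\<bar> * (real E * W)) / real E ^ (n1 - r)"
      proof -
        have "real E * \<bar>x\<bar> = (real j * \<bar>A\<bar> * real E) * \<bar>w p\<bar>" by (simp add: x_def abs_mult)
        also have "\<dots> \<le> (real j * \<bar>A\<bar> * real E) * W" using w[OF p] by (intro mult_left_mono) auto
        finally show ?thesis by (intro divide_right_mono) (auto simp: mult.assoc)
      qed
      also have "\<dots> \<le> exp (real j * \<bar>A\<bar> * (real E * W)) * (real E ^ r / real E ^ n1)"
      proof -
        \<comment> \<open>With truncated subtraction n1 <= r + (n1 - r) holds also for r > n1, where
          the Taylor sum is empty.\<close>
        have "real E ^ n1 \<le> real E ^ r * real E ^ (n1 - r)"
          using pos by (simp flip: power_add)
        then have "1 / real E ^ (n1 - r) \<le> real E ^ r / real E ^ n1"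
          using pos by (simp add: field_simps)
        from mult_left_mono[OF this, of "exp (real j * \<bar>A\<bar> * (real E * W))"] show ?thesis by simp
      qed
      finally have 2: "\<bar>exp x - tr (n1 - r)\<bar> \<le> exp (real j * \<bar>A\<bar> * (real E * W)) * (real E ^ r / real E ^ n1)" .
      have "\<bar>exp (real j * l0) * d i a r * u p ^ a * w p ^ r * (exp x - tr (n1 - r))\<bar> =
        exp (real j * l0) * \<bar>d i a r\<bar> * \<bar>u p\<bar> ^ a * \<bar>w p\<bar> ^ r * \<bar>exp x - tr (n1 - r)\<bar>"
        by (simp add: abs_mult power_abs)
      also have "\<dots> \<le> exp (real j * l0) * \<bar>d i a r\<bar> * U ^ a * W ^ r *
          (exp (real j * \<bar>A\<bar> * (real E * W)) * (real E ^ r / real E ^ n1))"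
        using 1 2 pos by (intro mult_mono) auto
      also have "\<dots> = \<bar>d i a r\<bar> * U ^ a * (real E * W) ^ r *
          (exp (real j * l0 + real j * \<bar>A\<bar> * (real E * W)) / real E ^ n1)"
        by (simp add: exp_add power_mult_distrib)
      also have "\<dots> \<le> \<bar>d i a r\<bar> * U ^ a * (real E * W) ^ r * (G / real E ^ n1)"
        using pos G[OF j] by (intro mult_left_mono divide_right_mono) auto
      finally show "\<bar>exp (real j * l0) * d i a r * u p ^ a * w p ^ r * (exp x - tr (n1 - r))\<bar>
        \<le> \<bar>d i a r\<bar> * U ^ a * (real E * W) ^ r * (G / real E ^ n1)" .
    qed
    also have "\<dots> = (\<Sum>a<Ku. \<Sum>r<R. \<bar>d i a r\<bar> * U ^ a * (real E * W) ^ r) * (G / real E ^ n1)"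
      by (simp only: sum_distrib_right)
    also have "\<dots> \<le> Bd i * (G / real E ^ n1)" using norm[OF i] pos by (intro mult_right_mono) auto
    finally show ?thesis by simp
  qed
  show ?thesis
  proof (rule that[of "\<lambda>i j. q (i, j)"])
    show "\<exists>i\<in>I. \<exists>j<L. q (i, j) \<noteq> 0" using q(1) by (auto simp: J_def)
    show "\<bar>real_of_int (q (i, j))\<bar> \<le> Y / Bd i" if "i \<in> I" "j < L" for i j by (rule qX[OF that])
    fix p assume p: "p \<in> P"
    define g where "g = (\<lambda>(a, m). (u p / U) ^ a * (w p / W) ^ m)"
    have g1: "\<bar>g e\<bar> \<le> 1" for e
    proof -
      have "\<bar>u p / U\<bar> \<le> 1" "\<bar>w p / W\<bar> \<le> 1" using u[OF p] w[OF p] pos by auto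
      then show ?thesis
        by (auto simp: g_def abs_mult power_abs mult_le_one power_le_one split: prod.splits)
    qed
    define f where "f = (\<lambda>(i, j). h i p * exp (real j * (l0 + A * w p)))"
    have "(\<Sum>i\<in>I. \<Sum>j<L. real_of_int (q (i, j)) * (h i p * exp (real j * (l0 + A * w p)))) =
      (\<Sum>z\<in>J. real_of_int (q z) * f z)"
      by (simp add: J_def sum.cartesian_product f_def case_prod_beta)
    \<comment> \<open>Each function is split into remainder and Taylor polynomial. The remainders
      obey \<open>main\<close>; each of the \<open>Ku * n1\<close> combined Taylor coefficients is
      at most \<open>T\<close>, since decay E^-m and number of cells E^(n1 - m) multiply to the same
      E^-n1.\<close>
    also have "\<dots> = (\<Sum>z\<in>J. real_of_int (q z) * (f z - (\<Sum>e\<in>Ee. c e z * g e))) +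
        (\<Sum>e\<in>Ee. (\<Sum>z\<in>J. real_of_int (q z) * c e z) * g e)"
    proof -
      have "(\<Sum>e\<in>Ee. (\<Sum>z\<in>J. real_of_int (q z) * c e z) * g e) =
        (\<Sum>z\<in>J. real_of_int (q z) * (\<Sum>e\<in>Ee. c e z * g e))"
        by (simp add: sum_distrib_right sum_distrib_left mult.assoc) (rule sum.swap)
      then show ?thesis by (simp add: sum.distrib[symmetric] algebra_simps)
    qed
    also have "\<bar>\<dots>\<bar> \<le> (\<Sum>z\<in>J. \<bar>real_of_int (q z) * (f z - (\<Sum>e\<in>Ee. c e z * g e))\<bar>) +
        (\<Sum>e\<in>Ee. \<bar>(\<Sum>z\<in>J. real_of_int (q z) * c e z) * g e\<bar>)"
      by (intro order.trans[OF abs_triangle_ineq] add_mono sum_abs)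
    also have "\<dots> \<le> (\<Sum>z\<in>J. Y * G / real E ^ n1) + (\<Sum>e\<in>Ee. T)"
    proof (intro add_mono sum_mono)
      fix z assume "z \<in> J"
      then obtain i j where z: "z = (i, j)" "i \<in> I" "j < L" by (auto simp: J_def)
      have "\<bar>f z - (\<Sum>e\<in>Ee. c e z * g e)\<bar> \<le> Bd i * G / real E ^ n1"
        using main[OF z(2,3) p] by (simp add: f_def g_def z case_prod_beta mult.assoc)
      then have "\<bar>real_of_int (q z)\<bar> * \<bar>f z - (\<Sum>e\<in>Ee. c e z * g e)\<bar> \<le> (Y / Bd i) * (Bd i * G / real E ^ n1)"
        using qX[OF z(2,3)] z(1) pos Bd[OF z(2)] by (intro mult_mono) auto
      then show "\<bar>real_of_int (q z) * (f z - (\<Sum>e\<in>Ee. c e z * g e))\<bar> \<le> Y * G / real E ^ n1"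
        using Bd[OF z(2)] by (simp add: abs_mult)
    next
      fix e assume e: "e \<in> Ee"
      obtain a m where am: "e = (a, m)" "m < n1" using e by (auto simp: Ee_def)
      have "\<rho> e / real (M e) = T"
        using am pos by (simp add: \<rho>_def M_def T_def flip: power_add)
      then have "\<bar>\<Sum>z\<in>J. real_of_int (q z) * c e z\<bar> \<le> T" using q(3)[OF e] by simp
      then show "\<bar>(\<Sum>z\<in>J. real_of_int (q z) * c e z) * g e\<bar> \<le> T"
        using g1[of e] mult_mono[of "\<bar>\<Sum>z\<in>J. real_of_int (q z) * c e z\<bar>" T "\<bar>g e\<bar>" 1]
        by (simp add: abs_mult)
    qed
    also have "\<dots> = (real Ku * real n1 + 1) * (real (card I) * real L) * Y * G / real E ^ n1"
      by (simp add: J_def Ee_def T_def card_cartesian_product algebra_simps add_divide_distrib)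
    finally show "\<bar>\<Sum>i\<in>I. \<Sum>j<L. real_of_int (q (i, j)) * (h i p * exp (real j * (l0 + A * w p)))\<bar>
       \<le> (real Ku * real n1 + 1) * (real (card I) * real L) * Y * G / real E ^ n1" .
  qed
qed

section \<open>Polynomials with a coefficient majorant\<close>

text \<open>The norm bounded by \<open>B\<close> is the sum of the absolute coefficients weighted by
  powers of \<open>U\<close> and \<open>V\<close>. It is submultiplicative, it is what the Taylor
  estimate needs, and it bounds the values for |u| <= U, |w| <= V as well. The bound
  \<open>n\<close> on the total degree keeps products inside the index range given by
  \<open>K\<close>.\<close>

definition maj_poly :: "nat \<Rightarrow> nat \<Rightarrow> real \<Rightarrow> real \<Rightarrow> real \<Rightarrow> (real \<Rightarrow> real \<Rightarrow> real) \<Rightarrow> bool" where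
  "maj_poly K n U V B f \<longleftrightarrow> (\<exists>d. (\<forall>a r. n < a + r \<longrightarrow> d a r = 0) \<and>
     (\<forall>u w. f u w = (\<Sum>a<K. \<Sum>r<K. d a r * u ^ a * w ^ r)) \<and>
     (\<Sum>a<K. \<Sum>r<K. \<bar>d a r\<bar> * U ^ a * V ^ r) \<le> B)"

lemma maj_poly_const:
  assumes "K > 0"
  shows "maj_poly K 0 U V \<bar>c\<bar> (\<lambda>_ _. c)"
  unfolding maj_poly_def
proof (intro exI conjI allI impI)
  let ?d = "\<lambda>a r. if a = 0 \<and> r = 0 then c else 0"
  have 1: "(\<Sum>a<K. \<Sum>r<K. (if a = 0 \<and> r = 0 then x else 0) * F a r) = x * F 0 0" for x :: real and F
  proof -
    have "(\<Sum>a<K. \<Sum>r<K. (if a = 0 \<and> r = 0 then x else 0) * F a r) =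
      (\<Sum>a<K. if a = 0 then x * F 0 0 else 0)"
      using assms by (intro sum.cong refl) (auto simp: if_distrib[of "\<lambda>z. z * _"] sum.delta cong: if_cong)
    then show ?thesis using assms by simp
  qed
  show "c = (\<Sum>a<K. \<Sum>r<K. ?d a r * u ^ a * w ^ r)" for u w
    using 1[of c "\<lambda>a r. u ^ a * w ^ r"] by (simp add: mult.assoc)
  have "(\<Sum>a<K. \<Sum>r<K. \<bar>?d a r\<bar> * U ^ a * V ^ r) = \<bar>c\<bar>"
    using 1[of "\<bar>c\<bar>" "\<lambda>a r. U ^ a * V ^ r"] by (simp add: mult.assoc if_distrib[of abs] cong: if_cong)
  then show "(\<Sum>a<K. \<Sum>r<K. \<bar>?d a r\<bar> * U ^ a * V ^ r) \<le> \<bar>c\<bar>" by simp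
qed auto

lemma sum_shift_power:
  fixes F :: "nat \<Rightarrow> real"
  assumes "K > 0" "F (K - 1) = 0"
  shows "(\<Sum>a<K. (if a = 0 then 0 else F (a - 1)) * x ^ a) = x * (\<Sum>a<K. F a * x ^ a)"
proof -
  obtain K' where K: "K = Suc K'" using assms(1) by (cases K) auto
  have "(\<Sum>a<K. (if a = 0 then 0 else F (a - 1)) * x ^ a) = (\<Sum>a<K'. F a * x ^ Suc a)"
    unfolding K by (subst sum.lessThan_Suc_shift) simp
  then show ?thesis using assms(2) by (simp add: K sum_distrib_left mult_ac)
qed

lemma maj_poly_linear:
  assumes f: "maj_poly K n U V B f" and K: "n + 1 < K" and UV: "U \<ge> 0" "V \<ge> 0"
  shows "maj_poly K (n + 1) U V (B * (\<bar>\<alpha>\<bar> * U + \<bar>\<beta>\<bar> * V + \<bar>\<gamma>\<bar>)) (\<lambda>u w. f u w * (\<alpha> * u + \<beta> * w + \<gamma>))"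
proof -
  obtain d where d: "\<And>a r. n < a + r \<Longrightarrow> d a r = 0"
    "\<And>u w. f u w = (\<Sum>a<K. \<Sum>r<K. d a r * u ^ a * w ^ r)"
    "(\<Sum>a<K. \<Sum>r<K. \<bar>d a r\<bar> * U ^ a * V ^ r) \<le> B"
    using f unfolding maj_poly_def by blast
  define d1 where "d1 a r = (if a = 0 then 0 else d (a - 1) r)" for a r
  define d2 where "d2 a r = (if r = 0 then 0 else d a (r - 1))" for a r
  have s1: "(\<Sum>a<K. \<Sum>r<K. g (d1 a r) * u ^ a * w ^ r) = u * (\<Sum>a<K. \<Sum>r<K. g (d a r) * u ^ a * w ^ r)"
    if "g 0 = 0" for g :: "real \<Rightarrow> real" and u w
  proof -
    have "(\<Sum>a<K. \<Sum>r<K. g (d1 a r) * u ^ a * w ^ r) =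
      (\<Sum>a<K. (if a = 0 then 0 else (\<lambda>a. \<Sum>r<K. g (d a r) * w ^ r) (a - 1)) * u ^ a)"
      using that by (intro sum.cong refl) (auto simp: d1_def sum_distrib_left sum_distrib_right mult_ac)
    also have "\<dots> = u * (\<Sum>a<K. (\<lambda>a. \<Sum>r<K. g (d a r) * w ^ r) a * u ^ a)"
      using K d(1) that by (intro sum_shift_power) (auto intro!: sum.neutral)
    finally show ?thesis by (simp add: sum_distrib_left sum_distrib_right mult_ac)
  qed
  have s2: "(\<Sum>a<K. \<Sum>r<K. g (d2 a r) * u ^ a * w ^ r) = w * (\<Sum>a<K. \<Sum>r<K. g (d a r) * u ^ a * w ^ r)"
    if "g 0 = 0" for g :: "real \<Rightarrow> real" and u w
  proof -
    have "(\<Sum>r<K. g (d2 a r) * u ^ a * w ^ r) = w * (\<Sum>r<K. g (d a r) * u ^ a * w ^ r)" for a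
    proof -
      have "(\<Sum>r<K. g (d2 a r) * u ^ a * w ^ r) =
        (\<Sum>r<K. (if r = 0 then 0 else (\<lambda>r. g (d a r) * u ^ a) (r - 1)) * w ^ r)"
        using that by (intro sum.cong refl) (auto simp: d2_def)
      also have "\<dots> = w * (\<Sum>r<K. (\<lambda>r. g (d a r) * u ^ a) r * w ^ r)"
        using K d(1) that by (intro sum_shift_power) auto
      finally show ?thesis by simp
    qed
    then show ?thesis by (simp add: sum_distrib_left)
  qed
  let ?d = "\<lambda>a r. \<alpha> * d1 a r + \<beta> * d2 a r + \<gamma> * d a r"
  show ?thesis
    unfolding maj_poly_def
  proof (intro exI conjI allI impI)
    show "?d a r = 0" if "n + 1 < a + r" for a r
      using that d(1) by (auto simp: d1_def d2_def)
    show "f u w * (\<alpha> * u + \<beta> * w + \<gamma>) = (\<Sum>a<K. \<Sum>r<K. ?d a r * u ^ a * w ^ r)" for u w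
    proof -
      have "(\<Sum>a<K. \<Sum>r<K. ?d a r * u ^ a * w ^ r) = \<alpha> * (\<Sum>a<K. \<Sum>r<K. d1 a r * u ^ a * w ^ r) +
        \<beta> * (\<Sum>a<K. \<Sum>r<K. d2 a r * u ^ a * w ^ r) + \<gamma> * (\<Sum>a<K. \<Sum>r<K. d a r * u ^ a * w ^ r)"
        by (simp add: sum_distrib_left sum.distrib[symmetric] algebra_simps)
      then show ?thesis using s1[of "\<lambda>x. x" u w] s2[of "\<lambda>x. x" u w] by (simp add: d(2) algebra_simps)
    qed
    have "(\<Sum>a<K. \<Sum>r<K. \<bar>?d a r\<bar> * U ^ a * V ^ r) \<le>
      (\<Sum>a<K. \<Sum>r<K. (\<bar>\<alpha>\<bar> * \<bar>d1 a r\<bar> + \<bar>\<beta>\<bar> * \<bar>d2 a r\<bar> + \<bar>\<gamma>\<bar> * \<bar>d a r\<bar>) * U ^ a * V ^ r)"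
      using UV by (intro sum_mono mult_right_mono) (auto simp: abs_mult[symmetric])
    also have "\<dots> = \<bar>\<alpha>\<bar> * (\<Sum>a<K. \<Sum>r<K. \<bar>d1 a r\<bar> * U ^ a * V ^ r) +
        \<bar>\<beta>\<bar> * (\<Sum>a<K. \<Sum>r<K. \<bar>d2 a r\<bar> * U ^ a * V ^ r) + \<bar>\<gamma>\<bar> * (\<Sum>a<K. \<Sum>r<K. \<bar>d a r\<bar> * U ^ a * V ^ r)"
      by (simp add: sum_distrib_left sum.distrib[symmetric] algebra_simps)
    also have "\<dots> = (\<Sum>a<K. \<Sum>r<K. \<bar>d a r\<bar> * U ^ a * V ^ r) * (\<bar>\<alpha>\<bar> * U + \<bar>\<beta>\<bar> * V + \<bar>\<gamma>\<bar>)"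
      using s1[of abs U V] s2[of abs U V] by (simp add: algebra_simps)
    also have "\<dots> \<le> B * (\<bar>\<alpha>\<bar> * U + \<bar>\<beta>\<bar> * V + \<bar>\<gamma>\<bar>)"
      using d(3) UV by (intro mult_right_mono) auto
    finally show "(\<Sum>a<K. \<Sum>r<K. \<bar>?d a r\<bar> * U ^ a * V ^ r) \<le> B * (\<bar>\<alpha>\<bar> * U + \<bar>\<beta>\<bar> * V + \<bar>\<gamma>\<bar>)" .
  qed
qed

lemma maj_poly_mono: "maj_poly K n U V B f \<Longrightarrow> B \<le> B' \<Longrightarrow> maj_poly K n U V B' f"
  unfolding maj_poly_def by (meson order.trans)

lemma maj_poly_divide:
  assumes f: "maj_poly K n U V B f" and c: "c > 0"
  shows "maj_poly K n U V (B / c) (\<lambda>u w. f u w / c)"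
proof -
  obtain d where d: "\<And>a r. n < a + r \<Longrightarrow> d a r = 0"
    "\<And>u w. f u w = (\<Sum>a<K. \<Sum>r<K. d a r * u ^ a * w ^ r)"
    "(\<Sum>a<K. \<Sum>r<K. \<bar>d a r\<bar> * U ^ a * V ^ r) \<le> B"
    using f unfolding maj_poly_def by blast
  show ?thesis unfolding maj_poly_def
  proof (intro exI[of _ "\<lambda>a r. d a r / c"] conjI allI impI)
    show "f u w / c = (\<Sum>a<K. \<Sum>r<K. d a r / c * u ^ a * w ^ r)" for u w
      by (simp add: d(2) sum_divide_distrib)
    have "(\<Sum>a<K. \<Sum>r<K. \<bar>d a r / c\<bar> * U ^ a * V ^ r) = (\<Sum>a<K. \<Sum>r<K. \<bar>d a r\<bar> * U ^ a * V ^ r) / c"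
      using c by (simp add: sum_divide_distrib abs_divide)
    then show "(\<Sum>a<K. \<Sum>r<K. \<bar>d a r / c\<bar> * U ^ a * V ^ r) \<le> B / c"
      using d(3) c by (simp add: divide_right_mono)
  qed (simp add: d(1))
qed

text \<open>The binomial is 1 / m! times a product of m linear factors, each shifted by less than
  \<open>K\<close> and hence of norm at most \<open>S\<close>.\<close>

lemma maj_poly_gbinomial:
  assumes f: "maj_poly K n U V B f" and K: "n + m < K" and UV: "U \<ge> 0" "V \<ge> 0" and B: "B \<ge> 0"
    and S: "\<bar>\<alpha>\<bar> * U + \<bar>\<beta>\<bar> * V + \<bar>\<gamma>\<bar> + real K \<le> S"
  shows "maj_poly K (n + m) U V (B * (S ^ m / fact m)) (\<lambda>u w. f u w * ((\<alpha> * u + \<beta> * w + \<gamma>) gchoose m))"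
proof -
  have "maj_poly K (n + m') U V (B * S ^ m') (\<lambda>u w. f u w * (\<Prod>i<m'. \<alpha> * u + \<beta> * w + \<gamma> - real i))"
    if "m' \<le> m" for m' using that
  proof (induction m')
    case 0
    then show ?case using f by simp
  next
    case (Suc m')
    have "maj_poly K (n + m' + 1) U V (B * S ^ m' * (\<bar>\<alpha>\<bar> * U + \<bar>\<beta>\<bar> * V + \<bar>\<gamma> - real m'\<bar>))
      (\<lambda>u w. f u w * (\<Prod>i<m'. \<alpha> * u + \<beta> * w + \<gamma> - real i) * (\<alpha> * u + \<beta> * w + (\<gamma> - real m')))"
      using Suc K UV by (intro maj_poly_linear) auto
    moreover have "B * S ^ m' * (\<bar>\<alpha>\<bar> * U + \<bar>\<beta>\<bar> * V + \<bar>\<gamma> - real m'\<bar>) \<le> B * S ^ m' * S"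
    proof (intro mult_left_mono)
      have "\<bar>\<gamma> - real m'\<bar> \<le> \<bar>\<gamma>\<bar> + real K" using Suc.prems K by linarith
      then show "\<bar>\<alpha>\<bar> * U + \<bar>\<beta>\<bar> * V + \<bar>\<gamma> - real m'\<bar> \<le> S" using S by linarith
      have "0 \<le> \<bar>\<alpha>\<bar> * U + \<bar>\<beta>\<bar> * V + \<bar>\<gamma>\<bar> + real K" using UV by simp
      then have "0 \<le> S" using S by linarith
      then show "0 \<le> B * S ^ m'" using B by simp
    qed
    ultimately show ?case using maj_poly_mono by (simp add: mult_ac add_diff_eq)
  qed
  from maj_poly_divide[OF this[OF order.refl], of "fact m"]
  show ?thesis by (simp add: gbinomial_prod_rev lessThan_atLeast0)
qed

section \<open>The golden ratio\<close>

definition gold :: real where "gold = (1 + sqrt 5) / 2"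
definition gold' :: real where "gold' = (1 - sqrt 5) / 2"

lemma gold_squares: "gold * gold = gold + 1" "gold' * gold' = gold' + 1"
  and gold_mult_gold': "gold * gold' = -1" and gold_add_gold': "gold + gold' = 1"
  unfolding gold_def gold'_def by (simp_all add: field_simps)

lemma gold_bounds: "1618 / 1000 < gold" "gold < 1619 / 1000"
proof -
  have "2236 / 1000 < sqrt 5" by (rule real_less_rsqrt) (simp add: power2_eq_square)
  moreover have "sqrt 5 < 2237 / 1000" by (rule real_less_lsqrt) (simp_all add: power2_eq_square)
  ultimately show "1618 / 1000 < gold" "gold < 1619 / 1000" by (simp_all add: gold_def)
qed

lemma gold'_bounds: "\<bar>gold'\<bar> < 1" "gold' < 0"
  using gold_bounds gold_add_gold' by linarith+

text \<open>\<open>z\<close> lies in the ring generated by the golden ratio and \<open>z'\<close> is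
  its conjugate. As a relation between reals it is closed under ring operations without a type of
  quadratic integers.\<close>

definition conj_pair :: "real \<Rightarrow> real \<Rightarrow> bool" where
  "conj_pair z z' \<longleftrightarrow> (\<exists>a b :: int. z = of_int a + of_int b * gold \<and> z' = of_int a + of_int b * gold')"

lemma conj_pair_of_int [intro]: "conj_pair (of_int a) (of_int a)"
  unfolding conj_pair_def by (rule exI[of _ a], rule exI[of _ 0]) simp

lemma conj_pair_of_nat [intro]: "conj_pair (of_nat a) (of_nat a)"
  using conj_pair_of_int[of "int a"] by simp

lemma conj_pair_gold [intro]: "conj_pair gold gold'"
  unfolding conj_pair_def by (rule exI[of _ 0], rule exI[of _ 1]) simp

lemma conj_pair_add [intro]: "conj_pair x x' \<Longrightarrow> conj_pair y y' \<Longrightarrow> conj_pair (x + y) (x' + y')"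
  unfolding conj_pair_def
proof (elim exE conjE)
  fix a b c d :: int
  assume "x = of_int a + of_int b * gold" "x' = of_int a + of_int b * gold'"
    "y = of_int c + of_int d * gold" "y' = of_int c + of_int d * gold'"
  then show "\<exists>a b :: int. x + y = of_int a + of_int b * gold \<and> x' + y' = of_int a + of_int b * gold'"
    by (intro exI[of _ "a + c"] exI[of _ "b + d"]) (simp add: algebra_simps)
qed

lemma conj_pair_mult [intro]: "conj_pair x x' \<Longrightarrow> conj_pair y y' \<Longrightarrow> conj_pair (x * y) (x' * y')"
  unfolding conj_pair_def
proof (elim exE conjE)
  fix a b c d :: int
  assume e: "x = of_int a + of_int b * gold" "x' = of_int a + of_int b * gold'"
    "y = of_int c + of_int d * gold" "y' = of_int c + of_int d * gold'"
  have *: "(of_int a + of_int b * t) * (of_int c + of_int d * t) =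
     of_int (a * c + b * d) + of_int (a * d + b * c + b * d) * t" if "t * t = t + 1" for t :: real
  proof -
    have "(of_int a + of_int b * t) * (of_int c + of_int d * t) =
      of_int (a * c) + of_int (a * d + b * c) * t + of_int (b * d) * (t * t)" by (simp add: algebra_simps)
    then show ?thesis unfolding that by (simp add: algebra_simps)
  qed
  show "\<exists>a b :: int. x * y = of_int a + of_int b * gold \<and> x' * y' = of_int a + of_int b * gold'"
    unfolding e using *[OF gold_squares(1)] *[OF gold_squares(2)] by blast
qed

lemma conj_pair_power [intro]: "conj_pair x x' \<Longrightarrow> conj_pair (x ^ n) (x' ^ n)"
proof (induction n)
  case 0
  show ?case using conj_pair_of_int[of 1] by simp
qed auto

lemma conj_pair_sum:
  assumes "\<And>i. i \<in> A \<Longrightarrow> conj_pair (f i) (f' i)"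
  shows "conj_pair (\<Sum>i\<in>A. f i) (\<Sum>i\<in>A. f' i)"
  using assms
proof (induction A rule: infinite_finite_induct)
  case (infinite A)
  then show ?case using conj_pair_of_int[of 0] by simp
next
  case empty
  then show ?case using conj_pair_of_int[of 0] by simp
qed auto

text \<open>The norm \<open>a\<^sup>2 + a b - b\<^sup>2\<close> is an integer, and \<open>4\<close> times it is \<open>(2a + b)\<^sup>2 - 5 b\<^sup>2\<close>.\<close>

lemma conj_pair_small_imp_zero:
  assumes "conj_pair z z'" "\<bar>z\<bar> * \<bar>z'\<bar> < 1"
  shows "z = 0"
proof -
  obtain a b :: int where ab: "z = of_int a + of_int b * gold" "z' = of_int a + of_int b * gold'"
    using assms(1) unfolding conj_pair_def by blast
  have "z * z' = of_int (a * a) + of_int (a * b) * (gold + gold') + of_int (b * b) * (gold * gold')"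
    by (simp add: ab algebra_simps)
  also have "\<dots> = of_int (a * a + a * b - b * b)" by (simp add: gold_mult_gold' gold_add_gold')
  finally have n: "z * z' = of_int (a * a + a * b - b * b)" .
  then have "\<bar>of_int (a * a + a * b - b * b)\<bar> < (1 :: real)" using assms(2) by (simp add: abs_mult[symmetric])
  then have "a * a + a * b - b * b = 0" by linarith
  then have "z * z' = 0" using n by simp
  have "b = 0"
  proof (rule ccontr)
    assume "b \<noteq> 0"
    have "(2 * a + b)\<^sup>2 = 5 * b\<^sup>2"
      using \<open>a * a + a * b - b * b = 0\<close> by (simp add: power2_eq_square algebra_simps)
    moreover from this have "2 * a + b \<noteq> 0" using \<open>b \<noteq> 0\<close> by auto
    ultimately have "2 * multiplicity 5 (2 * a + b) = multiplicity 5 (5 * b\<^sup>2)"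
      using prime_elem_multiplicity_power_distrib[of 5 "2 * a + b" 2] by simp
    also have "\<dots> = 1 + 2 * multiplicity 5 b"
      using \<open>b \<noteq> 0\<close> by (simp add: prime_elem_multiplicity_mult_distrib prime_elem_multiplicity_power_distrib)
    finally have "2 * multiplicity 5 (2 * a + b) = 1 + 2 * multiplicity 5 b" .
    then show False by presburger
  qed
  then show ?thesis using \<open>z * z' = 0\<close> ab by auto
qed

section \<open>From smallness to vanishing\<close>

lemma abs_exp_minus_1_le: "\<bar>x\<bar> \<le> 1 \<Longrightarrow> \<bar>exp x - 1\<bar> \<le> 2 * \<bar>x :: real\<bar>"
proof (cases "x \<ge> 0")
  case True
  assume "\<bar>x\<bar> \<le> 1"
  then have "exp x \<le> 1 + x + x\<^sup>2" using True exp_bound by simp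
  moreover have "x\<^sup>2 \<le> x" using True \<open>\<bar>x\<bar> \<le> 1\<close> by (simp add: power2_eq_square mult_left_le)
  moreover have "1 \<le> exp x" using True by simp
  ultimately show ?thesis using True by simp
next
  case False
  have "1 + x \<le> exp x" by (rule exp_ge_add_one_self)
  moreover have "\<bar>exp x - 1\<bar> = 1 - exp x" using False by simp
  moreover have "\<bar>x\<bar> = - x" using False by simp
  ultimately show ?thesis using False by linarith
qed

text \<open>The true value \<open>?F\<close> differs from the small sum in \<open>exact\<close> only
  by the effect of \<open>Lam\<close>. Its conjugate \<open>F'\<close> is bounded trivially, and
  independently of \<open>t1\<close> because |gold'| < 1. After multiplication by a power of
  \<open>v\<close> both lie in the ring of quadratic integers, and \<open>small\<close> says that
  the norm is below 1.\<close>

lemma vanishing: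
  fixes I :: "'i set" and q :: "'i \<Rightarrow> nat \<Rightarrow> int" and H :: "'i \<Rightarrow> int" and L R2 R3 n1 t1 t2 s g u v :: nat
    and Y G Z Mx Lam :: real
  defines "c \<equiv> real u / real v"
  assumes I: "finite I" and qH: "\<And>i j. i \<in> I \<Longrightarrow> j < L \<Longrightarrow> \<bar>real_of_int (q i j)\<bar> * \<bar>real_of_int (H i)\<bar> \<le> Y"
    and pos: "g \<ge> 1" "u \<ge> 1" "v \<ge> 1" "Y > 0" "G > 0" "Z \<ge> 0"
    and l: "l = real t1 * ln gold + real t2 * ln (real g) + real s * (ln c + Lam)"
    and exact: "\<bar>\<Sum>i\<in>I. \<Sum>j<L. real_of_int (q i j) * (real_of_int (H i) * exp (real j * l))\<bar>
      \<le> Z * (real (card I) * real L) * Y * G / 8 ^ n1"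
    and G: "\<And>j. j < L \<Longrightarrow> exp (real j * l) \<le> G"
    and t: "t2 \<le> R2" "s \<le> R3" and Lam: "real L * real R3 * \<bar>Lam\<bar> \<le> 1"
    and Mx: "(real g ^ R2 * max 1 c ^ R3) ^ L \<le> Mx"
    and small: "real v ^ (2 * (L * R3)) * (real (card I) * real L)\<^sup>2 * Y\<^sup>2 * G * Mx *
      (Z / 8 ^ n1 + 2 * real L * real R3 * \<bar>Lam\<bar>) < 1"
  shows "(\<Sum>i\<in>I. \<Sum>j<L. real_of_int (q i j) * real_of_int (H i) * (gold ^ t1 * real g ^ t2 * c ^ s) ^ j) = 0"
    (is "?F = 0")
proof -
  have c: "c > 0" using pos by (simp add: c_def)
  have gp: "gold > 0" using gold_bounds by linarith
  define y where "y = gold ^ t1 * real g ^ t2 * c ^ s"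
  define y' where "y' = gold' ^ t1 * real g ^ t2 * c ^ s"
  have y: "y ^ j = exp (real j * l + - (real j * real s * Lam))" for j
  proof -
    have "y = exp (real t1 * ln gold + real t2 * ln (real g) + real s * ln c)"
      using gp pos c by (simp add: y_def exp_add exp_of_nat_mult)
    also have "real t1 * ln gold + real t2 * ln (real g) + real s * ln c = l - real s * Lam"
      by (simp add: l algebra_simps)
    finally have "y ^ j = exp (real j * (l - real s * Lam))" by (simp add: exp_of_nat_mult)
    then show ?thesis by (simp add: algebra_simps)
  qed
  have jL: "real j * real s * \<bar>Lam\<bar> \<le> real L * real R3 * \<bar>Lam\<bar>" if "j < L" for j
    using that t by (intro mult_right_mono mult_mono) auto
  have diff: "\<bar>y ^ j - exp (real j * l)\<bar> \<le> G * (2 * real L * real R3 * \<bar>Lam\<bar>)" if j: "j < L" for j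
  proof -
    let ?x = "- (real j * real s * Lam)"
    have ax: "\<bar>?x\<bar> \<le> real L * real R3 * \<bar>Lam\<bar>" using jL[OF j] by (simp add: abs_mult)
    have "y ^ j - exp (real j * l) = exp (real j * l) * (exp ?x - 1)"
      unfolding y exp_add by (simp add: right_diff_distrib)
    then have "\<bar>y ^ j - exp (real j * l)\<bar> = exp (real j * l) * \<bar>exp ?x - 1\<bar>" by (simp add: abs_mult)
    also have "\<dots> \<le> G * (2 * real L * real R3 * \<bar>Lam\<bar>)"
    proof (intro mult_mono G j)
      have "\<bar>exp ?x - 1\<bar> \<le> 2 * \<bar>?x\<bar>" using ax Lam by (intro abs_exp_minus_1_le) linarith
      then show "\<bar>exp ?x - 1\<bar> \<le> 2 * real L * real R3 * \<bar>Lam\<bar>" using ax by linarith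
    qed (use pos in auto)
    finally show ?thesis .
  qed
  let ?n = "real (card I) * real L"
  have F: "\<bar>?F\<bar> \<le> ?n * Y * G * (Z / 8 ^ n1 + 2 * real L * real R3 * \<bar>Lam\<bar>)"
  proof -
    have "?F = (\<Sum>i\<in>I. \<Sum>j<L. real_of_int (q i j) * (real_of_int (H i) * exp (real j * l))) +
      (\<Sum>i\<in>I. \<Sum>j<L. real_of_int (q i j) * real_of_int (H i) * (y ^ j - exp (real j * l)))"
      unfolding y_def[symmetric] by (simp add: sum.distrib[symmetric] algebra_simps)
    also have "\<bar>\<dots>\<bar> \<le> Z * ?n * Y * G / 8 ^ n1 +
        (\<Sum>i\<in>I. \<Sum>j<L. Y * (G * (2 * real L * real R3 * \<bar>Lam\<bar>)))"
    proof (intro order.trans[OF abs_triangle_ineq] add_mono exact)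
      show "\<bar>\<Sum>i\<in>I. \<Sum>j<L. real_of_int (q i j) * real_of_int (H i) * (y ^ j - exp (real j * l))\<bar>
        \<le> (\<Sum>i\<in>I. \<Sum>j<L. Y * (G * (2 * real L * real R3 * \<bar>Lam\<bar>)))"
      proof (intro order.trans[OF sum_abs] sum_mono order.trans[OF sum_abs])
        fix i j assume "i \<in> I" "j \<in> {..<L}"
        then show "\<bar>real_of_int (q i j) * real_of_int (H i) * (y ^ j - exp (real j * l))\<bar>
            \<le> Y * (G * (2 * real L * real R3 * \<bar>Lam\<bar>))"
          unfolding abs_mult using qH diff pos by (intro mult_mono) auto
      qed
    qed
    also have "\<dots> = ?n * Y * G * (Z / 8 ^ n1 + 2 * real L * real R3 * \<bar>Lam\<bar>)"
      by (simp add: algebra_simps)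
    finally show ?thesis .
  qed
  define F' where "F' = (\<Sum>i\<in>I. \<Sum>j<L. real_of_int (q i j) * real_of_int (H i) * y' ^ j)"
  have F': "\<bar>F'\<bar> \<le> ?n * Y * Mx"
  proof -
    have "\<bar>F'\<bar> \<le> (\<Sum>i\<in>I. \<Sum>j<L. Y * Mx)"
      unfolding F'_def
    proof (intro order.trans[OF sum_abs] sum_mono order.trans[OF sum_abs])
      fix i j assume ij: "i \<in> I" "j \<in> {..<L}"
      have 1: "\<bar>y'\<bar> \<le> 1 * real g ^ R2 * max 1 c ^ R3"
        unfolding y'_def abs_mult power_abs
      proof (intro mult_mono)
        show "\<bar>gold'\<bar> ^ t1 \<le> 1" using gold'_bounds by (intro power_le_one) auto
        show "\<bar>real g\<bar> ^ t2 \<le> real g ^ R2" using pos t by (simp add: power_increasing)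
        have "\<bar>c\<bar> ^ s \<le> max 1 c ^ s" using c by (intro power_mono) auto
        also have "\<dots> \<le> max 1 c ^ R3" using t by (intro power_increasing) auto
        finally show "\<bar>c\<bar> ^ s \<le> max 1 c ^ R3" .
      qed auto
      have ge1: "1 \<le> real g ^ R2 * max 1 c ^ R3"
        using pos mult_mono[of 1 "real g ^ R2" 1 "max 1 c ^ R3"] by simp
      have "\<bar>y'\<bar> ^ j \<le> (real g ^ R2 * max 1 c ^ R3) ^ j" using 1 by (intro power_mono) auto
      also have "\<dots> \<le> (real g ^ R2 * max 1 c ^ R3) ^ L" using ge1 ij by (intro power_increasing) auto
      finally have "\<bar>y'\<bar> ^ j \<le> Mx" using Mx by linarith
      then show "\<bar>real_of_int (q i j) * real_of_int (H i) * y' ^ j\<bar> \<le> Y * Mx"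
        unfolding abs_mult power_abs using qH[of i j] ij pos by (intro mult_mono) auto
    qed
    also have "\<dots> = ?n * Y * Mx" by simp
    finally show ?thesis .
  qed
  define V where "V = real v ^ (L * R3)"
  have "conj_pair (V * ?F) (V * F')"
  proof -
    have *: "conj_pair (V * y ^ j) (V * y' ^ j)" if "j < L" for j
    proof -
      have le: "s * j \<le> L * R3" using t that by (metis less_imp_le mult.commute mult_le_mono)
      have "real v ^ (L * R3) = real v ^ (s * j) * real v ^ (L * R3 - s * j)"
        using le by (simp flip: power_add)
      then have "V * c ^ (s * j) = real (u ^ (s * j) * v ^ (L * R3 - s * j))"
        using pos by (simp add: V_def c_def power_divide)
      then have e: "V * (t ^ t1 * real g ^ t2 * c ^ s) ^ j =
          t ^ (t1 * j) * of_nat (g ^ (t2 * j) * (u ^ (s * j) * v ^ (L * R3 - s * j)))" for t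
        by (simp add: power_mult_distrib power_mult[symmetric] mult_ac)
      show ?thesis unfolding y_def y'_def e by (intro conj_pair_mult conj_pair_power conj_pair_gold conj_pair_of_nat)
    qed
    have "conj_pair (\<Sum>i\<in>I. \<Sum>j<L. of_int (q i j * H i) * (V * y ^ j))
       (\<Sum>i\<in>I. \<Sum>j<L. of_int (q i j * H i) * (V * y' ^ j))"
      by (intro conj_pair_sum conj_pair_mult conj_pair_of_int *) auto
    then show ?thesis unfolding F'_def y_def[symmetric] by (simp add: sum_distrib_left mult_ac)
  qed
  moreover have "\<bar>V * ?F\<bar> * \<bar>V * F'\<bar> < 1"
  proof -
    have V: "V \<ge> 0" by (simp add: V_def)
    have "\<bar>V * ?F\<bar> * \<bar>V * F'\<bar> = V\<^sup>2 * \<bar>?F\<bar> * \<bar>F'\<bar>" using V by (simp add: abs_mult power2_eq_square)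
    also have "\<dots> \<le> V\<^sup>2 * (?n * Y * G * (Z / 8 ^ n1 + 2 * real L * real R3 * \<bar>Lam\<bar>)) * (?n * Y * Mx)"
      using F F' pos by (intro mult_mono) auto
    also have "\<dots> = real v ^ (2 * (L * R3)) * ?n\<^sup>2 * Y\<^sup>2 * G * Mx *
      (Z / 8 ^ n1 + 2 * real L * real R3 * \<bar>Lam\<bar>)"
    proof -
      have "real v ^ (2 * (L * R3)) = V\<^sup>2" unfolding V_def by (metis power_mult mult.commute)
      then show ?thesis by (simp add: power2_eq_square mult_ac)
    qed
    finally show ?thesis using small by linarith
  qed
  ultimately have "V * ?F = 0" by (rule conj_pair_small_imp_zero)
  moreover have "V \<noteq> 0" using pos by (simp add: V_def)
  ultimately show ?thesis by simp
qed

lemma gbinomial_int: "\<exists>H :: int. (real_of_int a gchoose n) = real_of_int H"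
proof -
  have "(real_of_int a gchoose n) \<in> \<int>"
  proof (cases "a \<ge> 0")
    case True
    then have "real_of_int a = of_nat (nat a)" by simp
    then have "(real_of_int a gchoose n) = of_nat (nat a choose n)" by (simp only: binomial_gbinomial)
    then show ?thesis by simp
  next
    case False
    define m where "m = nat (- a)"
    have "m > 0" "real_of_int a = - of_nat m" using False by (auto simp: m_def)
    have "(real_of_int a gchoose n) = (-1) ^ n * ((of_nat m + of_nat n - 1 :: real) gchoose n)"
      unfolding \<open>real_of_int a = _\<close> by (rule gbinomial_minus)
    also have "(of_nat m + of_nat n - 1 :: real) = of_nat (m + n - 1)" using \<open>m > 0\<close> by (simp add: of_nat_diff)
    also have "(of_nat (m + n - 1) gchoose n :: real) = of_nat (m + n - 1 choose n)"
      by (simp only: binomial_gbinomial)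
    finally show ?thesis by simp
  qed
  then show ?thesis by (auto elim: Ints_cases)
qed

lemma conj_pair_sym: "conj_pair x y \<Longrightarrow> conj_pair y x"
  unfolding conj_pair_def
proof (elim exE conjE)
  fix a b :: int
  have "gold' = 1 - gold" using gold_add_gold' by linarith
  assume "x = of_int a + of_int b * gold" "y = of_int a + of_int b * gold'"
  then show "\<exists>a b :: int. y = of_int a + of_int b * gold \<and> x = of_int a + of_int b * gold'"
    unfolding \<open>gold' = _\<close> by (intro exI[of _ "a + b"] exI[of _ "- b"]) (simp add: algebra_simps)
qed

text \<open>Otherwise a positive power of the golden ratio would be rational, hence equal to its
  conjugate, but |gold'| < 1 < gold.\<close>

lemma gold_power_indep:
  fixes a b m n :: nat
  assumes "gold ^ m * real a = gold ^ n * real b" "a > 0" "b > 0"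
  shows "m = n"
proof -
  have *: "\<not> m < n" if eq: "gold ^ m * real a = gold ^ n * real b" and ab: "a > 0" "b > 0" for m n a b
  proof
    assume "m < n"
    then obtain d where d: "n = m + d" "d > 0" by (metis less_imp_add_positive)
    have g: "gold > 1" using gold_bounds by linarith
    then have e: "real a = gold ^ d * real b" using eq by (simp add: d power_add)
    have "conj_pair (gold ^ d * of_nat b + of_int (- int a)) (gold' ^ d * of_nat b + of_int (- int a))"
      by (intro conj_pair_add conj_pair_mult conj_pair_power conj_pair_gold conj_pair_of_nat conj_pair_of_int)
    from conj_pair_small_imp_zero[OF conj_pair_sym[OF this]]
    have "gold' ^ d * real b = real a" using e by simp
    then have "gold' ^ d = gold ^ d" using e ab by simp
    moreover have "\<bar>gold'\<bar> ^ d < 1" using gold'_bounds d(2) by (simp add: power_less_one_iff)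
    moreover have "1 < gold ^ d" using g d(2) by (simp add: one_less_power)
    ultimately show False using abs_ge_self[of "gold' ^ d"] unfolding power_abs by linarith
  qed
  show ?thesis using *[of m a n b] *[of n b m a] assms by force
qed

lemma maj_poly_D:
  assumes "maj_poly K n U V B f"
  obtains d where "\<And>u w. f u w = (\<Sum>a<K. \<Sum>r<K. d a r * u ^ a * w ^ r)"
    "(\<Sum>a<K. \<Sum>r<K. \<bar>d a r\<bar> * U ^ a * V ^ r) \<le> B"
  using assms unfolding maj_poly_def by blast

lemma maj_poly_bound:
  assumes "maj_poly K n U V B f" "\<bar>u\<bar> \<le> U" "\<bar>w\<bar> \<le> V"
  shows "\<bar>f u w\<bar> \<le> B"
proof -
  obtain d where d: "\<And>u w. f u w = (\<Sum>a<K. \<Sum>r<K. d a r * u ^ a * w ^ r)"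
    "(\<Sum>a<K. \<Sum>r<K. \<bar>d a r\<bar> * U ^ a * V ^ r) \<le> B"
    using maj_poly_D[OF assms(1)] by blast
  have "\<bar>f u w\<bar> \<le> (\<Sum>a<K. \<Sum>r<K. \<bar>d a r\<bar> * U ^ a * V ^ r)"
    unfolding d(1)
  proof (intro order.trans[OF sum_abs] sum_mono order.trans[OF sum_abs])
    fix a r
    show "\<bar>d a r * u ^ a * w ^ r\<bar> \<le> \<bar>d a r\<bar> * U ^ a * V ^ r"
      unfolding abs_mult power_abs using assms by (intro mult_mono power_mono) auto
  qed
  then show ?thesis using d(2) by linarith
qed

text \<open>A point \<open>(t\<^sub>1, t\<^sub>2, s)\<close> stands for the number \<open>yy = \<phi>\<^bsup>t\<^sub>1\<^esup> g\<^bsup>t\<^sub>2\<^esup> c\<^sup>s\<close>, and \<open>ell - s Lam\<close> is its logarithm.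
  The auxiliary polynomials have total degree less than \<open>K\<close> in \<open>(X1, X2)\<close> (less than \<open>K'\<close> on a line) and degree
  less than \<open>L\<close> in \<open>yy\<close>; \<open>n1\<close> is the number of Taylor coefficients made small, \<open>8\<close> the ratio of the
  radii in the Taylor estimate, and \<open>Xs\<close>, \<open>Xl\<close> bound the binomial polynomials on the enlarged region.
  The box with sides \<open>2 r1 + L\<close>, \<open>2 r2\<close>, \<open>2 r3\<close> contains \<open>W + W\<close> together with the \<open>L\<close> translates in
  direction \<open>t\<^sub>1\<close> used to eliminate \<open>yy\<close>.\<close>

locale log_form =
  fixes g k N u v L K K' r1 r2 r3 n1 :: nat and Y G Xs Xl :: real
  fixes c la G0 Lam th hi lo lr l0 :: real
  defines "c \<equiv> real u / real v" and "la \<equiv> ln gold" and "G0 \<equiv> ln (real g)"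
    and "Lam \<equiv> real k * la - real N * G0 - ln c" and "th \<equiv> real k * la - real N * G0"
    and "hi \<equiv> real (2 * r1 + L) * la + real (2 * r2) * G0 + real (2 * r3) * max th 0"
    and "lo \<equiv> real (2 * r3) * min th 0" and "lr \<equiv> (hi - lo) / 2" and "l0 \<equiv> (hi + lo) / 2"
  assumes nat: "g \<ge> 2" "u \<ge> 1" "v \<ge> 1" "K \<ge> 2" "L \<ge> 1" "r1 \<le> k" "r2 \<le> K - 1" "r3 \<le> K - 1" "1 \<le> K'" "K' \<le> K"
    and box: "((K - 1) * L) * ((K - 1) * L) < r1 * r2 * r3"
    and G: "exp (real L * (hi + 7 * lr)) \<le> G" and Y: "Y > 0"
    and Xs: "real (2 * r1 + L + k * (2 * r3)) + real K \<le> Xs"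
      "(la * real (2 * r1 + L + k * (2 * r3)) + 8 * lr + \<bar>l0\<bar>) / G0 + real K \<le> Xs"
    and Xl: "9 * real (r1 + k * r3) + real K \<le> Xl" "9 * real (r2 + N * r3) + real K \<le> Xl"
    and siegel_box: "8 ^ (K * (n1 * (n1 + 1) div 2)) <
      (\<Prod>(a, b)\<in>{(a, b). a + b < K}. Y / (Xs ^ a / fact a * (Xs ^ b / fact b))) ^ L"
    and siegel_line: "8 ^ (n1 * (n1 + 1) div 2) < (\<Prod>i<K'. Y / (Xl ^ i / fact i)) ^ L"
    and Lam: "real L * real (2 * r3) * \<bar>Lam\<bar> \<le> 1"
    and small: "real v ^ (2 * (L * (2 * r3))) * (real (K * K) * real L)\<^sup>2 * Y\<^sup>2 * G *
      (real g ^ (2 * r2) * max 1 c ^ (2 * r3)) ^ L *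
      ((real K * real n1 + 1) / 8 ^ n1 + 2 * real L * real (2 * r3) * \<bar>Lam\<bar>) < 1"
begin

definition X1 :: "nat \<times> nat \<times> nat \<Rightarrow> real" where "X1 = (\<lambda>(t1, t2, s). real t1 + real k * real s)"
definition X2 :: "nat \<times> nat \<times> nat \<Rightarrow> real" where "X2 = (\<lambda>(t1, t2, s). real t2 - real N * real s)"
definition yy :: "nat \<times> nat \<times> nat \<Rightarrow> real" where "yy = (\<lambda>(t1, t2, s). gold ^ t1 * real g ^ t2 * c ^ s)"
definition ell :: "nat \<times> nat \<times> nat \<Rightarrow> real" where
  "ell = (\<lambda>(t1, t2, s). real t1 * la + real t2 * G0 + real s * th)"
definition W :: "(nat \<times> nat \<times> nat) set" where "W = {..<r1} \<times> {..<r2} \<times> {..<r3}"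

lemma la: "la > 0" and G0: "G0 > 0" and c: "c > 0" and th: "th = ln c + Lam"
  using gold_bounds nat by (simp_all add: la_def G0_def c_def th_def Lam_def)

lemma rpos: "r1 > 0" "r2 > 0" "r3 > 0"
proof -
  have "0 < r1 * r2 * r3" using box by linarith
  then show "r1 > 0" "r2 > 0" "r3 > 0" by simp_all
qed

lemma ell_X: "ell p = la * X1 p + G0 * X2 p"
  by (cases p) (simp add: ell_def X1_def X2_def th_def algebra_simps)

text \<open>The range is halved for \<open>W\<close> because the line argument works with sums of
  two points of \<open>W\<close>, on which \<open>ell\<close> is additive.\<close>

lemma ell_bounds: "t1 < 2 * r1 + L \<Longrightarrow> t2 < 2 * r2 \<Longrightarrow> s < 2 * r3 \<Longrightarrow>
    lo \<le> ell (t1, t2, s) \<and> ell (t1, t2, s) \<le> hi"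
  "t1 < r1 \<Longrightarrow> t2 < r2 \<Longrightarrow> s < r3 \<Longrightarrow> lo / 2 \<le> ell (t1, t2, s) \<and> ell (t1, t2, s) \<le> hi / 2"
proof -
  have *: "S * min th 0 \<le> ell (t1, t2, s) \<and> ell (t1, t2, s) \<le> T1 * la + T2 * G0 + S * max th 0"
    if t: "real t1 \<le> T1" "real t2 \<le> T2" "real s \<le> S" for t1 t2 s T1 T2 S
  proof -
    have "real t1 * la \<le> T1 * la" "real t2 * G0 \<le> T2 * G0" using t la G0 by (auto intro: mult_right_mono)
    moreover have "real s * th \<le> S * max th 0"
      using t by (intro order.trans[OF mult_left_mono[of th "max th 0"]] mult_right_mono) auto
    moreover have "S * min th 0 \<le> real s * min th 0" using t by (intro mult_right_mono_neg) auto
    moreover have "real s * min th 0 \<le> real s * th" by (intro mult_left_mono) auto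
    moreover have "0 \<le> real t1 * la" "0 \<le> real t2 * G0" using la G0 by auto
    ultimately show ?thesis by (simp add: ell_def)
  qed
  show "t1 < 2 * r1 + L \<Longrightarrow> t2 < 2 * r2 \<Longrightarrow> s < 2 * r3 \<Longrightarrow> lo \<le> ell (t1, t2, s) \<and> ell (t1, t2, s) \<le> hi"
    using *[of t1 "real (2 * r1 + L)" t2 "real (2 * r2)" s "real (2 * r3)"] by (simp add: lo_def hi_def)
  assume "t1 < r1" "t2 < r2" "s < r3"
  then have "real r3 * min th 0 \<le> ell (t1, t2, s) \<and>
      ell (t1, t2, s) \<le> real r1 * la + real r2 * G0 + real r3 * max th 0"
    by (intro *) auto
  moreover have "real r1 * la + real r2 * G0 + real r3 * max th 0 \<le> hi / 2"
    using la by (simp add: hi_def field_simps)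
  ultimately show "lo / 2 \<le> ell (t1, t2, s) \<and> ell (t1, t2, s) \<le> hi / 2" by (simp add: lo_def)
qed

lemma hi_nonneg: "hi \<ge> 0" and lo_nonpos: "lo \<le> 0" and lr_pos: "lr > 0"
proof -
  have "real (2 * r1 + L) * la > 0" using la rpos by simp
  moreover have "real (2 * r2) * G0 \<ge> 0" "real (2 * r3) * max th 0 \<ge> 0" using G0 by auto
  ultimately have "hi > 0" unfolding hi_def by linarith
  moreover show "lo \<le> 0" by (simp add: lo_def mult_nonneg_nonpos)
  ultimately show "hi \<ge> 0" "lr > 0" by (simp_all add: lr_def)
qed

lemma G_pos: "G > 0" using G exp_gt_zero[of "real L * (hi + 7 * lr)"] by linarith

text \<open>The bound hi + 7 lr equals l0 + 8 lr: the centre of the range of \<open>ell\<close> plus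
  its radius enlarged by the factor 8 of the Taylor estimate.\<close>

lemma exp_le_G:
  assumes "j < L" "x \<le> hi + 7 * lr"
  shows "exp (real j * x) \<le> G"
proof -
  have "real j * x \<le> real j * (hi + 7 * lr)" using assms by (intro mult_left_mono) auto
  also have "\<dots> \<le> real L * (hi + 7 * lr)" using assms(1) hi_nonneg lr_pos by (intro mult_right_mono) auto
  finally have "exp (real j * x) \<le> exp (real L * (hi + 7 * lr))" by simp
  then show ?thesis using G by linarith
qed

lemma vanishing':
  fixes I :: "'i set" and q :: "'i \<Rightarrow> nat \<Rightarrow> int" and h :: "'i \<Rightarrow> real"
  assumes I: "finite I" "card I \<le> K * K" and Ku: "Ku \<le> K"
    and h: "\<And>i. i \<in> I \<Longrightarrow> \<exists>H :: int. h i = real_of_int H"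
    and qh: "\<And>i j. i \<in> I \<Longrightarrow> j < L \<Longrightarrow> \<bar>real_of_int (q i j)\<bar> * \<bar>h i\<bar> \<le> Y"
    and t: "t1 < 2 * r1 + L" "t2 < 2 * r2" "s < 2 * r3"
    and exact: "\<bar>\<Sum>i\<in>I. \<Sum>j<L. real_of_int (q i j) * (h i * exp (real j * ell (t1, t2, s)))\<bar>
      \<le> (real Ku * real n1 + 1) * (real (card I) * real L) * Y * G / 8 ^ n1"
  shows "(\<Sum>i\<in>I. \<Sum>j<L. real_of_int (q i j) * h i * yy (t1, t2, s) ^ j) = 0"
proof -
  obtain H where H: "\<And>i. i \<in> I \<Longrightarrow> h i = real_of_int (H i)" using h by metis
  have "(\<Sum>i\<in>I. \<Sum>j<L. real_of_int (q i j) * real_of_int (H i) *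
      (gold ^ t1 * real g ^ t2 * (real u / real v) ^ s) ^ j) = 0"
  proof (rule vanishing[OF I(1)])
    show "\<bar>real_of_int (q i j)\<bar> * \<bar>real_of_int (H i)\<bar> \<le> Y" if "i \<in> I" "j < L" for i j
      using qh[OF that] H[OF that(1)] by simp
    show "ell (t1, t2, s) = real t1 * ln gold + real t2 * ln (real g) + real s * (ln (real u / real v) + Lam)"
      using th by (simp add: ell_def la_def G0_def c_def)
    show "\<bar>\<Sum>i\<in>I. \<Sum>j<L. real_of_int (q i j) * (real_of_int (H i) * exp (real j * ell (t1, t2, s)))\<bar>
      \<le> (real K * real n1 + 1) * (real (card I) * real L) * Y * G / 8 ^ n1"
    proof -
      have "(\<Sum>i\<in>I. \<Sum>j<L. real_of_int (q i j) * (real_of_int (H i) * exp (real j * ell (t1, t2, s)))) =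
        (\<Sum>i\<in>I. \<Sum>j<L. real_of_int (q i j) * (h i * exp (real j * ell (t1, t2, s))))"
        using H by (intro sum.cong refl) auto
      moreover have "(real Ku * real n1 + 1) * (real (card I) * real L) * Y * G / 8 ^ n1 \<le>
        (real K * real n1 + 1) * (real (card I) * real L) * Y * G / 8 ^ n1"
        using Ku Y G_pos by (intro divide_right_mono mult_right_mono) (auto intro: mult_right_mono)
      ultimately show ?thesis using exact by linarith
    qed
    show "exp (real j * ell (t1, t2, s)) \<le> G" if "j < L" for j
      using that ell_bounds(1)[OF t] lr_pos by (intro exp_le_G) auto
    show "(real g ^ (2 * r2) * max 1 (real u / real v) ^ (2 * r3)) ^ L \<le>
      (real g ^ (2 * r2) * max 1 c ^ (2 * r3)) ^ L" by (simp add: c_def)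
    let ?Z = "(real K * real n1 + 1) / 8 ^ n1 + 2 * real L * real (2 * r3) * \<bar>Lam\<bar>"
    have "real v ^ (2 * (L * (2 * r3))) * (real (card I) * real L)\<^sup>2 * Y\<^sup>2 * G *
      (real g ^ (2 * r2) * max 1 c ^ (2 * r3)) ^ L * ?Z \<le>
      real v ^ (2 * (L * (2 * r3))) * (real (K * K) * real L)\<^sup>2 * Y\<^sup>2 * G *
      (real g ^ (2 * r2) * max 1 c ^ (2 * r3)) ^ L * ?Z"
      using I(2) G_pos c
      by (intro mult_right_mono mult_left_mono power_mono) (auto simp del: of_nat_mult)
    then show "real v ^ (2 * (L * (2 * r3))) * (real (card I) * real L)\<^sup>2 * Y\<^sup>2 * G *
      (real g ^ (2 * r2) * max 1 c ^ (2 * r3)) ^ L * ?Z < 1"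
      using small by linarith
    show "real L * real (2 * r3) * \<bar>Lam\<bar> \<le> 1" by (rule Lam)
  qed (use nat Y G_pos t in auto)
  then show ?thesis using H by (simp add: yy_def c_def)
qed

end

section \<open>The box, the line, and the contradiction\<close>

context log_form
begin

text \<open>For w = ell - l0 the coordinate \<open>X2\<close> is a linear function of
  \<open>X1\<close> and w. In the variables \<open>X1\<close> and w the exponential depends on w
  alone, so only w has to be enlarged by the factor 8.\<close>

lemma maj_poly_box:
  assumes "a + b < K"
  shows "maj_poly K (a + b) (real (2 * r1 + L + k * (2 * r3))) (8 * lr) (Xs ^ a / fact a * (Xs ^ b / fact b))
    (\<lambda>x w. (x gchoose a) * (((l0 + w - la * x) / G0) gchoose b))"
proof -
  let ?U = "real (2 * r1 + L + k * (2 * r3))"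
  have Xs0: "Xs \<ge> 0" using Xs(1) by linarith
  have "maj_poly K 0 ?U (8 * lr) \<bar>1\<bar> (\<lambda>_ _. 1)" using nat by (intro maj_poly_const) auto
  from maj_poly_gbinomial[OF this, of a 1 0 0 Xs]
  have 1: "maj_poly K a ?U (8 * lr) (Xs ^ a / fact a) (\<lambda>x w. x gchoose a)"
    using assms Xs(1) lr_pos by simp
  have "maj_poly K (a + b) ?U (8 * lr) (Xs ^ a / fact a * (Xs ^ b / fact b))
    (\<lambda>x w. (x gchoose a) * ((- la / G0 * x + 1 / G0 * w + l0 / G0) gchoose b))"
  proof (rule maj_poly_gbinomial[OF 1 assms])
    have "\<bar>- la / G0\<bar> * ?U + \<bar>1 / G0\<bar> * (8 * lr) + \<bar>l0 / G0\<bar> = (la * ?U + 8 * lr + \<bar>l0\<bar>) / G0"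
      using la G0 by (simp add: abs_divide add_divide_distrib)
    then show "\<bar>- la / G0\<bar> * ?U + \<bar>1 / G0\<bar> * (8 * lr) + \<bar>l0 / G0\<bar> + real K \<le> Xs" using Xs(2) by linarith
  qed (use lr_pos Xs0 in auto)
  moreover have "- la / G0 * x + 1 / G0 * w + l0 / G0 = (l0 + w - la * x) / G0" for x w
    using G0 by (simp add: field_simps)
  ultimately show ?thesis by simp
qed

lemma box_case:
  obtains S where "S \<subseteq> W" "r1 * r2 * r3 \<le> card S * ((K - 1) * L)"
    "\<And>p0 p1 p2. p0 \<in> S \<Longrightarrow> p1 \<in> S \<Longrightarrow> p2 \<in> S \<Longrightarrow>
      (X1 p1 - X1 p0) * (X2 p2 - X2 p0) = (X2 p1 - X2 p0) * (X1 p2 - X1 p0)"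
proof -
  let ?I = "{(a, b). a + b < K}"
  let ?U = "real (2 * r1 + L + k * (2 * r3))"
  define P where "P = {..<2 * r1 + L} \<times> {..<2 * r2} \<times> {..<2 * r3}"
  define Bd where "Bd = (\<lambda>(a, b). Xs ^ a / fact a * (Xs ^ b / fact b))"
  define h where "h = (\<lambda>(a, b) p. (X1 p gchoose a) * (X2 p gchoose b))"
  define w where "w p = ell p - l0" for p
  have fin: "finite ?I" by (rule finite_subset[of _ "{..<K} \<times> {..<K}"]) auto
  have cardI: "card ?I \<le> K * K"
  proof -
    have "?I \<subseteq> {..<K} \<times> {..<K}" by auto
    from card_mono[OF _ this] show ?thesis by (simp add: card_cartesian_product)
  qed
  have Xs0: "Xs > 0" using Xs(1) nat by linarith
  have x2: "X2 p = (l0 + w p - la * X1 p) / G0" for p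
    using G0 by (simp add: w_def ell_X)
  have X1U: "\<bar>X1 p\<bar> \<le> ?U" if pP: "p \<in> P" for p
  proof -
    obtain t1 t2 s where p: "p = (t1, t2, s)" "t1 < 2 * r1 + L" "s < 2 * r3" using pP by (auto simp: P_def)
    then have "t1 + k * s \<le> 2 * r1 + L + k * (2 * r3)" by (intro add_mono mult_le_mono) auto
    then have "real (t1 + k * s) \<le> ?U" by (simp only: of_nat_le_iff)
    then show ?thesis by (simp add: p X1_def)
  qed
  have w: "\<bar>w p\<bar> \<le> lr" if pP: "p \<in> P" for p
  proof -
    obtain t1 t2 s where p: "p = (t1, t2, s)" "t1 < 2 * r1 + L" "t2 < 2 * r2" "s < 2 * r3"
      using pP by (auto simp: P_def)
    have "lo \<le> ell p" "ell p \<le> hi" using ell_bounds(1)[OF p(2-4)] p(1) by auto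
    then show ?thesis unfolding w_def l0_def lr_def abs_le_iff by (simp_all add: field_simps)
  qed
  have "\<exists>d. (\<forall>u w. (u gchoose fst i) * (((l0 + w - la * u) / G0) gchoose snd i) = (\<Sum>a<K. \<Sum>r<K. d a r * u ^ a * w ^ r)) \<and>
     (\<Sum>a<K. \<Sum>r<K. \<bar>d a r\<bar> * ?U ^ a * (8 * lr) ^ r) \<le> Bd i" if iI: "i \<in> ?I" for i
  proof -
    obtain a b where i: "i = (a, b)" "a + b < K" using iI by auto
    obtain d where "\<And>u w. (u gchoose a) * (((l0 + w - la * u) / G0) gchoose b) = (\<Sum>a<K. \<Sum>r<K. d a r * u ^ a * w ^ r)"
      "(\<Sum>a<K. \<Sum>r<K. \<bar>d a r\<bar> * ?U ^ a * (8 * lr) ^ r) \<le> Xs ^ a / fact a * (Xs ^ b / fact b)"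
      using maj_poly_D[OF maj_poly_box[OF i(2)]] by blast
    then show ?thesis by (intro exI[of _ d]) (simp add: i Bd_def)
  qed
  then have "\<forall>i\<in>?I. \<exists>d. (\<forall>u w. (u gchoose fst i) * (((l0 + w - la * u) / G0) gchoose snd i) = (\<Sum>a<K. \<Sum>r<K. d a r * u ^ a * w ^ r)) \<and>
     (\<Sum>a<K. \<Sum>r<K. \<bar>d a r\<bar> * ?U ^ a * (8 * lr) ^ r) \<le> Bd i" by blast
  from bchoice[OF this] obtain d where d0: "\<forall>i\<in>?I. (\<forall>u w. (u gchoose fst i) * (((l0 + w - la * u) / G0) gchoose snd i) =
       (\<Sum>a<K. \<Sum>r<K. d i a r * u ^ a * w ^ r)) \<and> (\<Sum>a<K. \<Sum>r<K. \<bar>d i a r\<bar> * ?U ^ a * (8 * lr) ^ r) \<le> Bd i" ..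
  have d: "(u gchoose fst i) * (((l0 + w - la * u) / G0) gchoose snd i) = (\<Sum>a<K. \<Sum>r<K. d i a r * u ^ a * w ^ r)"
    "(\<Sum>a<K. \<Sum>r<K. \<bar>d i a r\<bar> * ?U ^ a * (8 * lr) ^ r) \<le> Bd i" if "i \<in> ?I" for i u w
    using d0 that by blast+
  have BdY: "(\<Prod>i\<in>?I. Y / Bd i) = (\<Prod>(a, b)\<in>?I. Y / (Xs ^ a / fact a * (Xs ^ b / fact b)))"
    by (intro prod.cong refl) (auto simp: Bd_def)
  obtain q where q: "\<exists>i\<in>?I. \<exists>j<L. q i j \<noteq> 0"
    "\<And>i j. i \<in> ?I \<Longrightarrow> j < L \<Longrightarrow> \<bar>real_of_int (q i j)\<bar> \<le> Y / Bd i"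
    "\<And>p. p \<in> P \<Longrightarrow> \<bar>\<Sum>i\<in>?I. \<Sum>j<L. real_of_int (q i j) * (h i p * exp (real j * (l0 + 1 * w p)))\<bar>
       \<le> (real K * real n1 + 1) * (real (card ?I) * real L) * Y * G / real 8 ^ n1"
  proof (rule auxiliary_function[where I = ?I and E = 8 and U = ?U and W = lr and Y = Y and G = G and Bd = Bd
        and P = P and h = h and Ku = K and R = K and d = d and u = X1 and w = w and L = L and A = 1
        and ?l0.0 = l0 and ?n1.0 = n1])
    have "0 < 2 * r1 + L + k * (2 * r3)" using rpos by simp
    then show "0 < ?U" by (rule of_nat_0_less_iff[THEN iffD2])
    show "0 < Bd i" for i using Xs0 by (cases i) (simp add: Bd_def)
    show "h i p = (\<Sum>a<K. \<Sum>r<K. d i a r * X1 p ^ a * w p ^ r)" if "i \<in> ?I" "p \<in> P" for i p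
      using d(1)[OF that(1), of "X1 p" "w p"] x2[of p] by (simp add: h_def case_prod_beta)
    show "(\<Sum>a<K. \<Sum>r<K. \<bar>d i a r\<bar> * ?U ^ a * (real 8 * lr) ^ r) \<le> Bd i" if "i \<in> ?I" for i
      using d(2)[OF that] by simp
    show "exp (real j * l0 + real j * \<bar>1\<bar> * (real 8 * lr)) \<le> G" if "j < L" for j
    proof -
      have "l0 + 8 * lr = hi + 7 * lr" by (simp add: l0_def lr_def field_simps)
      then show ?thesis using exp_le_G[OF that, of "l0 + 8 * lr"] by (simp add: distrib_left)
    qed
    show "real 8 ^ (K * (n1 * (n1 + 1) div 2)) < (\<Prod>i\<in>?I. Y / Bd i) ^ L"
      unfolding BdY using siegel_box by simp
  qed (use fin lr_pos Y G_pos X1U w in auto)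
  have zero: "(\<Sum>i\<in>?I. \<Sum>j<L. real_of_int (q i j) * h i (t1, t2, s) * yy (t1, t2, s) ^ j) = 0"
    if t: "t1 < 2 * r1 + L" "t2 < 2 * r2" "s < 2 * r3" for t1 t2 s
  proof (rule vanishing'[OF fin cardI order.refl _ _ t])
    have p: "(t1, t2, s) \<in> P" using t by (simp add: P_def)
    show "\<exists>H :: int. h i (t1, t2, s) = real_of_int H" for i
    proof -
      obtain a b where i: "i = (a, b)" by force
      have "X1 (t1, t2, s) = real_of_int (int t1 + int k * int s)" "X2 (t1, t2, s) = real_of_int (int t2 - int N * int s)"
        by (simp_all add: X1_def X2_def)
      then obtain H1 H2 :: int where "(X1 (t1, t2, s) gchoose a) = real_of_int H1" "(X2 (t1, t2, s) gchoose b) = real_of_int H2"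
        using gbinomial_int by metis
      then have "h i (t1, t2, s) = real_of_int (H1 * H2)" by (simp add: h_def i)
      then show ?thesis by blast
    qed
    show "\<bar>real_of_int (q i j)\<bar> * \<bar>h i (t1, t2, s)\<bar> \<le> Y" if "i \<in> ?I" "j < L" for i j
    proof -
      have "\<bar>h i (t1, t2, s)\<bar> \<le> Bd i"
        using maj_poly_bound[OF maj_poly_box[of "fst i" "snd i"], of "X1 (t1, t2, s)" "w (t1, t2, s)"]
          X1U[OF p] w[OF p] lr_pos that(1) x2[of "(t1, t2, s)"]
        by (auto simp: h_def Bd_def case_prod_beta)
      moreover have "0 < Bd i" using Xs0 by (cases i) (simp add: Bd_def)
      ultimately have "\<bar>real_of_int (q i j)\<bar> * \<bar>h i (t1, t2, s)\<bar> \<le> (Y / Bd i) * Bd i"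
        using q(2)[OF that] Y by (intro mult_mono) auto
      then show ?thesis using \<open>0 < Bd i\<close> by simp
    qed
    show "\<bar>\<Sum>i\<in>?I. \<Sum>j<L. real_of_int (q i j) * (h i (t1, t2, s) * exp (real j * ell (t1, t2, s)))\<bar>
      \<le> (real K * real n1 + 1) * (real (card ?I) * real L) * Y * G / 8 ^ n1"
      using q(3)[OF p] by (simp add: w_def)
  qed
  obtain a0 b0 j0 where nz: "a0 + b0 < K" "j0 < L" "q (a0, b0) j0 \<noteq> 0" using q(1) by auto
  have gold1: "gold > 1" and gpos: "real g > 0" using gold_bounds nat by auto
  show ?thesis
  proof (rule zero_estimate_box[OF gold1 gpos c nat(6) box nz(1,2), where q = "\<lambda>a b j. real_of_int (q (a, b) j)" and N = N])
    show "real_of_int (q (a0, b0) j0) \<noteq> 0" using nz by simp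
    show "(\<Sum>j<L. \<Sum>(a, b)\<in>?I. real_of_int (q (a, b) j) *
          ((case (t1, t2, s) of (t1, t2, s) \<Rightarrow> real t1 + real k * real s) gchoose a) *
          ((case (t1, t2, s) of (t1, t2, s) \<Rightarrow> real t2 - real N * real s) gchoose b) *
          (case (t1, t2, s) of (t1, t2, s) \<Rightarrow> gold ^ t1 * real g ^ t2 * c ^ s) ^ j) = 0"
      if t: "t1 < 2 * r1 + L" "t2 < 2 * r2" "s < 2 * r3" for t1 t2 s
    proof -
      have "(\<Sum>i\<in>?I. \<Sum>j<L. real_of_int (q i j) * h i (t1, t2, s) * yy (t1, t2, s) ^ j) =
        (\<Sum>j<L. \<Sum>i\<in>?I. real_of_int (q i j) * h i (t1, t2, s) * yy (t1, t2, s) ^ j)" by (rule sum.swap)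
      then show ?thesis using zero[OF t] by (simp add: h_def X1_def X2_def yy_def case_prod_beta mult.assoc)
    qed
  qed (rule that; simp add: W_def X1_def X2_def)
qed

text \<open>On a line \<open>ell\<close> is affine in one integer coordinate \<open>x\<close>, and
  polynomials in \<open>x\<close> alone serve as auxiliary functions. Only the width of the range of
  \<open>x\<close> matters, whatever its position. The bound \<open>fib\<close> guarantees enough
  distinct values of \<open>yy\<close> for the elimination.\<close>

lemma line_case:
  fixes S :: "(nat \<times> nat \<times> nat) set" and x :: "nat \<times> nat \<times> nat \<Rightarrow> real" and rx :: real
  assumes S: "S \<subseteq> W" "(K - 1) * L < card S" and x: "inj_on x S"
    and x_int: "\<And>p. p \<in> S \<Longrightarrow> \<exists>n :: int. x p = real_of_int n"
    and aff: "\<And>p. p \<in> S \<Longrightarrow> ell p = e + A * x p"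
    and rx: "\<And>p p'. p \<in> S \<Longrightarrow> p' \<in> S \<Longrightarrow> x p - x p' \<le> rx" "9 * rx + real K \<le> Xl"
    and fib: "\<And>t1. card {p \<in> S. fst p = t1} \<le> K - 1"
  shows False
proof -
  have finS: "finite S" using S(1) by (rule finite_subset) (simp add: W_def)
  have "S \<noteq> {}" using S(2) by auto
  define xmin where "xmin = Min (x ` S)"
  define xmax where "xmax = Max (x ` S)"
  have "xmin \<in> x ` S" "xmax \<in> x ` S"
    using finS \<open>S \<noteq> {}\<close> by (auto simp: xmin_def xmax_def intro!: Min_in Max_in)
  then obtain pmin pmax where pm: "pmin \<in> S" "x pmin = xmin" "pmax \<in> S" "x pmax = xmax" by auto
  have xb: "xmin \<le> x p" "x p \<le> xmax" if "p \<in> S" for p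
    using finS that by (auto simp: xmin_def xmax_def)
  define Wd where "Wd = xmax - xmin"
  have "card S > 1"
  proof -
    have "1 \<le> (K - 1) * L" using nat by (simp add: Suc_le_eq)
    then show ?thesis using S(2) by linarith
  qed
  have Wd: "Wd > 0"
  proof (rule ccontr)
    assume "\<not> Wd > 0"
    then have "x p = xmin" if "p \<in> S" for p using xb[OF that] by (simp add: Wd_def)
    then have "S \<subseteq> {pmin}" using x pm by (auto simp: inj_on_def)
    then have "card S \<le> 1" using card_mono[of "{pmin}" S] by simp
    then show False using \<open>card S > 1\<close> by simp
  qed
  \<comment> \<open>Sums \<open>x p + x p'\<close> stay within \<open>Wd\<close> of
    \<open>xmin + xmax\<close>, where the exponent is \<open>lm\<close>. The argument w + Wd of the
    binomials is thus at most 9 Wd on the enlarged range |w| <= 8 Wd, whence the 9 in the condition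
    on \<open>Xl\<close>.\<close>
  define lm where "lm = ell pmin + ell pmax"
  define P where "P = S \<times> S"
  define w where "w = (\<lambda>(p, p'). x p + x p' - (xmin + xmax))"
  define h where "h i = (\<lambda>z. (w z + Wd) gchoose i)" for i
  define Bd where "Bd i = Xl ^ i / fact i" for i
  have Xl0: "Xl > 0" using Xl(1) nat by linarith
  have Bd: "Bd i > 0" for i using Xl0 by (simp add: Bd_def)
  have w: "\<bar>w z\<bar> \<le> Wd" if zP: "z \<in> P" for z
  proof -
    obtain p p' where z: "z = (p, p')" "p \<in> S" "p' \<in> S" using zP by (auto simp: P_def)
    show ?thesis using xb[OF z(2)] xb[OF z(3)] by (simp add: z w_def Wd_def abs_le_iff)
  qed
  have maj: "maj_poly K i 1 (8 * Wd) (Bd i) (\<lambda>u w. (w + Wd) gchoose i)" if "i < K" for i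
  proof -
    have "maj_poly K 0 1 (8 * Wd) \<bar>1\<bar> (\<lambda>_ _. 1)" using nat by (intro maj_poly_const) auto
    from maj_poly_gbinomial[OF this, of i 0 1 Wd Xl]
    show ?thesis using that Wd rx(1)[OF pm(3,1)] rx(2) pm by (simp add: Bd_def Wd_def)
  qed
  have "\<exists>d. (\<forall>w. ((w + Wd) gchoose i) = (\<Sum>r<K. d r * w ^ r)) \<and> (\<Sum>r<K. \<bar>d r\<bar> * (8 * Wd) ^ r) \<le> Bd i"
    if i: "i < K" for i
  proof -
    obtain d where d: "\<And>u w. ((w + Wd) gchoose i) = (\<Sum>a<K. \<Sum>r<K. d a r * u ^ a * w ^ r)"
      "(\<Sum>a<K. \<Sum>r<K. \<bar>d a r\<bar> * 1 ^ a * (8 * Wd) ^ r) \<le> Bd i"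
      using maj_poly_D[OF maj[OF i]] by blast
    have K: "{..<K} = insert 0 {1..<K}" using nat by auto
    \<comment> \<open>The variable u is only formal here; at u = 0 the terms with a = 0
      survive.\<close>
    have "((w + Wd) gchoose i) = (\<Sum>r<K. d 0 r * w ^ r)" for w
    proof -
      have "(\<Sum>a<K. \<Sum>r<K. d a r * 0 ^ a * w ^ r) = (\<Sum>a\<in>{0}. \<Sum>r<K. d a r * 0 ^ a * w ^ r)"
        using nat by (intro sum.mono_neutral_right) (auto simp: power_0_left)
      then show ?thesis using d(1)[of w 0] by simp
    qed
    moreover have "(\<Sum>r<K. \<bar>d 0 r\<bar> * (8 * Wd) ^ r) \<le> Bd i"
    proof -
      have "(\<Sum>a\<in>{0}. \<Sum>r<K. \<bar>d a r\<bar> * 1 ^ a * (8 * Wd) ^ r) \<le> (\<Sum>a<K. \<Sum>r<K. \<bar>d a r\<bar> * 1 ^ a * (8 * Wd) ^ r)"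
        using nat Wd by (intro sum_mono2) (auto intro!: sum_nonneg)
      then show ?thesis using d(2) by simp
    qed
    ultimately show ?thesis by blast
  qed
  then obtain d where d: "\<And>i w. i < K \<Longrightarrow> ((w + Wd) gchoose i) = (\<Sum>r<K. d i r * w ^ r)"
    "\<And>i. i < K \<Longrightarrow> (\<Sum>r<K. \<bar>d i r\<bar> * (8 * Wd) ^ r) \<le> Bd i" by metis
  have lmA: "lm + A * w (p, p') = ell p + ell p'" if "p \<in> S" "p' \<in> S" for p p'
    using that pm aff by (simp add: lm_def w_def algebra_simps)
  have SW: "ell p \<le> hi / 2" "lo / 2 \<le> ell p" if "p \<in> S" for p
    using S(1) that ell_bounds(2) by (auto simp: W_def)
  have AW: "lm + 8 * (\<bar>A\<bar> * Wd) \<le> hi + 7 * lr"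
  proof -
    have "A * Wd = ell pmax - ell pmin" using pm aff by (simp add: Wd_def algebra_simps)
    then have "\<bar>A\<bar> * Wd = \<bar>ell pmax - ell pmin\<bar>" using Wd by (metis abs_mult abs_of_pos)
    moreover have "\<bar>ell pmax - ell pmin\<bar> \<le> lr" "lm + \<bar>ell pmax - ell pmin\<bar> \<le> hi"
      using SW[OF pm(1)] SW[OF pm(3)] by (auto simp: lr_def lm_def abs_if)
    ultimately show ?thesis by linarith
  qed
  obtain q where q: "\<exists>i\<in>{..<K'}. \<exists>j<L. q i j \<noteq> 0"
    "\<And>i j. i \<in> {..<K'} \<Longrightarrow> j < L \<Longrightarrow> \<bar>real_of_int (q i j)\<bar> \<le> Y / Bd i"
    "\<And>z. z \<in> P \<Longrightarrow> \<bar>\<Sum>i<K'. \<Sum>j<L. real_of_int (q i j) * (h i z * exp (real j * (lm + A * w z)))\<bar>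
       \<le> (real 1 * real n1 + 1) * (real (card {..<K'}) * real L) * Y * G / real 8 ^ n1"
  proof (rule auxiliary_function[where I = "{..<K'}" and E = 8 and U = 1 and W = Wd and Y = Y and G = G and Bd = Bd
        and P = P and h = h and Ku = 1 and R = K and d = "\<lambda>i a r. d i r" and u = "\<lambda>_. 0" and w = w and L = L
        and A = A and ?l0.0 = lm and ?n1.0 = n1])
    show "h i z = (\<Sum>a<1. \<Sum>r<K. d i r * 0 ^ a * w z ^ r)" if "i \<in> {..<K'}" for i z
      using d(1)[of i "w z"] that nat by (simp add: h_def)
    show "(\<Sum>a<1. \<Sum>r<K. \<bar>d i r\<bar> * 1 ^ a * (real 8 * Wd) ^ r) \<le> Bd i" if "i \<in> {..<K'}" for i
      using d(2)[of i] that nat by simp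
    show "exp (real j * lm + real j * \<bar>A\<bar> * (real 8 * Wd)) \<le> G" if "j < L" for j
      using exp_le_G[OF that AW] by (simp add: algebra_simps)
    show "real 8 ^ (1 * (n1 * (n1 + 1) div 2)) < (\<Prod>i<K'. Y / Bd i) ^ L"
      using siegel_line by (simp add: Bd_def)
  qed (use Wd Y G_pos Bd w in auto)
  show False
  proof -
    obtain i0 j0 where nz: "i0 < K'" "j0 < L" "q i0 j0 \<noteq> 0" using q(1) by auto
    have yyp: "yy p > 0" for p using gold_bounds nat c by (cases p) (simp add: yy_def)
    have "L \<le> card (yy ` S)"
    proof -
      \<comment> \<open>The value \<open>yy p\<close> determines the exponent of the golden ratio,
        so the number of values is at least that of the first components, which is more than
        \<open>L\<close> because each occurs at most \<open>K - 1\<close> times.\<close>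
      have fy: "fst p = fst p'" if "yy p = yy p'" for p p'
      proof -
        obtain t1 t2 s t1' t2' s' where pp: "p = (t1, t2, s)" "p' = (t1', t2', s')" by (metis prod_cases3)
        have vs: "real v ^ s > 0" "real v ^ s' > 0" using nat by auto
        from that have "gold ^ t1 * real g ^ t2 * real u ^ s / real v ^ s =
            gold ^ t1' * real g ^ t2' * real u ^ s' / real v ^ s'"
          by (simp add: pp yy_def c_def power_divide)
        then have "gold ^ t1 * real g ^ t2 * real u ^ s * real v ^ s' =
          gold ^ t1' * real g ^ t2' * real u ^ s' * real v ^ s"
          using vs by (simp add: divide_eq_eq eq_divide_eq)
        then have "gold ^ t1 * real (g ^ t2 * u ^ s * v ^ s') = gold ^ t1' * real (g ^ t2' * u ^ s' * v ^ s)"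
          by (simp add: mult_ac)
        from gold_power_indep[OF this] show ?thesis using nat by (simp add: pp)
      qed
      have "fst ` S \<subseteq> (\<lambda>t. fst (inv_into S yy t)) ` (yy ` S)"
      proof
        fix t assume "t \<in> fst ` S"
        then obtain p where p: "p \<in> S" "t = fst p" by auto
        have "yy (inv_into S yy (yy p)) = yy p" using p by (intro f_inv_into_f) auto
        then have "fst (inv_into S yy (yy p)) = t" using fy p by metis
        then show "t \<in> (\<lambda>t. fst (inv_into S yy t)) ` (yy ` S)" using p by force
      qed
      then have 1: "card (fst ` S) \<le> card (yy ` S)"
        using finS by (meson card_image_le card_mono finite_imageI order.trans)
      have "S = (\<Union>t\<in>fst ` S. {p \<in> S. fst p = t})" by auto
      then have "card S \<le> (\<Sum>t\<in>fst ` S. card {p \<in> S. fst p = t})"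
        using card_UN_le[of "fst ` S" "\<lambda>t. {p \<in> S. fst p = t}"] finS by simp
      also have "\<dots> \<le> (\<Sum>t\<in>fst ` S. K - 1)" by (intro sum_mono fib)
      also have "\<dots> = (K - 1) * card (fst ` S)" by simp
      finally have "(K - 1) * L < (K - 1) * card (fst ` S)" using S(2) by linarith
      then show ?thesis using 1 by simp
    qed
    moreover have "(K' - 1) * L < card S"
      using S(2) nat mult_le_mono1[of "K' - 1" "K - 1" L] by linarith
    moreover have "(\<Sum>j<L. \<Sum>i<K'. real_of_int (q i j) * ((x p + x p' - 2 * xmin) gchoose i) * (yy p * yy p') ^ j) = 0"
      if p: "p \<in> S" "p' \<in> S" for p p'
    proof -
      obtain t1 t2 s where p1: "p = (t1, t2, s)" "t1 < r1" "t2 < r2" "s < r3" using p(1) S(1) by (auto simp: W_def)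
      obtain t1' t2' s' where p2: "p' = (t1', t2', s')" "t1' < r1" "t2' < r2" "s' < r3"
        using p(2) S(1) by (auto simp: W_def)
      have zP: "(p, p') \<in> P" using p by (simp add: P_def)
      have wW: "w (p, p') + Wd = x p + x p' - 2 * xmin" by (simp add: w_def Wd_def)
      let ?t = "(t1 + t1', t2 + t2', s + s')"
      have ell: "ell ?t = lm + A * w (p, p')" unfolding lmA[OF p] by (simp add: p1 p2 ell_def algebra_simps)
      have yym: "yy ?t = yy p * yy p'" by (simp add: p1 p2 yy_def power_add mult_ac)
      have "(\<Sum>i<K'. \<Sum>j<L. real_of_int (q i j) * h i (p, p') * yy ?t ^ j) = 0"
      proof (rule vanishing'[where Ku = 1])
        show "card {..<K'} \<le> K * K" using nat by (metis card_lessThan le_square order.trans)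
        show "\<exists>H :: int. h i (p, p') = real_of_int H" for i
        proof -
          obtain n n' n'' where "x p = real_of_int n" "x p' = real_of_int n'" "xmin = real_of_int n''"
            using x_int p pm by metis
          then have "w (p, p') + Wd = real_of_int (n + n' - 2 * n'')" unfolding wW by simp
          then show ?thesis unfolding h_def using gbinomial_int by metis
        qed
        show "\<bar>real_of_int (q i j)\<bar> * \<bar>h i (p, p')\<bar> \<le> Y" if ij: "i \<in> {..<K'}" "j < L" for i j
        proof -
          have "\<bar>h i (p, p')\<bar> \<le> Bd i"
            using maj_poly_bound[OF maj[of i], of 0 "w (p, p')"] w[OF zP] Wd ij nat by (simp add: h_def)
          then have "\<bar>real_of_int (q i j)\<bar> * \<bar>h i (p, p')\<bar> \<le> (Y / Bd i) * Bd i"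
            using q(2)[OF ij] Y Bd[of i] by (intro mult_mono) auto
          then show ?thesis using Bd[of i] by simp
        qed
        show "\<bar>\<Sum>i<K'. \<Sum>j<L. real_of_int (q i j) * (h i (p, p') * exp (real j * ell ?t))\<bar>
          \<le> (real 1 * real n1 + 1) * (real (card {..<K'}) * real L) * Y * G / 8 ^ n1"
          unfolding ell using q(3)[OF zP] by simp
      qed (use nat p1 p2 in auto)
      then have "(\<Sum>j<L. \<Sum>i<K'. real_of_int (q i j) * h i (p, p') * yy ?t ^ j) = 0"
        by (subst sum.swap)
      then show ?thesis unfolding h_def wW yym .
    qed
    ultimately show False
      using zero_estimate_line[of S x yy L K' i0 j0 "\<lambda>i j. real_of_int (q i j)" "2 * xmin"] finS x yyp nz by simp
  qed
qed

end

context log_form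
begin

lemma X_inj:
  assumes "p \<in> W" "p' \<in> W" "X1 p = X1 p'" "X2 p = X2 p'"
  shows "p = p'"
proof -
  obtain t1 t2 s t1' t2' s' where p: "p = (t1, t2, s)" "p' = (t1', t2', s')" by (metis prod_cases3)
  have "real (t1 + k * s) = real (t1' + k * s')" using assms(3) by (simp add: p X1_def)
  then have e: "t1 + k * s = t1' + k * s'" by (simp only: of_nat_eq_iff)
  have "t1 < k" "t1' < k" using assms(1,2) nat(6) by (auto simp: p W_def)
  then have "s = (t1 + k * s) div k" "s' = (t1' + k * s') div k" by auto
  then have "s = s'" using e by simp
  then show ?thesis using e assms(4) by (simp add: p X2_def)
qed

lemma contradiction: False
proof -
  obtain S where S: "S \<subseteq> W" "r1 * r2 * r3 \<le> card S * ((K - 1) * L)"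
    "\<And>p0 p1 p2. p0 \<in> S \<Longrightarrow> p1 \<in> S \<Longrightarrow> p2 \<in> S \<Longrightarrow>
      (X1 p1 - X1 p0) * (X2 p2 - X2 p0) = (X2 p1 - X2 p0) * (X1 p2 - X1 p0)"
    using box_case by blast
  have cS: "(K - 1) * L < card S"
  proof -
    have "(K - 1) * L * ((K - 1) * L) < card S * ((K - 1) * L)" using box S(2) by linarith
    then show ?thesis by (metis mult_less_cancel2)
  qed
  have finS: "finite S" using S(1) by (rule finite_subset) (simp add: W_def)
  have k: "k > 0" using nat(6) rpos(1) by linarith
  have tW: "fst p < r1 \<and> fst (snd p) < r2 \<and> snd (snd p) < r3" if "p \<in> S" for p
    using that S(1) by (auto simp: W_def)
  have X1': "X1 p = real (fst p) + real k * real (snd (snd p))" for p by (simp add: X1_def case_prod_beta)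
  have X2': "X2 p = real (fst (snd p)) - real N * real (snd (snd p))" for p by (simp add: X2_def case_prod_beta)
  show False
  \<comment> \<open>The points (X1, X2) lie on one line. Either \<open>X1\<close> is a parameter on
    it, or the line is vertical and \<open>X2\<close> is one. With \<open>t1\<close> fixed, a point
    is determined by \<open>s\<close> in the first case and by \<open>t2\<close> in the
    second.\<close>
  proof (cases "inj_on X1 S")
    case True
    have "1 \<le> (K - 1) * L" using nat by (simp add: Suc_le_eq)
    then have "1 < card S" using cS by linarith
    then obtain p0 p1 where p01: "p0 \<in> S" "p1 \<in> S" "p0 \<noteq> p1"
      using finS by (metis card_le_Suc0_iff_eq not_less_eq_eq less_eq_Suc_le One_nat_def)
    then have ne: "X1 p1 - X1 p0 \<noteq> 0" using True by (auto simp: inj_on_def)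
    define A where "A = la + G0 * ((X2 p1 - X2 p0) / (X1 p1 - X1 p0))"
    show False
    proof (rule line_case[OF S(1) cS True, of "ell p0 - A * X1 p0" A "real (r1 + k * r3)"])
      show "\<exists>n :: int. X1 p = real_of_int n" for p
        by (rule exI[of _ "int (fst p) + int k * int (snd (snd p))"]) (simp add: X1')
      show "ell p = ell p0 - A * X1 p0 + A * X1 p" if "p \<in> S" for p
      proof -
        have "X2 p - X2 p0 = (X2 p1 - X2 p0) / (X1 p1 - X1 p0) * (X1 p - X1 p0)"
          using S(3)[OF p01(1,2) that] ne by (simp add: field_simps)
        then have "ell p - ell p0 = A * (X1 p - X1 p0)"
          unfolding ell_X A_def by (simp add: algebra_simps)
        then show ?thesis by (simp add: algebra_simps)
      qed
      show "X1 p - X1 p' \<le> real (r1 + k * r3)" if "p \<in> S" "p' \<in> S" for p p'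
      proof -
        have "real k * real (snd (snd p)) \<le> real k * real r3"
          using tW[OF that(1)] by (intro mult_left_mono) auto
        moreover have "0 \<le> real (fst p') + real k * real (snd (snd p'))" by simp
        moreover have "real (fst p) \<le> real r1" using tW[OF that(1)] by simp
        ultimately show ?thesis unfolding X1' of_nat_add of_nat_mult by linarith
      qed
      show "9 * real (r1 + k * r3) + real K \<le> Xl" by (rule Xl(1))
      show "card {p \<in> S. fst p = t1} \<le> K - 1" for t1
      proof -
        have "inj_on (\<lambda>p. snd (snd p)) {p \<in> S. fst p = t1}"
          using True by (auto simp: inj_on_def X1')
        then have "card {p \<in> S. fst p = t1} \<le> card {..<r3}"
          using tW by (intro card_inj_on_le) auto
        then show ?thesis using nat by simp
      qed
    qed
  next
    case False
    then obtain p p' where pp: "p \<in> S" "p' \<in> S" "p \<noteq> p'" "X1 p = X1 p'" unfolding inj_on_def by blast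
    then have "X2 p' - X2 p \<noteq> 0" using X_inj[of p p'] subsetD[OF S(1)] by auto
    then have const: "X1 q = X1 p" if "q \<in> S" for q
      using S(3)[OF pp(1,2) that] pp(4) by simp
    have inj2: "inj_on X2 S"
      using X_inj S(1) const by (intro inj_onI) (metis subsetD)
    show False
    proof (rule line_case[OF S(1) cS inj2, of "la * X1 p" G0 "real (r2 + N * r3)"])
      show "\<exists>n :: int. X2 p = real_of_int n" for p
        by (rule exI[of _ "int (fst (snd p)) - int N * int (snd (snd p))"]) (simp add: X2')
      show "ell q = la * X1 p + G0 * X2 q" if "q \<in> S" for q
        unfolding ell_X const[OF that] ..
      show "X2 q - X2 q' \<le> real (r2 + N * r3)" if "q \<in> S" "q' \<in> S" for q q'
      proof -
        have "real N * real (snd (snd q')) \<le> real N * real r3"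
          using tW[OF that(2)] by (intro mult_left_mono) auto
        moreover have "0 \<le> real N * real (snd (snd q))" "0 \<le> real (fst (snd q'))" by simp_all
        moreover have "real (fst (snd q)) \<le> real r2" using tW[OF that(1)] by simp
        ultimately show ?thesis unfolding X2' of_nat_add of_nat_mult by linarith
      qed
      show "9 * real (r2 + N * r3) + real K \<le> Xl" by (rule Xl(2))
      show "card {q \<in> S. fst q = t1} \<le> K - 1" for t1
      proof -
        have "inj_on (\<lambda>q. fst (snd q)) {q \<in> S. fst q = t1}"
        proof (rule inj_onI)
          fix q q' assume q: "q \<in> {q \<in> S. fst q = t1}" "q' \<in> {q \<in> S. fst q = t1}" "fst (snd q) = fst (snd q')"
          then have "X1 q = X1 q'" using const[of q] const[of q'] by simp
          then have "snd (snd q) = snd (snd q')" using q k by (simp add: X1')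
          then show "q = q'" using q by (simp add: prod_eq_iff)
        qed
        then have "card {q \<in> S. fst q = t1} \<le> card {..<r2}"
          using tW by (intro card_inj_on_le) auto
        then show ?thesis using nat by simp
      qed
    qed
  qed
qed

end

section \<open>Numerical parameters\<close>

lemma exp_taylor_bounds:
  fixes x :: real
  assumes "x \<ge> 0"
  shows "(\<Sum>n<N. x ^ n / fact n) \<le> exp x" "exp x \<le> (\<Sum>n<N. x ^ n / fact n) + exp (8 * x) / 8 ^ N"
proof -
  have "exp x = (\<Sum>n. x ^ n / fact n)" by (simp add: exp_def field_simps)
  moreover have "summable (\<lambda>n. x ^ n / fact n)"
    using summable_exp_generic[of x] by (simp add: field_simps)
  ultimately show "(\<Sum>n<N. x ^ n / fact n) \<le> exp x"
    using assms by (simp add: sum_le_suminf)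
  show "exp x \<le> (\<Sum>n<N. x ^ n / fact n) + exp (8 * x) / 8 ^ N"
    using exp_truncate[of 8 x N] assms by (simp add: abs_le_iff)
qed

lemma exp_2_le: "exp 2 \<le> (9 :: real)"
proof -
  have "exp 1 \<le> (3 :: real)" by (rule exp_le)
  then have "exp 1 * exp 1 \<le> 3 * (3 :: real)" by (intro mult_mono) auto
  then show ?thesis by (simp flip: exp_add)
qed

text \<open>The exponential is evaluated at a quarter of the argument, where the crude remainder exp
  (8 x) / 8^N is small enough, and then raised to the fourth power.\<close>

lemma ln_2_ge: "ln 2 \<ge> (693 / 1000 :: real)"
proof -
  have "exp (8 * (693 / 4000)) \<le> exp (2 :: real)" by simp
  then have "exp (8 * (693 / 4000)) \<le> (9 :: real)" using exp_2_le by linarith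
  then have "exp (693 / 4000) \<le> (\<Sum>n<8. (693 / 4000 :: real) ^ n / fact n) + 9 / 8 ^ 8"
    using exp_taylor_bounds(2)[of "693 / 4000" 8] by (simp add: divide_right_mono)
  also have "\<dots> \<le> 11892 / 10000" by (simp add: eval_nat_numeral fact_numeral)
  finally have "exp (693 / 4000) ^ 4 \<le> (11892 / 10000 :: real) ^ 4" by (intro power_mono) auto
  also have "\<dots> \<le> 2" by (simp add: power4_eq_xxxx)
  finally have "exp (693 / 1000) \<le> (2 :: real)" by (simp flip: exp_of_nat_mult)
  moreover have "(0 :: real) < 2" by simp
  ultimately show ?thesis using ln_ge_iff by blast
qed

lemma ln_gold_bounds: "ln gold \<ge> 48 / 100" "ln gold \<le> 4813 / 10000"
proof -
  have g: "gold > 0" using gold_bounds by linarith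
  have "exp (8 * (6 / 100)) \<le> exp (2 :: real)" by simp
  then have "exp (8 * (6 / 100)) \<le> (9 :: real)" using exp_2_le by linarith
  then have "exp (6 / 100) \<le> (\<Sum>n<6. (6 / 100 :: real) ^ n / fact n) + 9 / 8 ^ 6"
    using exp_taylor_bounds(2)[of "6 / 100" 6] by (simp add: divide_right_mono)
  also have "\<dots> \<le> 10619 / 10000" by (simp add: eval_nat_numeral fact_numeral)
  finally have "exp (6 / 100) ^ 8 \<le> (10619 / 10000 :: real) ^ 8" by (intro power_mono) auto
  also have "\<dots> \<le> 1618 / 1000" by (simp add: eval_nat_numeral)
  finally have "exp (48 / 100) \<le> (1618 / 1000 :: real)" by (simp flip: exp_of_nat_mult)
  then have "exp (48 / 100) \<le> gold" using gold_bounds by linarith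
  then show "ln gold \<ge> 48 / 100" using g ln_ge_iff by blast
  have "sqrt 5 < 22361 / 10000" by (rule real_less_lsqrt) (simp_all add: power2_eq_square)
  then have "gold \<le> 161805 / 100000" by (simp add: gold_def)
  also have "\<dots> \<le> (\<Sum>n<8. (4813 / 10000 :: real) ^ n / fact n)"
    by (simp add: eval_nat_numeral fact_numeral)
  also have "\<dots> \<le> exp (4813 / 10000)" by (rule exp_taylor_bounds) simp
  finally show "ln gold \<le> 4813 / 10000" using g by (metis exp_gt_zero ln_exp ln_le_cancel_iff)
qed

lemma power_div_fact_le: "K \<ge> 0 \<Longrightarrow> (K * e) ^ a / fact a \<le> exp K * e ^ a" if "e \<ge> 0" for K e :: real
  using power_le_fact_exp[of K a] that mult_right_mono[of "K ^ a / fact a" "exp K" "e ^ a"]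
  by (simp add: power_mult_distrib)

lemma sum_triangle:
  "(\<Sum>(a, b)\<in>{(a, b). a + b < K}. 1 :: real) = real K * (real K + 1) / 2"
  "(\<Sum>(a, b)\<in>{(a, b). a + b < K}. real (a + b)) = (real K - 1) * real K * (real K + 1) / 3"
proof -
  have *: "(\<Sum>(a, b)\<in>{(a, b). a + b < K}. f (a + b)) = (\<Sum>n<K. (real n + 1) * f n)" for f :: "nat \<Rightarrow> real"
    using sum.triangle_reindex[of "\<lambda>a b. f (a + b)" K] by (simp add: add.commute)
  have "(\<Sum>n<K. (real n + 1) * 1) = real K * (real K + 1) / 2"
    by (induction K) (simp_all add: field_simps)
  then show "(\<Sum>(a, b)\<in>{(a, b). a + b < K}. 1 :: real) = real K * (real K + 1) / 2"
    using *[of "\<lambda>_. 1"] by simp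
  have "(\<Sum>n<K. (real n + 1) * real n) = (real K - 1) * real K * (real K + 1) / 3"
    by (induction K) (simp_all add: field_simps)
  then show "(\<Sum>(a, b)\<in>{(a, b). a + b < K}. real (a + b)) = (real K - 1) * real K * (real K + 1) / 3"
    using *[of real] by simp
qed

text \<open>The terms of \<open>y\<close>: 2/3 K b bounds b times the mean of a + c over the
  triangle; 2 K comes from K^a / a! <= exp K, used twice; K L ln 8 / 16 is K n1^2 / 2 * ln 8 shared
  among about K^2 L / 2 unknowns, with n1 = K L / 4. The lower-order part of n1 (n1 + 1) / 2 is
  absorbed by K (K + 1) / 2 > K^2 / 2 since L >= 4, and the 1 gives strictness.\<close>

lemma siegel_box_numeric:
  fixes K L n1 :: nat and b y Xs :: real
  assumes K: "K \<ge> 1" "L \<ge> 4" and n1: "4 * n1 = K * L" and b: "b \<ge> 0" and Xs: "Xs = real K * exp b"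
    and y: "y \<ge> 2 / 3 * real K * b + 2 * real K + real K * real L * ln 8 / 16 + 1"
  shows "8 ^ (K * (n1 * (n1 + 1) div 2)) <
      (\<Prod>(a, c)\<in>{(a, c). a + c < K}. exp y / (Xs ^ a / fact a * (Xs ^ c / fact c))) ^ L"
proof -
  let ?T = "{(a, c). a + c < K}"
  have fin: "finite ?T" by (rule finite_subset[of _ "{..<K} \<times> {..<K}"]) auto
  define Z where "Z = real K * (real K + 1) / 2 * (y - 2 * real K) - b * ((real K - 1) * real K * (real K + 1) / 3)"
  have "exp Z = (\<Prod>(a, c)\<in>?T. exp (y - 2 * real K - b * real (a + c)))"
  proof -
    have "Z = (\<Sum>(a, c)\<in>?T. y - 2 * real K - b * real (a + c))"
    proof -
      have "(\<Sum>(a, c)\<in>?T. y - 2 * real K - b * real (a + c)) =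
        (y - 2 * real K) * (\<Sum>(a, c)\<in>?T. 1) - b * (\<Sum>(a, c)\<in>?T. real (a + c))"
        by (simp add: case_prod_beta sum_subtractf sum_distrib_left)
      then show ?thesis unfolding sum_triangle Z_def by simp
    qed
    then show ?thesis using fin by (simp add: exp_sum case_prod_beta)
  qed
  also have "\<dots> \<le> (\<Prod>(a, c)\<in>?T. exp y / (Xs ^ a / fact a * (Xs ^ c / fact c)))"
  proof (intro prod_mono, clarify, intro conjI)
    fix a c
    have X0: "Xs > 0" using K Xs by simp
    have "Xs ^ a / fact a * (Xs ^ c / fact c) \<le> (exp (real K) * exp b ^ a) * (exp (real K) * exp b ^ c)"
      unfolding Xs by (intro mult_mono power_div_fact_le) auto
    also have "\<dots> = exp (2 * real K + b * real (a + c))"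
      by (simp add: exp_add[symmetric] exp_of_nat_mult[symmetric] algebra_simps)
    finally have le: "Xs ^ a / fact a * (Xs ^ c / fact c) \<le> exp (2 * real K + b * real (a + c))" .
    have "exp (y - 2 * real K - b * real (a + c)) = exp y / exp (2 * real K + b * real (a + c))"
      by (simp add: exp_diff[symmetric] algebra_simps)
    also have "\<dots> \<le> exp y / (Xs ^ a / fact a * (Xs ^ c / fact c))"
      using le X0 by (intro divide_left_mono mult_pos_pos) auto
    finally show "exp (y - 2 * real K - b * real (a + c)) \<le> exp y / (Xs ^ a / fact a * (Xs ^ c / fact c))" .
  qed auto
  finally have "exp Z ^ L \<le> (\<Prod>(a, c)\<in>?T. exp y / (Xs ^ a / fact a * (Xs ^ c / fact c))) ^ L"
    by (intro power_mono) auto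
  moreover have "8 ^ (K * (n1 * (n1 + 1) div 2)) < exp Z ^ L"
  proof -
    have n: "real n1 = real K * real L / 4" using n1 by (metis of_nat_mult of_nat_numeral nonzero_mult_div_cancel_left zero_neq_numeral)
    have ev: "real (n1 * (n1 + 1) div 2) = real n1 * (real n1 + 1) / 2"
      by (simp add: real_of_nat_div algebra_simps)
    have K0: "real K \<ge> 1" using K by simp
    have "real K * (real K + 1) / 2 * (real K * real L * ln 8 / 16 + 1) \<le> Z"
    proof -
      have "b * ((real K - 1) * real K * (real K + 1) / 3) \<le> b * (real K * real K * (real K + 1) / 3)"
        using b K0 by (intro mult_left_mono divide_right_mono mult_right_mono) auto
      also have "\<dots> = real K * (real K + 1) / 2 * (2 / 3 * real K * b)" by simp
      finally have 1: "b * ((real K - 1) * real K * (real K + 1) / 3) \<le> real K * (real K + 1) / 2 * (2 / 3 * real K * b)" .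
      have "real K * (real K + 1) / 2 * (2 / 3 * real K * b + (real K * real L * ln 8 / 16 + 1))
        \<le> real K * (real K + 1) / 2 * (y - 2 * real K)"
        using y by (intro mult_left_mono) auto
      then show ?thesis using 1 unfolding Z_def distrib_left[of _ "2 / 3 * real K * b"] by linarith
    qed
    then have "real L * (real K * (real K + 1) / 2 * (real K * real L * ln 8 / 16 + 1)) \<le> real L * Z"
      by (intro mult_left_mono) auto
    moreover have "real (K * (n1 * (n1 + 1) div 2)) * ln 8 < real L * (real K * (real K + 1) / 2 * (real K * real L * ln 8 / 16 + 1))"
    proof -
      have "real (K * (n1 * (n1 + 1) div 2)) * ln 8 =
         real L * (real K * (real K) / 2 * (real K * real L * ln 8 / 16)) + real K * real K * real L * (1 / 8 * ln 8)"
        unfolding of_nat_mult ev n by (simp add: field_simps)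
      also have "\<dots> \<le> real L * (real K * (real K) / 2 * (real K * real L * ln 8 / 16)) + real K * real K * real L * (real L / 32 * ln 8)"
        using K by (intro add_left_mono mult_left_mono mult_right_mono) auto
      also have "\<dots> < real L * (real K * (real K + 1) / 2 * (real K * real L * ln 8 / 16)) + real L * (real K * (real K + 1) / 2)"
      proof -
        have "real L * (real K * (real K + 1) / 2) > 0" using K by simp
        moreover have "real L * (real K * (real K + 1) / 2 * (real K * real L * ln 8 / 16)) =
          real L * (real K * (real K) / 2 * (real K * real L * ln 8 / 16)) + real K * real K * real L * (real L / 32 * ln 8)"
          by (simp add: field_simps)
        ultimately show ?thesis by linarith
      qed
      finally show ?thesis by (simp add: field_simps)
    qed
    ultimately have "real (K * (n1 * (n1 + 1) div 2)) * ln 8 < real L * Z" by linarith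
    then have "exp (real (K * (n1 * (n1 + 1) div 2)) * ln 8) < exp (real L * Z)" by simp
    then show ?thesis by (simp only: exp_of_nat_mult) simp
  qed
  ultimately show ?thesis by linarith
qed

text \<open>With K' = K / 2 there are K L / 2 unknowns for n1^2 / 2 * ln 8, the same share as in the
  plane, so the same \<open>y\<close> serves. The extra factor 9/2 in \<open>Xl\<close> is paid for
  by having one binomial instead of two, which leaves K of the summand 2 K.\<close>

lemma siegel_line_numeric:
  fixes K L n1 K' :: nat and b y Xl :: real
  assumes K: "K \<ge> 1" "L \<ge> 4" "K = 2 * K'" and n1: "4 * n1 = K * L" and b: "b \<ge> 0" and Xl: "Xl = 9 / 2 * (real K * exp b)"
    and y: "y \<ge> 2 / 3 * real K * b + 2 * real K + real K * real L * ln 8 / 16 + 1"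
  shows "8 ^ (n1 * (n1 + 1) div 2) < (\<Prod>i<K'. exp y / (Xl ^ i / fact i)) ^ L"
proof -
  define b' where "b' = b + ln (9 / 2)"
  have l92: "ln (9 / 2) \<le> (16 / 10 :: real)"
  proof -
    have "(\<Sum>n<5. (16 / 10 :: real) ^ n / fact n) \<le> exp (16 / 10)" by (rule exp_taylor_bounds) simp
    moreover have "(9 / 2 :: real) \<le> (\<Sum>n<5. (16 / 10 :: real) ^ n / fact n)"
      by (simp add: eval_nat_numeral fact_numeral)
    ultimately have "9 / 2 \<le> exp (16 / 10 :: real)" by linarith
    then show ?thesis by (metis exp_gt_zero ln_exp ln_le_cancel_iff zero_less_divide_iff zero_less_numeral)
  qed
  have Xl': "Xl = real K * exp b'" using Xl by (simp add: b'_def exp_add)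
  define Z where "Z = real K' * (y - real K) - b' * (real K' * real K' / 2)"
  have b'0: "b' \<ge> 0" using b by (simp add: b'_def)
  have "Z \<le> (\<Sum>i<K'. y - real K - b' * real i)"
  proof -
    have "(\<Sum>i<K'. real i) \<le> real K' * real K' / 2" by (induction K') (simp_all add: field_simps)
    then have "b' * (\<Sum>i<K'. real i) \<le> b' * (real K' * real K' / 2)" using b'0 by (rule mult_left_mono)
    then show ?thesis unfolding Z_def by (simp add: sum_subtractf sum_distrib_left)
  qed
  then have "exp Z \<le> (\<Prod>i<K'. exp (y - real K - b' * real i))" by (simp flip: exp_sum)
  also have "\<dots> \<le> (\<Prod>i<K'. exp y / (Xl ^ i / fact i))"
  proof (intro prod_mono conjI)
    fix i
    have X0: "Xl > 0" using K Xl' by simp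
    have "Xl ^ i / fact i \<le> exp (real K) * exp b' ^ i" unfolding Xl' by (rule power_div_fact_le) auto
    also have "\<dots> = exp (real K + b' * real i)"
      by (simp add: exp_add exp_of_nat_mult[symmetric] mult.commute)
    finally have le: "Xl ^ i / fact i \<le> exp (real K + b' * real i)" .
    have "exp (y - real K - b' * real i) = exp y / exp (real K + b' * real i)"
      by (simp add: exp_diff[symmetric] algebra_simps)
    also have "\<dots> \<le> exp y / (Xl ^ i / fact i)"
      using le X0 by (intro divide_left_mono mult_pos_pos) auto
    finally show "exp (y - real K - b' * real i) \<le> exp y / (Xl ^ i / fact i)" .
  qed auto
  finally have "exp Z ^ L \<le> (\<Prod>i<K'. exp y / (Xl ^ i / fact i)) ^ L" by (intro power_mono) auto
  moreover have "8 ^ (n1 * (n1 + 1) div 2) < exp Z ^ L"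
  proof -
    define k where "k = real K'"
    have k: "k \<ge> 1" "real K = 2 * k" using K by (auto simp: k_def)
    have n: "real n1 = k * real L / 2"
    proof -
      have "real (4 * n1) = real (K * L)" using n1 by simp
      then show ?thesis using k by simp
    qed
    have ev: "real (n1 * (n1 + 1) div 2) = real n1 * (real n1 + 1) / 2"
      by (simp add: real_of_nat_div algebra_simps)
    have "k * (k * (2 - 8 / 10) + 2 * k * real L * ln 8 / 16 + 1) \<le> Z"
    proof -
      have "b' * (k * k / 2) \<le> (b + 16 / 10) * (k * k / 2)"
        using l92 by (intro mult_right_mono) (auto simp: b'_def)
      moreover have "k * (2 / 3 * (2 * k) * b + 2 * (2 * k) + 2 * k * real L * ln 8 / 16 + 1 - 2 * k) \<le> k * (y - 2 * k)"
        using y k by (intro mult_left_mono) auto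
      moreover have "b * (k * k / 2) \<le> k * (2 / 3 * (2 * k) * b)" using b k by (simp add: field_simps)
      ultimately show ?thesis unfolding Z_def k_def[symmetric] k(2) by (simp add: algebra_simps)
    qed
    then have 1: "real L * (k * (k * (2 - 8 / 10) + 2 * k * real L * ln 8 / 16 + 1)) \<le> real L * Z"
      by (intro mult_left_mono) auto
    have l8: "ln 8 \<le> (24 / 10 :: real)"
    proof -
      have "ln (2 ^ 3 :: real) = 3 * ln 2" by (subst ln_realpow) auto
      moreover have "ln 2 \<le> (8 / 10 :: real)"
      proof -
        have "(\<Sum>n<3. (8 / 10 :: real) ^ n / fact n) \<le> exp (8 / 10)" by (rule exp_taylor_bounds) simp
        then have "2 \<le> exp (8 / 10 :: real)" by (simp add: eval_nat_numeral fact_numeral)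
        then show ?thesis by (metis exp_gt_zero ln_exp ln_le_cancel_iff zero_less_numeral)
      qed
      ultimately show ?thesis by simp
    qed
    have "real (n1 * (n1 + 1) div 2) * ln 8 = real L * (k * (2 * k * real L * ln 8 / 16)) + real L * (k * (ln 8 / 4))"
      unfolding ev n by (simp add: field_simps)
    also have "\<dots> \<le> real L * (k * (2 * k * real L * ln 8 / 16)) + real L * (k * (12 / 10))"
      using l8 k by (intro add_left_mono mult_left_mono) auto
    also have "\<dots> < real L * (k * (k * (2 - 8 / 10) + 2 * k * real L * ln 8 / 16 + 1))"
    proof -
      have "real L * (k * (12 / 10)) \<le> real L * (k * (k * (12 / 10)))" using k by (intro mult_left_mono) auto
      moreover have "real L * k > 0" using k K by simp
      ultimately show ?thesis by (simp add: algebra_simps)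
    qed
    finally have "real (n1 * (n1 + 1) div 2) * ln 8 < real L * Z" using 1 by linarith
    then have "exp (real (n1 * (n1 + 1) div 2) * ln 8) < exp (real L * Z)" by simp
    then show ?thesis by (simp only: exp_of_nat_mult) simp
  qed
  ultimately show ?thesis by linarith
qed

lemma ln_2_le: "ln 2 \<le> (6932 / 10000 :: real)"
proof -
  have "2 \<le> (\<Sum>n<8. (6932 / 10000 :: real) ^ n / fact n)"
    by (simp add: eval_nat_numeral fact_numeral)
  also have "\<dots> \<le> exp (6932 / 10000)" by (rule exp_taylor_bounds) simp
  finally show ?thesis by (metis exp_gt_zero ln_exp ln_le_cancel_iff zero_less_numeral)
qed

lemma ln_8_bounds: "ln 8 \<ge> (2079 / 1000 :: real)" "ln 8 \<le> (20796 / 10000 :: real)"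
proof -
  have "ln (2 ^ 3 :: real) = 3 * ln 2" by (subst ln_realpow) auto
  then show "ln 8 \<ge> (2079 / 1000 :: real)" "ln 8 \<le> (20796 / 10000 :: real)"
    using ln_2_ge ln_2_le by simp_all
qed

text \<open>The threshold is 2 * 9000^2, from x <= (x / 9000)^2 / 2 <= exp (x / 9000).\<close>

lemma power9_le_exp:
  assumes "x \<ge> (162 * 10 ^ 6 :: real)"
  shows "x ^ 9 \<le> exp (x / 1000)"
proof -
  have "x * (162 * 10 ^ 6) \<le> x * x" using assms by (intro mult_left_mono) auto
  then have "x \<le> (x / 9000) ^ 2 / fact 2" by (simp add: power2_eq_square fact_numeral)
  also have "\<dots> \<le> exp (x / 9000)" using assms by (intro power_le_fact_exp) auto
  finally have "x ^ 9 \<le> exp (x / 9000) ^ 9" using assms by (intro power_mono) auto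
  also have "\<dots> = exp (x / 1000)" by (simp flip: exp_of_nat_mult)
  finally show ?thesis .
qed

text \<open>The parameters are \<open>K \<approx> 6.7 10\<^sup>6 L\<^sup>2 h ln g\<close> and a box with sides \<open>K / 240\<close> divided by \<open>ln \<phi>\<close>, \<open>ln g\<close>, \<open>h\<close>,
  which makes the volume of the box exceed \<open>(K L)\<^sup>2\<close>. With \<open>n1 = K L / 4\<close> Taylor coefficients the smallness
  attained is \<open>8\<^bsup>-n1\<^esup> = exp (- K L ln 8 / 4)\<close>, whence the constant \<open>3.5 10\<^sup>6 \<approx> 6.7 10\<^sup>6 ln 8 / 4\<close>.\<close>

theorem linear_form_lower_bound:
  fixes g k N u v L :: nat and h :: real
  assumes nat: "g \<ge> 2" "u \<ge> 1" "v \<ge> 1" "L \<ge> 200"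
    and h: "h \<ge> 1 / 2" "2 * ln (real v) + max 0 (ln (real u / real v)) \<le> h"
    and k: "3500000 * real L ^ 3 * ln (real g) * h \<le> real k"
    and kh: "real k / (120 * h) + 12 / 10 \<le> exp (98 / 1000 * real L - 31 / 10)"
    and small: "\<bar>real k * ln gold - real N * ln (real g) - ln (real u / real v)\<bar> \<le>
      exp (- (3500000 * real L ^ 3 * ln (real g) * h))"
  shows False
proof -
  define c where "c = real u / real v"
  define la where "la = ln gold"
  define G0 where "G0 = ln (real g)"
  define Lam where "Lam = real k * la - real N * G0 - ln c"
  define th where "th = real k * la - real N * G0"
  define l where "l = real L"
  define M where "M = l ^ 2 * (G0 * h)"
  define T where "T = 3500000 * l * M"
  \<comment> \<open>By \<open>kh\<close>, exp b bounds the arguments of the binomials relative to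
    \<open>KK\<close>. The slope 98/1000 is nearly the largest that the final balance of exponents
    allows.\<close>
  define b where "b = 98 / 1000 * l - 31 / 10"
  define q where "q = real k / (120 * h)"
  have l: "l \<ge> 200" using nat by (simp add: l_def)
  have la: "48 / 100 \<le> la" "la \<le> 4813 / 10000" using ln_gold_bounds by (auto simp: la_def)
  have G0: "G0 \<ge> 693 / 1000"
  proof -
    have "ln 2 \<le> G0" using nat by (simp add: G0_def)
    then show ?thesis using ln_2_ge by linarith
  qed
  have c: "c > 0" using nat by (simp add: c_def)
  have T: "T = 3500000 * real L ^ 3 * ln (real g) * h"
    by (simp add: T_def M_def l_def G0_def power3_eq_cube power2_eq_square)
  have Lam: "\<bar>Lam\<bar> \<le> exp (- T)" using small unfolding T Lam_def la_def G0_def c_def .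
  have kT: "T \<le> real k" using k unfolding T .
  define lc where "lc = max 0 (ln c)"
  have lv: "ln (real v) \<ge> 0" using nat by simp
  have hlc: "2 * ln (real v) + lc \<le> h" using h(2) by (simp add: lc_def c_def)
  have lcb: "lc \<ge> 0" "ln c \<le> lc" "lc \<le> h" "- ln c \<le> h"
  proof -
    show "lc \<ge> 0" "ln c \<le> lc" by (auto simp: lc_def)
    show "lc \<le> h" using hlc lv by linarith
    have "- ln c = ln (real v) - ln (real u)" using nat by (simp add: c_def ln_div)
    moreover have "ln (real u) \<ge> 0" using nat by simp
    ultimately show "- ln c \<le> h" using hlc lv \<open>lc \<ge> 0\<close> by linarith
  qed
  have abslc: "\<bar>ln c\<bar> \<le> h" using lcb by linarith
  have l2: "l ^ 2 \<ge> 200 * l" using l by (simp add: power2_eq_square)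
  have Gh: "G0 * h \<ge> 693 / 2000"
    using mult_mono[of "693 / 1000" G0 "1 / 2" h] G0 h by simp
  have M1: "M \<ge> 693 / 2000 * l ^ 2"
    using mult_left_mono[OF Gh, of "l ^ 2"] by (simp add: M_def)
  have M0: "M \<ge> 13860" using M1 l2 l by linarith
  have M2: "M \<ge> 20000 * G0"
  proof -
    have "40000 * (G0 * (1 / 2)) \<le> l ^ 2 * (G0 * h)"
      using l l2 G0 h by (intro mult_mono) auto
    then show ?thesis by (simp add: M_def)
  qed
  have M3: "M \<ge> 27720 * h"
  proof -
    have "40000 * (693 / 1000 * h) \<le> l ^ 2 * (G0 * h)"
      using l l2 G0 h by (intro mult_mono mult_right_mono) auto
    then show ?thesis by (simp add: M_def)
  qed
  \<comment> \<open>\<open>K\<close> is taken divisible by 4 so that n1 = K L / 4 and K' = K / 2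
    hold exactly.\<close>
  define K4 where "K4 = nat \<lceil>1675000 * M\<rceil>"
  define K where "K = 4 * K4"
  define KK where "KK = real K"
  define n1 where "n1 = K4 * L"
  have K4: "1675000 * M \<le> real K4" "real K4 \<le> 1675000 * M + 1"
  proof -
    have "0 \<le> 1675000 * M" using M0 by simp
    then have "0 \<le> \<lceil>1675000 * M\<rceil>" by linarith
    then have "real K4 = of_int \<lceil>1675000 * M\<rceil>" by (simp add: K4_def)
    then show "1675000 * M \<le> real K4" "real K4 \<le> 1675000 * M + 1" by linarith+
  qed
  have KK: "6700000 * M \<le> KK" "KK \<le> 6700000 * M + 4" using K4 by (simp_all add: KK_def K_def)
  have KKl: "KK \<ge> 2000000 * l ^ 2" using KK M1 zero_le_power2[of l] by linarith
  have KKl': "KK \<ge> 400000000 * l" using KKl l2 by linarith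
  have KKbig: "KK \<ge> 10000000000" using KK M0 by simp
  have n1: "real n1 = KK * l / 4" "4 * n1 = K * L" by (simp_all add: n1_def KK_def K_def l_def)
  define a1 where "a1 = KK / (240 * la)"
  define a2 where "a2 = KK / (240 * G0)"
  define a3 where "a3 = KK / (240 * h)"
  have hpos: "h > 0" "G0 > 0" "la > 0" using h G0 la by auto
  have a: "a1 \<ge> 8 / 1000 * KK" "a2 \<ge> 10000" "a3 \<ge> 10000"
  proof -
    have "8 / 1000 * KK * (240 * la) \<le> 8 / 1000 * KK * 125" using la KKbig by (intro mult_left_mono) auto
    also have "\<dots> = KK" by simp
    finally show "a1 \<ge> 8 / 1000 * KK" using hpos by (simp add: a1_def le_divide_eq)
    show "a2 \<ge> 10000" using KK M2 hpos by (simp add: a2_def le_divide_eq)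
    show "a3 \<ge> 10000" using KK M3 hpos by (simp add: a3_def le_divide_eq)
  qed
  \<comment> \<open>Subtracting l / 2 makes room for the \<open>L\<close> translates: 2 r1 + L <= 2
    a1.\<close>
  define r1 where "r1 = nat \<lfloor>a1 - l / 2\<rfloor>"
  define r2 where "r2 = nat \<lfloor>a2\<rfloor>"
  define r3 where "r3 = nat \<lfloor>a3\<rfloor>"
  have fl: "real (nat \<lfloor>x\<rfloor>) \<le> x \<and> x - 1 \<le> real (nat \<lfloor>x\<rfloor>)" if "x \<ge> 0" for x :: real
    using that by linarith
  have r1: "real r1 \<le> a1 - l / 2" "real r1 \<ge> 999 / 1000 * a1"
  proof -
    have "a1 - l / 2 \<ge> 0" using a(1) KKl' l by linarith
    from fl[OF this] show "real r1 \<le> a1 - l / 2" "real r1 \<ge> 999 / 1000 * a1"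
      unfolding r1_def[symmetric] using a(1) KKl' l by linarith+
  qed
  have r2: "real r2 \<le> a2" "real r2 \<ge> 999 / 1000 * a2" using fl[of a2] a(2) unfolding r2_def[symmetric] by linarith+
  have r3: "real r3 \<le> a3" "real r3 \<ge> 999 / 1000 * a3" using fl[of a3] a(3) unfolding r3_def[symmetric] by linarith+
  have s1: "real (2 * r1 + L) * la \<le> KK / 120"
  proof -
    have "real (2 * r1 + L) * la \<le> (2 * a1) * la" using r1(1) hpos by (intro mult_right_mono) (auto simp: l_def)
    also have "\<dots> = KK / 120" using hpos by (simp add: a1_def)
    finally show ?thesis .
  qed
  have s2: "real (2 * r2) * G0 \<le> KK / 120"
  proof -
    have "real (2 * r2) * G0 \<le> (2 * a2) * G0" using r2(1) hpos by (intro mult_right_mono) auto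
    also have "\<dots> = KK / 120" using hpos by (simp add: a2_def)
    finally show ?thesis .
  qed
  have s3: "real (2 * r3) * h \<le> KK / 120"
  proof -
    have "real (2 * r3) * h \<le> (2 * a3) * h" using r3(1) hpos by (intro mult_right_mono) auto
    also have "\<dots> = KK / 120" using hpos by (simp add: a3_def)
    finally show ?thesis .
  qed
  have a1u: "a1 \<le> 87 / 10000 * KK"
  proof -
    have "KK * 1 \<le> KK * (87 / 10000 * (240 * la))" using la KKbig by (intro mult_left_mono) auto
    then show ?thesis using hpos by (simp add: a1_def divide_le_eq mult_ac)
  qed
  have a2u: "a2 \<le> 61 / 10000 * KK"
  proof -
    have "KK * 1 \<le> KK * (61 / 10000 * (240 * G0))" using G0 KKbig by (intro mult_left_mono) auto
    then show ?thesis using hpos by (simp add: a2_def divide_le_eq mult_ac)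
  qed
  have a3u: "a3 \<le> 1 / 120 * KK"
  proof -
    have "KK * 1 \<le> KK * (1 / 120 * (240 * h))" using h KKbig by (intro mult_left_mono) auto
    then show ?thesis using hpos by (simp add: a3_def divide_le_eq mult_ac)
  qed
  have box: "((K - 1) * L) * ((K - 1) * L) < r1 * r2 * r3"
  proof -
    have "(KK * l) * (KK * l) \<le> (999 / 1000 * a1) * (999 / 1000 * a2) * (999 / 1000 * a3)"
    proof -
      \<comment> \<open>240^3 = 13824000. Times the upper bound 0.4813 for ln phi this is below
        6660000, and so below 6700000, the factor between \<open>M\<close> and \<open>KK\<close>,
        with room for the rounding of the sides.\<close>
      have e: "a1 * a2 * a3 = KK * KK * KK / (13824000 * la * (G0 * h))"
        by (simp add: a1_def a2_def a3_def)
      have "l ^ 2 * (13824000 * la * (G0 * h)) \<le> l ^ 2 * (6660000 * (G0 * h))"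
        using la hpos by (intro mult_left_mono mult_right_mono) auto
      also have "\<dots> = 6660000 * M" by (simp add: M_def)
      also have "\<dots> \<le> 997 / 1000 * KK" using KK M0 by linarith
      finally have "l ^ 2 \<le> 997 / 1000 * KK / (13824000 * la * (G0 * h))"
        using hpos by (simp add: pos_le_divide_eq)
      then have "KK * KK * l ^ 2 \<le> KK * KK * (997 / 1000 * KK / (13824000 * la * (G0 * h)))"
        by (intro mult_left_mono) auto
      also have "\<dots> = 997 / 1000 * (a1 * a2 * a3)" unfolding e by simp
      also have "\<dots> \<le> (999 / 1000) ^ 3 * (a1 * a2 * a3)"
        using a KKbig by (intro mult_right_mono) (auto simp: power3_eq_cube)
      finally show ?thesis by (simp add: power2_eq_square power3_eq_cube mult_ac)
    qed
    also have "\<dots> \<le> real r1 * real r2 * real r3"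
      using r1 r2 r3 a KKbig by (intro mult_mono) auto
    finally have "real (K * L * (K * L)) \<le> real (r1 * r2 * r3)" by (simp add: KK_def l_def)
    then have "K * L * (K * L) \<le> r1 * r2 * r3" by (simp only: of_nat_le_iff)
    moreover have "(K - 1) * L < K * L" using KKbig nat by (simp add: KK_def)
    then have "((K - 1) * L) * ((K - 1) * L) < K * L * (K * L)" by (metis mult_strict_mono le_less_trans zero_le)
    ultimately show ?thesis by linarith
  qed
  have E9: "KK ^ 9 \<le> exp (KK / 1000)" using KKbig by (intro power9_le_exp) simp
  have KKpow: "KK ^ m \<le> KK ^ 9" if "m \<le> 9" for m using that KKbig by (intro power_increasing) auto
  have Lam1: "2 * l * real (2 * r3) * \<bar>Lam\<bar> \<le> 1 / 8 ^ n1"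
  proof -
    have "2 * l * real (2 * r3) \<le> KK * KK"
      using KKl' l r3(1) a3u KKbig by (intro mult_mono) auto
    also have "\<dots> \<le> exp (KK / 1000)" using KKpow[of 2] E9 by (simp add: power2_eq_square)
    finally have "2 * l * real (2 * r3) * \<bar>Lam\<bar> \<le> exp (KK / 1000) * exp (- T)"
      using Lam by (intro mult_mono) auto
    also have "\<dots> = exp (KK / 1000 - T)" by (simp flip: exp_add)
    also have "\<dots> \<le> exp (- (real n1 * ln 8))"
    proof -
      have "real n1 * ln 8 \<le> KK * l / 4 * (20796 / 10000)"
        unfolding n1(1) using ln_8_bounds(2) KKbig l by (intro mult_left_mono) auto
      moreover have "KK * (l / 4 * (20796 / 10000) + 1 / 1000) \<le> (6700000 * M + 4) * (l / 4 * (20796 / 10000) + 1 / 1000)"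
        using KK l by (intro mult_right_mono) auto
      moreover have "(6700000 * M + 4) * (l / 4 * (20796 / 10000) + 1 / 1000) \<le> T"
      proof -
        have "200 * M \<le> l * M" "200 * 13860 \<le> l * M" "l * 13860 \<le> l * M"
          using l M0 by (intro mult_right_mono, simp, simp, intro mult_mono, simp, simp, simp, simp, intro mult_left_mono, simp, simp)
        moreover have "(6700000 * M + 4) * (l / 4 * (20796 / 10000) + 1 / 1000) =
          3483330 * (l * M) + 6700 * M + 20796 / 10000 * l + 1 / 250" by (simp add: field_simps)
        moreover have "T = 3500000 * (l * M)" by (simp add: T_def)
        ultimately show ?thesis by linarith
      qed
      ultimately show ?thesis by (simp add: algebra_simps)
    qed
    also have "\<dots> = 1 / 8 ^ n1" by (simp add: exp_minus exp_of_nat_mult field_simps)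
    finally show ?thesis .
  qed
  have p8: "1 / 8 ^ n1 \<le> (1 :: real)" by simp
  have Lam2: "l * real (2 * r3) * \<bar>Lam\<bar> \<le> 1" 
  proof -
    have "2 * l * real (2 * r3) * \<bar>Lam\<bar> = 2 * (l * real (2 * r3) * \<bar>Lam\<bar>)" by simp
    moreover have "0 \<le> l * real (2 * r3) * \<bar>Lam\<bar>" using l by simp
    ultimately show ?thesis using Lam1 p8 by linarith
  qed
  have Lam3: "real (2 * r3) * \<bar>Lam\<bar> \<le> 1"
  proof -
    have "1 * (real (2 * r3) * \<bar>Lam\<bar>) \<le> l * (real (2 * r3) * \<bar>Lam\<bar>)" using l by (intro mult_right_mono) auto
    then show ?thesis using Lam2 by (simp add: mult.assoc)
  qed
  define hi where "hi = real (2 * r1 + L) * la + real (2 * r2) * G0 + real (2 * r3) * max th 0"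
  define lo where "lo = real (2 * r3) * min th 0"
  define lr where "lr = (hi - lo) / 2"
  define l0 where "l0 = (hi + lo) / 2"
  have th: "th = ln c + Lam" by (simp add: th_def Lam_def)
  have r3th: "real (2 * r3) * \<bar>th\<bar> \<le> KK / 120 + 1"
  proof -
    have "real (2 * r3) * \<bar>th\<bar> \<le> real (2 * r3) * (h + \<bar>Lam\<bar>)"
      using th abslc by (intro mult_left_mono) auto
    then show ?thesis using s3 Lam3 by (simp add: distrib_left)
  qed
  have hi: "hi \<le> KK / 40 + 1" "0 \<le> hi"
  proof -
    have "real (2 * r3) * max th 0 \<le> real (2 * r3) * \<bar>th\<bar>" by (intro mult_left_mono) auto
    then show "hi \<le> KK / 40 + 1" using s1 s2 r3th unfolding hi_def by linarith
    show "0 \<le> hi" unfolding hi_def using hpos by simp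
  qed
  have lr: "lr \<le> KK / 80 + 1 / 2"
  proof -
    have "real (2 * r3) * max th 0 - real (2 * r3) * min th 0 = real (2 * r3) * \<bar>th\<bar>"
      by (simp add: max_def min_def)
    then have "lr = (real (2 * r1 + L) * la + real (2 * r2) * G0 + real (2 * r3) * \<bar>th\<bar>) / 2"
      unfolding lr_def hi_def lo_def by (simp only: add_diff_eq[symmetric])
    then have "lr = real (2 * r1 + L) * la / 2 + real (2 * r2) * G0 / 2 + real (2 * r3) * \<bar>th\<bar> / 2"
      by (simp only: add_divide_distrib)
    moreover have "real (2 * r1 + L) * la / 2 \<le> KK / 120 / 2" "real (2 * r2) * G0 / 2 \<le> KK / 120 / 2"
      "real (2 * r3) * \<bar>th\<bar> / 2 \<le> (KK / 120 + 1) / 2"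
      by (intro divide_right_mono s1 s2 r3th; simp)+
    ultimately show ?thesis by (simp only: add_divide_distrib)
  qed
  have lo: "lo \<le> 0" by (simp add: lo_def mult_nonneg_nonpos)
  have l0: "\<bar>l0\<bar> \<le> lr" using hi lo by (simp add: l0_def lr_def)
  define Q where "Q = KK * q"
  have q: "real k * real (2 * r3) \<le> Q"
  proof -
    have "real k * real (2 * r3) \<le> real k * (2 * a3)" using r3(1) by (intro mult_left_mono) auto
    also have "\<dots> = Q" using hpos by (simp add: a3_def q_def Q_def)
    finally show ?thesis .
  qed
  have q0: "q \<ge> 0" using hpos by (simp add: q_def)
  define Xs where "Xs = KK * exp b"
  have Xs: "Q + 12 / 10 * KK \<le> Xs"
  proof -
    have "KK * (q + 12 / 10) \<le> KK * exp b"
      using kh KKbig by (intro mult_left_mono) (auto simp: q_def b_def l_def)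
    then show ?thesis by (simp add: Xs_def Q_def algebra_simps)
  qed
  have Kq: "Q \<ge> 0" using q0 KKbig by (simp add: Q_def)
  define U1 where "U1 = real (2 * r1 + L + k * (2 * r3))"
  have U1: "U1 \<le> 174 / 10000 * KK + Q"
  proof -
    have "U1 = real (2 * r1 + L) + real k * real (2 * r3)" by (simp add: U1_def)
    moreover have "real (2 * r1 + L) \<le> 2 * a1" using r1(1) by (simp add: l_def)
    ultimately show ?thesis using q a1u by linarith
  qed
  have Xs1: "U1 + real K \<le> Xs" using U1 Xs KKbig unfolding KK_def[symmetric] by linarith
  have Xs2: "(la * U1 + 8 * lr + \<bar>l0\<bar>) / G0 + real K \<le> Xs"
  proof -
    have "la * U1 \<le> 4813 / 10000 * U1" using la by (intro mult_right_mono) (auto simp: U1_def)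
    then have "la * U1 + 8 * lr + \<bar>l0\<bar> \<le> 2 / 100 * KK + 4813 / 10000 * Q + 9 / 80 * KK + 9 / 2"
      using U1 lr l0 KKbig by linarith
    also have "\<dots> \<le> 693 / 1000 * (2 / 10 * KK + Q)"
      using KKbig Kq unfolding distrib_left by linarith
    also have "\<dots> \<le> G0 * (2 / 10 * KK + Q)" using G0 KKbig Kq by (intro mult_right_mono) auto
    finally have "(la * U1 + 8 * lr + \<bar>l0\<bar>) / G0 \<le> 2 / 10 * KK + Q"
      using hpos by (simp add: divide_le_eq mult.commute)
    then show ?thesis using Xs unfolding KK_def[symmetric] by linarith
  qed
  define Xl where "Xl = 9 / 2 * Xs"
  have Xl: "9 * x + KK \<le> Xl" if "x \<le> 3 / 100 * KK + Q / 2" for x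
    using that Xs KKbig unfolding Xl_def by linarith
  have Xl1: "9 * real (r1 + k * r3) + real K \<le> Xl"
  proof -
    have "real (r1 + k * r3) = real r1 + (real k * real (2 * r3)) / 2" by simp
    also have "\<dots> \<le> 3 / 100 * KK + Q / 2"
      using q r1(1) a1u l KKbig by (intro add_mono divide_right_mono) auto
    finally show ?thesis unfolding KK_def[symmetric] by (rule Xl)
  qed
  have Xl2: "9 * real (r2 + N * r3) + real K \<le> Xl"
  proof -
    have "real N * G0 \<le> 4813 / 10000 * real k + (h + 1)"
    proof -
      have "real N * G0 = real k * la - ln c - Lam" by (simp add: Lam_def)
      moreover have "\<bar>Lam\<bar> \<le> 1"
      proof -
        have "T \<ge> 0" using M0 l by (simp add: T_def)
        then have "exp (- T) \<le> 1" by simp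
        then show ?thesis using Lam by linarith
      qed
      moreover have "real k * la \<le> real k * (4813 / 10000)" using la by (intro mult_left_mono) auto
      ultimately show ?thesis using abslc by linarith
    qed
    moreover have "real N * (693 / 1000) \<le> real N * G0" using G0 by (intro mult_left_mono) auto
    \<comment> \<open>\<open>N\<close> is roughly k ln phi / ln g, and 0.4813 / 0.693 <
      0.695.\<close>
    ultimately have N: "real N \<le> 695 / 1000 * real k + 1444 / 1000 * (h + 1)" using h(1) unfolding distrib_left by linarith
    have "real N * real (2 * r3) \<le> (695 / 1000 * real k + 1444 / 1000 * (h + 1)) * real (2 * r3)"
      using N by (intro mult_right_mono) auto
    also have "\<dots> = 695 / 1000 * (real k * real (2 * r3)) + 1444 / 1000 * (real (2 * r3) * h) + 1444 / 1000 * real (2 * r3)"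
      by (simp add: algebra_simps)
    also have "\<dots> \<le> 695 / 1000 * (Q) + 1444 / 1000 * (KK / 120) + 1444 / 1000 * (KK / 60)"
      using q s3 r3(1) a3u by (intro add_mono mult_left_mono) auto
    finally have "real N * real (2 * r3) \<le> 695 / 1000 * (Q) + 4 / 100 * KK" using KKbig by linarith
    then have "real r2 + (real N * real (2 * r3)) / 2 \<le> 61 / 10000 * KK + (695 / 1000 * Q + 4 / 100 * KK) / 2"
      using r2(1) a2u by (intro add_mono divide_right_mono) auto
    moreover have "real (r2 + N * r3) = real r2 + (real N * real (2 * r3)) / 2" by simp
    ultimately have "real (r2 + N * r3) \<le> 61 / 10000 * KK + (695 / 1000 * Q + 4 / 100 * KK) / 2" by simp
    also have "\<dots> \<le> 3 / 100 * KK + Q / 2" using KKbig Kq unfolding add_divide_distrib by linarith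
    finally show ?thesis unfolding KK_def[symmetric] by (rule Xl)
  qed
  define y where "y = 2 / 3 * real K * b + 2 * real K + real K * real L * ln 8 / 16 + 1"
  define G where "G = exp (l * (hi + 7 * lr))"
  have b0: "b \<ge> 0" using l by (simp add: b_def)
  have K1: "K \<ge> 1" "K = 2 * (2 * K4)" using KKbig by (auto simp: KK_def K_def)
  have sb: "8 ^ (K * (n1 * (n1 + 1) div 2)) <
      (\<Prod>(a, b)\<in>{(a, b). a + b < K}. exp y / (Xs ^ a / fact a * (Xs ^ b / fact b))) ^ L"
    using K1 nat n1 b0 by (intro siegel_box_numeric[where b = b]) (auto simp: Xs_def KK_def y_def)
  have sl: "8 ^ (n1 * (n1 + 1) div 2) < (\<Prod>i<2 * K4. exp y / (Xl ^ i / fact i)) ^ L"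
    using K1 nat n1 b0 by (intro siegel_line_numeric[where K = K and b = b]) (auto simp: Xl_def Xs_def KK_def y_def)
  have fin: "real v ^ (2 * (L * (2 * r3))) * (real (K * K) * real L)\<^sup>2 * (exp y)\<^sup>2 * G *
      (real g ^ (2 * r2) * max 1 c ^ (2 * r3)) ^ L *
      ((real K * real n1 + 1) / 8 ^ n1 + 2 * real L * real (2 * r3) * \<bar>Lam\<bar>) < 1"
  proof -
    let ?S = "2 * (l * real (2 * r3)) * ln (real v) + l * (real (2 * r2) * G0 + real (2 * r3) * lc)"
    have e1: "real v ^ (2 * (L * (2 * r3))) = exp (2 * (l * real (2 * r3)) * ln (real v))"
    proof -
      have "exp (real (2 * (L * (2 * r3))) * ln (real v)) = real v ^ (2 * (L * (2 * r3)))"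
        unfolding exp_of_nat_mult using nat by simp
      then show ?thesis by (simp add: l_def)
    qed
    have mc: "max 1 c = exp lc" using c by (simp add: lc_def max_def)
    have e2: "(real g ^ (2 * r2) * max 1 c ^ (2 * r3)) ^ L = exp (l * (real (2 * r2) * G0 + real (2 * r3) * lc))"
    proof -
      have "exp (real (2 * r2) * G0) = real g ^ (2 * r2)" unfolding exp_of_nat_mult G0_def using nat by simp
      moreover have "exp (real (2 * r3) * lc) = max 1 c ^ (2 * r3)" unfolding exp_of_nat_mult mc ..
      ultimately show ?thesis by (simp only: l_def exp_of_nat_mult exp_add)
    qed
    have e3: "(real (K * K) * real L)\<^sup>2 * (KK * real n1 + 2) \<le> KK ^ 9"
    proof -
      have lK: "l \<le> KK" using KKl' l by linarith
      have "(real (K * K) * real L)\<^sup>2 \<le> (KK * KK * KK)\<^sup>2"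
        using lK l by (intro power_mono mult_left_mono) (auto simp: KK_def l_def)
      moreover have "KK * real n1 + 2 \<le> KK ^ 3"
      proof -
        have "KK * real n1 + 2 = KK * (KK * l / 4) + 2" using n1 by simp
        also have "\<dots> \<le> KK * (KK * KK / 4) + KK * (KK * KK / 4)"
        proof (intro add_mono)
          show "KK * (KK * l / 4) \<le> KK * (KK * KK / 4)" using lK KKbig by (intro mult_left_mono divide_right_mono) auto
          have "2 * (2 * 2) \<le> KK * (KK * KK)" using KKbig by (intro mult_mono) auto
          then show "2 \<le> KK * (KK * KK / 4)" by simp
        qed
        also have "\<dots> \<le> KK ^ 3" using KKbig by (simp add: power3_eq_cube)
        finally show ?thesis .
      qed
      ultimately have "(real (K * K) * real L)\<^sup>2 * (KK * real n1 + 2) \<le> (KK * KK * KK)\<^sup>2 * KK ^ 3"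
        using KKbig by (intro mult_mono) auto
      also have "\<dots> = KK ^ 9" by (simp add: power2_eq_square eval_nat_numeral)
      finally show ?thesis .
    qed
    have e4: "(real K * real n1 + 1) / 8 ^ n1 + 2 * real L * real (2 * r3) * \<bar>Lam\<bar> \<le> (KK * real n1 + 2) * exp (- (real n1 * ln 8))"
    proof -
      have e: "exp (- (real n1 * ln 8)) = 1 / 8 ^ n1" by (simp add: exp_minus exp_of_nat_mult field_simps)
      have "(KK * real n1 + 2) / 8 ^ n1 = (KK * real n1 + 1) / 8 ^ n1 + 1 / 8 ^ n1"
        by (simp add: add_divide_distrib[symmetric])
      then show ?thesis using Lam1 unfolding e KK_def[symmetric] l_def[symmetric] by simp
    qed
    have e5: "(exp y)\<^sup>2 = exp (2 * y)" by (simp add: exp_double)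
    have e6: "exp (?S + 2 * y + l * (hi + 7 * lr) - real n1 * ln 8) =
      exp (2 * (l * real (2 * r3)) * ln (real v)) * exp (l * (real (2 * r2) * G0 + real (2 * r3) * lc)) *
      exp (2 * y) * exp (l * (hi + 7 * lr)) * exp (- (real n1 * ln 8))"
      by (simp only: exp_add diff_conv_add_uminus)
    have "real v ^ (2 * (L * (2 * r3))) * (real (K * K) * real L)\<^sup>2 * (exp y)\<^sup>2 * G *
      (real g ^ (2 * r2) * max 1 c ^ (2 * r3)) ^ L *
      ((real K * real n1 + 1) / 8 ^ n1 + 2 * real L * real (2 * r3) * \<bar>Lam\<bar>) \<le>
      real v ^ (2 * (L * (2 * r3))) * (real (K * K) * real L)\<^sup>2 * (exp y)\<^sup>2 * G *
      (real g ^ (2 * r2) * max 1 c ^ (2 * r3)) ^ L * ((KK * real n1 + 2) * exp (- (real n1 * ln 8)))"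
      by (rule mult_left_mono[OF e4]) (use c in \<open>simp add: G_def\<close>)
    also have "\<dots> = ((real (K * K) * real L)\<^sup>2 * (KK * real n1 + 2)) *
      exp (?S + 2 * y + l * (hi + 7 * lr) - real n1 * ln 8)"
      unfolding e1 e2 e5 e6 G_def by (simp only: mult_ac)
    also have "\<dots> \<le> exp (KK / 1000) * exp (?S + 2 * y + l * (hi + 7 * lr) - real n1 * ln 8)"
      using e3 E9 by (intro mult_right_mono) auto
    also have "\<dots> = exp (KK / 1000 + (?S + 2 * y + l * (hi + 7 * lr) - real n1 * ln 8))"
      by (simp add: exp_add)
    also have "\<dots> < 1"
    proof -
      have S: "?S \<le> l * (KK / 60)"
      proof -
        have "?S = l * (real (2 * r3) * (2 * ln (real v) + lc) + real (2 * r2) * G0)" by (simp add: algebra_simps)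
        also have "\<dots> \<le> l * (real (2 * r3) * h + real (2 * r2) * G0)"
          using hlc l by (intro mult_left_mono add_right_mono) auto
        also have "\<dots> \<le> l * (KK / 60)" using s2 s3 l by (intro mult_left_mono) auto
        finally show ?thesis .
      qed
      have H: "l * (hi + 7 * lr) \<le> l * (KK * (9 / 80) + 9 / 2)"
        using hi lr l by (intro mult_left_mono) auto
      have Y: "2 * y = 4 / 3 * KK * b + 4 * KK + KK * l * ln 8 / 8 + 2" by (simp add: y_def KK_def l_def)
      have "KK * l / 8 * (2079 / 1000) \<le> KK * l / 8 * ln 8"
        using ln_8_bounds(1) KKbig l by (intro mult_left_mono) auto
      then have B: "KK * l * ln 8 / 8 - real n1 * ln 8 \<le> - (KK * l / 8 * (2079 / 1000))"
        unfolding n1(1) by (simp add: field_simps)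
      have Kb: "4 / 3 * KK * b = 4 / 3 * (98 / 1000) * (KK * l) - 4 / 3 * (31 / 10) * KK"
        by (simp add: b_def algebra_simps)
      have Kl: "KK * l \<ge> 0" using KKbig l by simp
      \<comment> \<open>The decisive balance. Per unit of KK l the losses are 1/60 from
        denominators, g and c, 4/3 * 98/1000 from Y^2, and 9/80 from G; the gain left after the
        Siegel share is ln 8 / 8 >= 2079/8000, which just exceeds their sum. Among the multiples of
        KK, 4/3 * 31/10 beats 4 + 1/1000 and leaves room for the remaining terms.\<close>
      have "KK / 1000 + (?S + 2 * y + l * (hi + 7 * lr) - real n1 * ln 8) \<le>
        KK / 1000 + (KK * l) / 60 + (4 / 3 * (98 / 1000) * (KK * l) - 4 / 3 * (31 / 10) * KK + 4 * KK + 2) +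
        ((KK * l) * (9 / 80) + 9 / 2 * l) - (KK * l) / 8 * (2079 / 1000)"
        using S H B unfolding Y Kb by (simp add: algebra_simps)
      also have "\<dots> < 0" using Kl KKl' KKbig l by linarith
      finally show ?thesis by simp
    qed
    finally show ?thesis .
  qed
  have "log_form g k N u v L K (2 * K4) r1 r2 r3 n1 (exp y) G Xs Xl"
    unfolding log_form_def
    unfolding c_def[symmetric] la_def[symmetric] G0_def[symmetric]
    unfolding Lam_def[symmetric]
    unfolding th_def[symmetric]
    unfolding hi_def[symmetric] lo_def[symmetric]
    unfolding lr_def[symmetric] l0_def[symmetric]
  proof (intro conjI)
    show "r1 \<le> k"
    proof -
      have "KK \<le> T" 
        using KK M0 mult_right_mono[of 200 l M] l unfolding T_def by linarith
      then have "real r1 \<le> real k" using r1(1) a1u kT KKbig l by linarith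
      then show ?thesis by simp
    qed
    show "r2 \<le> K - 1" "r3 \<le> K - 1"
      using r2(1) r3(1) a2u a3u KKbig unfolding KK_def by linarith+
    show "exp (real L * (hi + 7 * lr)) \<le> G" by (simp add: G_def l_def)
    show "2 \<le> K" "1 \<le> 2 * K4" "2 * K4 \<le> K" using KKbig unfolding KK_def K_def by linarith+
    show "real L * real (2 * r3) * \<bar>Lam\<bar> \<le> 1" using Lam2 by (simp add: l_def)
    show "1 \<le> L" using nat by linarith
  qed (use nat box Xs1 Xs2 Xl1 Xl2 sb sl fin in \<open>simp_all only: U1_def exp_gt_zero\<close>)
  then show False by (rule log_form.contradiction)
qed

section \<open>Products of three repdigits\<close>

lemma lucas_closed_form: "real (lucas k) = gold ^ k + gold' ^ k"
proof (induction k rule: lucas.induct)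
  case (3 n)
  then show ?case using gold_squares by (simp add: algebra_simps mult.assoc[symmetric])
qed (use gold_add_gold' in auto)

lemma ln_one_plus_bound:
  fixes x :: real
  assumes "\<bar>x\<bar> \<le> d" "d < 1"
  shows "\<bar>ln (1 + x)\<bar> \<le> \<bar>x\<bar> / (1 - d)"
proof -
  have x: "1 + x > 0" using assms by linarith
  have 1: "ln (1 + x) \<le> \<bar>x\<bar> / (1 - d)"
  proof -
    have "ln (1 + x) \<le> x" by (rule ln_add_one_self_le_self2) (use assms in linarith)
    also have "x \<le> \<bar>x\<bar> / 1" by simp
    also have "\<dots> \<le> \<bar>x\<bar> / (1 - d)" using assms by (intro divide_left_mono) auto
    finally show ?thesis .
  qed
  have "- ln (1 + x) = ln (1 / (1 + x))" using x by (simp add: ln_div)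
  also have "\<dots> \<le> 1 / (1 + x) - 1" using x by (intro ln_le_minus_one) simp
  also have "\<dots> = - x / (1 + x)" using x by (simp add: field_simps)
  also have "\<dots> \<le> \<bar>x\<bar> / (1 - d)" using assms by (intro frac_le) auto
  finally show ?thesis using 1 by linarith
qed

text \<open>lucas k / gold^k = 1 + x with |x| = gold^(-2k) <= gold^(-2) < 0.382, and 1 / (1 - 0.382)
  < 1.62.\<close>

lemma ln_lucas_approx:
  assumes "k \<ge> 1"
  shows "\<bar>real k * ln gold - ln (real (lucas k))\<bar> \<le> 162 / 100 / gold ^ (2 * k)"
    and "real (lucas k) \<le> 1382 / 1000 * gold ^ k"
    and "gold ^ k \<le> 162 / 100 * real (lucas k)"
    and "real (lucas k) > 0"
proof -
  define x where "x = gold' ^ k / gold ^ k"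
  have g: "gold > 0" using gold_bounds by linarith
  have gk: "gold ^ k > 0" using g by simp
  have L: "real (lucas k) = gold ^ k * (1 + x)"
    using g by (simp add: lucas_closed_form x_def distrib_left)
  have "\<bar>gold'\<bar> * gold = 1" using gold_mult_gold' gold'_bounds by (simp add: mult.commute)
  then have "\<bar>gold'\<bar> = 1 / gold" using g by (simp add: field_simps)
  then have x: "\<bar>x\<bar> = 1 / gold ^ (2 * k)"
    using g by (simp add: x_def abs_mult power_abs power_mult power2_eq_square power_mult_distrib power_one_over)
  have "gold ^ 2 \<ge> 2618 / 1000" using gold_squares gold_bounds by (simp add: power2_eq_square)
  moreover have "gold ^ 2 \<le> gold ^ (2 * k)" using assms gold_bounds by (intro power_increasing) auto
  ultimately have p: "gold ^ (2 * k) \<ge> 2618 / 1000" by linarith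
  then have xb: "\<bar>x\<bar> \<le> 382 / 1000" unfolding x by (simp add: divide_le_eq)
  have "\<bar>ln (1 + x)\<bar> \<le> \<bar>x\<bar> / (1 - 382 / 1000)" using xb by (intro ln_one_plus_bound) auto
  also have "\<dots> \<le> 162 / 100 * \<bar>x\<bar>" by simp
  finally have "\<bar>ln (1 + x)\<bar> \<le> 162 / 100 / gold ^ (2 * k)" unfolding x by simp
  moreover have "ln (real (lucas k)) = real k * ln gold + ln (1 + x)"
    unfolding L using g gk xb by (subst ln_mult) (auto simp: ln_realpow)
  ultimately show "\<bar>real k * ln gold - ln (real (lucas k))\<bar> \<le> 162 / 100 / gold ^ (2 * k)" by simp
  have "gold ^ k * (1 + x) \<le> gold ^ k * (1382 / 1000)" using gk xb by (intro mult_left_mono) auto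
  then show "real (lucas k) \<le> 1382 / 1000 * gold ^ k" unfolding L by simp
  have "gold ^ k * 1 \<le> gold ^ k * (162 / 100 * (1 + x))" using gk xb by (intro mult_left_mono) auto
  then show "gold ^ k \<le> 162 / 100 * real (lucas k)" unfolding L by (simp only: mult.left_commute mult_1_right)
  show "real (lucas k) > 0" unfolding L using gk xb by (intro mult_pos_pos) auto
qed

lemma real_repdigit:
  assumes "g \<ge> 2"
  shows "real (repdigit g d m) = real d * ((real g ^ m - 1) / (real g - 1))"
proof -
  have "int g - 1 dvd int g ^ m - 1" by (simp add: power_diff_1_eq)
  then have "int (g - 1) dvd int (g ^ m - 1)" using assms by (simp add: of_nat_diff)
  then have "g - 1 dvd g ^ m - 1" by (simp only: int_dvd_int_iff)
  then have "real ((g ^ m - 1) div (g - 1)) = real (g ^ m - 1) / real (g - 1)" by (rule real_of_nat_div)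
  then show ?thesis using assms by (simp add: repdigit_def of_nat_diff)
qed

lemma repdigit_bounds:
  assumes "g \<ge> 2" "1 \<le> d" "d \<le> g - 1" "m \<ge> 1"
  shows "real g ^ (m - 1) \<le> real (repdigit g d m)" "real (repdigit g d m) \<le> real g ^ m"
proof -
  have g: "real g - 1 > 0" "real g \<ge> 2" using assms by auto
  have p: "real g ^ m - 1 \<ge> 0" using g by simp
  have "real g ^ (m - 1) * (real g - 1) \<le> real g ^ m - 1"
  proof -
    have "real g ^ m = real g ^ (m - 1) * real g" using assms(4) by (subst power_minus_mult) auto
    moreover have "1 \<le> real g ^ (m - 1)" using g by simp
    ultimately show ?thesis by (simp add: algebra_simps)
  qed
  then have "real g ^ (m - 1) \<le> (real g ^ m - 1) / (real g - 1)" using g by (simp add: le_divide_eq)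
  also have "\<dots> \<le> real d * ((real g ^ m - 1) / (real g - 1))"
    using assms(2) g p mult_right_mono[of 1 "real d" "(real g ^ m - 1) / (real g - 1)"] by simp
  finally show "real g ^ (m - 1) \<le> real (repdigit g d m)" by (simp add: real_repdigit[OF assms(1)])
  have "real d \<le> real g - 1" using assms by linarith
  then have "real d * ((real g ^ m - 1) / (real g - 1)) \<le> (real g - 1) * ((real g ^ m - 1) / (real g - 1))"
    using g p by (intro mult_right_mono) auto
  also have "\<dots> \<le> real g ^ m" using g by simp
  finally show "real (repdigit g d m) \<le> real g ^ m" by (simp add: real_repdigit[OF assms(1)])
qed

text \<open>L is about L0 - 1 + 62 ln z. As 0.098 * 62 > 6, the exponential gains z^6; as 62 <= L0 /
  3, L is at most L0 (1 + ln z / 3), whose cube is at most L0^3 z. The 1 in L0 - 1 allows for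
  rounding up.\<close>

lemma choose_L:
  fixes z w w0 L0 :: real
  assumes z: "z \<ge> 1" and w: "w \<le> w0 * z ^ 6" and w0: "w0 \<le> exp (98 / 1000 * (L0 - 1) - 31 / 10)"
    and L0: "L0 \<ge> 201"
  obtains L :: nat where "L \<ge> 200" "w \<le> exp (98 / 1000 * real L - 31 / 10)" "real L ^ 3 \<le> L0 ^ 3 * z"
proof -
  define y where "y = L0 - 1 + 62 * ln z"
  define L where "L = nat \<lceil>y\<rceil>"
  have lz: "ln z \<ge> 0" using z by simp
  have y: "y \<ge> 200" using lz L0 by (simp add: y_def)
  then have L: "y \<le> real L" "real L \<le> y + 1" unfolding L_def by linarith+
  have "w \<le> exp (98 / 1000 * (L0 - 1) - 31 / 10) * z ^ 6"
    by (rule order.trans[OF w mult_right_mono[OF w0]]) (use z in simp)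
  also have "z ^ 6 = exp (6 * ln z)" using z exp_of_nat_mult[of 6 "ln z"] by simp
  also have "exp (98 / 1000 * (L0 - 1) - 31 / 10) * exp (6 * ln z) = exp (98 / 1000 * (L0 - 1) - 31 / 10 + 6 * ln z)"
    by (simp only: exp_add)
  also have "\<dots> \<le> exp (98 / 1000 * real L - 31 / 10)"
  proof -
    have "98 / 1000 * (L0 - 1) - 31 / 10 + 6 * ln z \<le> 98 / 1000 * y - 31 / 10"
      using lz by (simp add: y_def field_simps)
    also have "\<dots> \<le> 98 / 1000 * real L - 31 / 10" using L by simp
    finally show ?thesis by simp
  qed
  finally have 1: "w \<le> exp (98 / 1000 * real L - 31 / 10)" .
  have "real L \<le> L0 + 62 * ln z" using L by (simp add: y_def)
  also have "\<dots> \<le> L0 * (1 + ln z / 3)"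
    using mult_right_mono[of 201 L0 "ln z"] L0 lz by (simp add: distrib_left)
  also have "\<dots> \<le> L0 * exp (ln z / 3)" using L0 by (intro mult_left_mono) (auto intro: exp_ge_add_one_self)
  finally have "real L ^ 3 \<le> (L0 * exp (ln z / 3)) ^ 3" by (intro power_mono) auto
  also have "\<dots> = L0 ^ 3 * z" using z exp_of_nat_mult[of 3 "ln z / 3"] by (simp add: power_mult_distrib)
  finally have 2: "real L ^ 3 \<le> L0 ^ 3 * z" .
  have "L \<ge> 200" using y L by linarith
  then show ?thesis using 1 2 that by blast
qed

lemma exp_1_power_ge: "(27 / 10) ^ n \<le> exp x" if "real n \<le> x"
proof -
  have "(27 / 10 :: real) \<le> (\<Sum>n<6. 1 ^ n / fact n)" by (simp add: eval_nat_numeral fact_numeral)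
  also have "\<dots> \<le> exp 1" by (rule exp_taylor_bounds) simp
  finally have "(27 / 10 :: real) ^ n \<le> exp 1 ^ n" by (intro power_mono) auto
  also have "\<dots> = exp (real n)" using exp_of_nat_mult[of n "1 :: real"] by simp
  also have "\<dots> \<le> exp x" using that by simp
  finally show ?thesis .
qed

section \<open>The three linear forms attached to a solution\<close>

locale lucas_product =
  fixes g k d1 d2 d3 l m n :: nat
  assumes g: "g \<ge> 2" and pos: "k \<ge> 1" "l \<ge> 1" "m \<ge> 1"
    and d: "1 \<le> d1" "d1 \<le> g - 1" "1 \<le> d2" "d2 \<le> g - 1" "1 \<le> d3" "d3 \<le> g - 1"
    and le: "l \<le> m" "m \<le> n"
    and eq: "lucas k = repdigit g d1 l * repdigit g d2 m * repdigit g d3 n"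
begin

abbreviation G where "G \<equiv> ln (real g)"

lemma G: "G \<ge> 693 / 1000"
proof -
  have "ln 2 \<le> G" using g by simp
  then show ?thesis using ln_2_ge by linarith
qed

lemma lucas_bounds: "real g ^ (n - 1) \<le> real (lucas k)" "real (lucas k) \<le> real g ^ (3 * n)"
proof -
  have n: "n \<ge> 1" using pos le by linarith
  have g1: "real g \<ge> 1" using g by simp
  note r = repdigit_bounds[OF g d(1,2) pos(2)] repdigit_bounds[OF g d(3,4) pos(3)] repdigit_bounds[OF g d(5,6) n]
  have "1 \<le> real g ^ (l - 1)" "1 \<le> real g ^ (m - 1)" using g1 by simp_all
  then have one: "1 \<le> real (repdigit g d1 l)" "1 \<le> real (repdigit g d2 m)" using r(1,3) by linarith+
  have "1 * 1 * real g ^ (n - 1) \<le> real (repdigit g d1 l) * real (repdigit g d2 m) * real (repdigit g d3 n)"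
    by (intro mult_mono one r) simp_all
  then show "real g ^ (n - 1) \<le> real (lucas k)" by (simp add: eq)
  have "real (repdigit g d1 l) * real (repdigit g d2 m) * real (repdigit g d3 n) \<le> real g ^ l * real g ^ m * real g ^ n"
    by (intro mult_mono r) simp_all
  also have "\<dots> = real g ^ (l + m + n)" by (simp add: power_add)
  also have "\<dots> \<le> real g ^ (3 * n)" using g1 le by (intro power_increasing) auto
  finally show "real (lucas k) \<le> real g ^ (3 * n)" by (simp add: eq)
qed

text \<open>Logarithms of \<open>lucas_bounds\<close>: 625/100 is 3 / 0.48 with 0.48 <= ln phi, and
  exp (7/10) covers the constants 1.62 and 1.382.\<close>

lemma k_bounds: "real k \<le> 625 / 100 * (real n * G) + 21 / 10" "(real n - 1) * G \<le> 4813 / 10000 * real k + 7 / 10"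
proof -
  have g0: "real g > 0" using g by simp
  have gold: "gold > 0" using gold_bounds by linarith
  have n: "n \<ge> 1" using pos le by linarith
  note L = ln_lucas_approx(2-4)[OF pos(1)]
  have e: "162 / 100 \<le> exp (7 / 10 :: real)" "1382 / 1000 \<le> exp (7 / 10 :: real)"
    using exp_ge_add_one_self[of "7 / 10 :: real"] by linarith+
  have "gold ^ k \<le> exp (7 / 10) * real g ^ (3 * n)"
    using L(2) lucas_bounds(2) e(1) by (intro order.trans[OF L(2)] mult_mono) auto
  then have "ln (gold ^ k) \<le> ln (exp (7 / 10) * real g ^ (3 * n))" using gold g0 by simp
  then have 1: "real k * ln gold \<le> 7 / 10 + 3 * (real n * G)" using gold g0 by (simp add: ln_realpow ln_mult)
  have "real k * (48 / 100) \<le> real k * ln gold" using ln_gold_bounds by (intro mult_left_mono) auto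
  moreover have nG: "real n * G \<ge> 0" using G by simp
  ultimately show "real k \<le> 625 / 100 * (real n * G) + 21 / 10" using 1 by linarith
  have "real g ^ (n - 1) \<le> exp (7 / 10) * gold ^ k"
    by (rule order.trans[OF lucas_bounds(1) order.trans[OF L(1) mult_right_mono[OF e(2)]]]) (use gold in simp)
  then have "ln (real g ^ (n - 1)) \<le> ln (exp (7 / 10) * gold ^ k)" using gold g0 by simp
  then have "(real n - 1) * G \<le> 7 / 10 + real k * ln gold" using gold g0 n by (simp add: ln_realpow ln_mult of_nat_diff)
  moreover have "real k * ln gold \<le> real k * (4813 / 10000)" using ln_gold_bounds by (intro mult_left_mono) auto
  ultimately show "(real n - 1) * G \<le> 4813 / 10000 * real k + 7 / 10" by linarith
qed

text \<open>If s were larger, the form, at most 10 g^(-s), would fall below exp (-T), the threshold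
  for height H ln g. The summand 34/10 absorbs the factor 10, since 3.4 * 0.693 > 2.35 >= ln
  10.\<close>

lemma linear_form_estimate:
  fixes u v N s L :: nat and H :: real
  assumes n: "n \<ge> 2" and uv: "u \<ge> 1" "v \<ge> 1" and s: "s \<le> n" and H: "H \<ge> 6"
    "2 * ln (real v) + max 0 (ln (real u / real v)) \<le> H * G"
    and approx: "\<bar>ln (real (lucas k)) - real N * G - ln (real u / real v)\<bar> \<le> 6 / real g ^ s"
    and L: "L \<ge> 200" "521 / 10000 * (real n / H) + 121 / 100 \<le> exp (98 / 1000 * real L - 31 / 10)"
  shows "real s \<le> 3500000 * real L ^ 3 * G * H + 34 / 10"
proof (rule ccontr)
  assume "\<not> ?thesis"
  then have neg: "3500000 * real L ^ 3 * G * H + 34 / 10 < real s" by simp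
  define T where "T = 3500000 * real L ^ 3 * G * (H * G)"
  have g1: "real g \<ge> 1" using g by simp
  have HG: "H * G \<ge> 4" using mult_mono[of 6 H "693 / 1000" G] H(1) G by simp
  have T0: "T \<ge> 0" using HG G by (simp add: T_def)
  have "(3500000 * real L ^ 3 * G * H + 34 / 10) * G < real s * G" using neg G by (intro mult_strict_right_mono) auto
  then have neg': "T + 34 / 10 * G < real s * G" by (simp add: T_def algebra_simps)
  \<comment> \<open>Otherwise (n - 1) G <= 0.4813 k + 0.7 would be too small for n >= s.\<close>
  have kT: "T \<le> real k"
  proof (rule ccontr)
    assume "\<not> ?thesis"
    then have "(real n - 1) * G \<le> 4813 / 10000 * T + 7 / 10" using k_bounds(2) by linarith
    moreover have "real s * G \<le> real n * G" using s G by (intro mult_right_mono) auto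
    moreover have "(real n - 1) * G = real n * G - G" by (simp add: left_diff_distrib)
    ultimately show False using neg' T0 G by linarith
  qed
  have small: "\<bar>real k * ln gold - real N * G - ln (real u / real v)\<bar> \<le> exp (- T)"
  proof -
    have gold: "gold > 0" using gold_bounds by linarith
    \<comment> \<open>The error gold^(-2k) of the Lucas approximation is as small as g^(-s): for n
      >= 2 one has s <= n <= 2 (n - 1), and g^(n - 1) <= lucas k.\<close>
    have "real g ^ s \<le> (real g ^ (n - 1)) ^ 2"
      using s n g1 by (simp add: power_mult[symmetric]) (intro power_increasing; linarith)
    also have "\<dots> \<le> (1382 / 1000 * gold ^ k) ^ 2"
      by (intro power_mono order.trans[OF lucas_bounds(1) ln_lucas_approx(2)[OF pos(1)]]) simp
    also have "\<dots> = (1382 / 1000)\<^sup>2 * gold ^ (2 * k)"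
      by (simp only: power_mult_distrib power_mult[symmetric] mult.commute[of k])
    also have "\<dots> \<le> 2 * gold ^ (2 * k)" using gold by (intro mult_right_mono) (simp_all add: power2_eq_square)
    finally have "1 / (2 * gold ^ (2 * k)) \<le> 1 / real g ^ s" using g gold by (intro frac_le) auto
    then have "162 / 100 / gold ^ (2 * k) \<le> 162 / 100 * (2 / real g ^ s)" by simp
    then have A: "\<bar>real k * ln gold - real N * G - ln (real u / real v)\<bar> \<le> 10 * (1 / real g ^ s)"
    proof -
      have "\<bar>real k * ln gold - real N * G - ln (real u / real v)\<bar> \<le>
        \<bar>real k * ln gold - ln (real (lucas k))\<bar> + \<bar>ln (real (lucas k)) - real N * G - ln (real u / real v)\<bar>"
        by linarith
      also have "\<dots> \<le> 162 / 100 * (2 / real g ^ s) + 6 / real g ^ s"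
        using \<open>162 / 100 / gold ^ (2 * k) \<le> _\<close> ln_lucas_approx(1)[OF pos(1)] approx by linarith
      also have "\<dots> \<le> 10 * (1 / real g ^ s)" using g1 by (simp add: field_simps)
      finally show ?thesis .
    qed
    have B: "10 \<le> exp (235 / 100 :: real)"
    proof -
      have "(10 :: real) \<le> (\<Sum>n<9. (235 / 100) ^ n / fact n)" by (simp add: eval_nat_numeral fact_numeral)
      also have "\<dots> \<le> exp (235 / 100)" by (rule exp_taylor_bounds) simp
      finally show ?thesis .
    qed
    have C: "1 / real g ^ s = exp (- (real s * G))" using g1 g by (simp add: exp_minus exp_of_nat_mult divide_inverse)
    have "\<bar>real k * ln gold - real N * G - ln (real u / real v)\<bar> \<le> exp (235 / 100) * exp (- (real s * G))"
      using A unfolding C by (rule order.trans[OF _ mult_right_mono[OF B]]) simp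
    also have "\<dots> = exp (235 / 100 - real s * G)" by (simp flip: exp_add)
    also have "\<dots> \<le> exp (- T)" using neg' G by simp
    finally show ?thesis .
  qed
  \<comment> \<open>Since 6.25 / 120 < 0.0521, the condition on \<open>L\<close> can be expressed by
    n / H, without k and g.\<close>
  have kh: "real k / (120 * (H * G)) + 12 / 10 \<le> 521 / 10000 * (real n / H) + 121 / 100"
  proof -
    have "real k / (120 * (H * G)) \<le> (625 / 100 * (real n * G) + 21 / 10) / (120 * (H * G))"
      using k_bounds(1) HG by (intro divide_right_mono) auto
    also have "\<dots> = 625 / 12000 * (real n / H) + 21 / 1200 / (H * G)"
      using H(1) G by (simp add: add_divide_distrib)
    also have "\<dots> \<le> 521 / 10000 * (real n / H) + 21 / 1200 / 4"
      using HG H(1) by (intro add_mono mult_right_mono divide_left_mono) auto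
    finally show ?thesis by simp
  qed
  show False
    by (rule linear_form_lower_bound[OF g uv L(1) _ H(2) kT[unfolded T_def] order.trans[OF kh L(2)] small[unfolded T_def]])
      (use HG in simp)
qed

lemma lucas_eq: "real (lucas k) = real (d1 * d2 * d3) / (real g - 1) ^ 3 *
    (real g ^ l - 1) * (real g ^ m - 1) * (real g ^ n - 1)"
  unfolding eq by (simp add: real_repdigit[OF g] power3_eq_cube)

lemma ln_power_minus_one:
  assumes "j \<ge> 1"
  shows "\<bar>ln (real g ^ j - 1) - real j * G\<bar> \<le> 2 / real g ^ j"
proof -
  have "real g ^ j \<ge> 2 ^ 1"
    using g assms by (intro order.trans[OF power_increasing[of 1 j 2] power_mono]) auto
  then have x: "\<bar>- (1 / real g ^ j)\<bar> \<le> 1 / 2" "real g ^ j > 0" using g by (auto simp: divide_le_eq)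
  have p: "1 + - (1 / real g ^ j) > 0" using x(1) by linarith
  have "real g ^ j - 1 = real g ^ j * (1 + - (1 / real g ^ j))" using x(2) by (simp add: algebra_simps)
  then have "ln (real g ^ j - 1) = ln (real g ^ j) + ln (1 + - (1 / real g ^ j))"
    using x(2) p by (simp only: ln_mult_pos)
  then have "ln (real g ^ j - 1) - real j * G = ln (1 + - (1 / real g ^ j))"
    using g by (simp add: ln_realpow)
  also have "\<bar>\<dots>\<bar> \<le> \<bar>- (1 / real g ^ j)\<bar> / (1 - 1 / 2)" using x by (intro ln_one_plus_bound) auto
  finally show ?thesis by simp
qed

lemma ln_power_minus_one':
  assumes "j \<ge> s" "s \<ge> 1"
  shows "\<bar>ln (real g ^ j - 1) - real j * G\<bar> \<le> 2 / real g ^ s"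
proof -
  have "2 / real g ^ j \<le> 2 / real g ^ s"
    using assms g by (intro divide_left_mono power_increasing) auto
  moreover have "j \<ge> 1" using assms by linarith
  ultimately show ?thesis using ln_power_minus_one[of j] by linarith
qed

text \<open>Replacing g^j - 1 by g^j costs at most 2 / g^s in the logarithm for each factor with j
  >= s; three, two or one factors are replaced, whence the common 6 / g^s. The factors kept go into
  the numerator u over v = (g - 1)^3. Here 2 ln v <= 6 ln g gives the 6 in the heights, and each
  kept factor adds its exponent, because d1 d2 d3 <= v.\<close>

lemma linear_form_estimates:
  fixes L :: nat
  assumes n: "n \<ge> 2" and L: "L \<ge> 200"
  shows "521 / 10000 * (real n / 6) + 121 / 100 \<le> exp (98 / 1000 * real L - 31 / 10) \<Longrightarrow>
      real l \<le> 3500000 * real L ^ 3 * G * 6 + 34 / 10"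
    and "521 / 10000 * (real n / (real l + 6)) + 121 / 100 \<le> exp (98 / 1000 * real L - 31 / 10) \<Longrightarrow>
      real m \<le> 3500000 * real L ^ 3 * G * (real l + 6) + 34 / 10"
    and "521 / 10000 * (real n / (real l + real m + 6)) + 121 / 100 \<le> exp (98 / 1000 * real L - 31 / 10) \<Longrightarrow>
      real n \<le> 3500000 * real L ^ 3 * G * (real l + real m + 6) + 34 / 10"
proof -
  define D where "D = d1 * d2 * d3"
  define v where "v = (g - 1) ^ 3"
  have g0: "real g > 0" and g1: "real g - 1 > 0" "real g \<ge> 1" using g by auto
  have D: "D \<ge> 1" using d by (simp add: D_def)
  have v: "v \<ge> 1" "real v = (real g - 1) ^ 3" using g by (simp_all add: v_def of_nat_diff)
  have Dv: "D \<le> v" unfolding D_def v_def power3_eq_cube using d by (intro mult_mono) auto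
  have gp: "real g ^ j - 1 > 0" if "j \<ge> 1" for j
  proof -
    have "real g ^ 1 \<le> real g ^ j" using that g1 by (intro power_increasing) auto
    moreover have "1 < real g ^ 1" using g by simp
    ultimately show ?thesis by linarith
  qed
  have gpn: "g ^ j - 1 \<ge> 1" "real (g ^ j - 1) = real g ^ j - 1" if "j \<ge> 1" for j
  proof -
    have "g ^ j \<ge> 1" using g by simp
    then show r: "real (g ^ j - 1) = real g ^ j - 1" by (simp add: of_nat_diff)
    have "real (g ^ j - 1) > 0" unfolding r using gp[OF that] .
    then show "g ^ j - 1 \<ge> 1" by simp
  qed
  note gps = gp[OF pos(2)] gp[OF pos(3)]
  have gn: "real g ^ n - 1 > 0" using gp n by simp
  have lnv: "ln (real v) \<le> 3 * G"
  proof -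
    have "real v \<le> real g ^ 3" unfolding v(2) using g1 by (intro power_mono) auto
    then have "ln (real v) \<le> ln (real g ^ 3)" using v(1) g0 by (subst ln_le_cancel_iff) auto
    also have "\<dots> = 3 * G" using g0 by (simp add: ln_realpow)
    finally show ?thesis .
  qed
  have height: "2 * ln (real v) + max 0 (ln (real u / real v)) \<le> (real j + 6) * G"
    if "u \<ge> 1" "real u \<le> real v * real g ^ j" for u j
  proof -
    have "real u / real v \<le> real g ^ j" using that v(1) by (simp add: divide_le_eq mult.commute)
    then have "ln (real u / real v) \<le> ln (real g ^ j)" using that v(1) g0 by (subst ln_le_cancel_iff) auto
    then have "max 0 (ln (real u / real v)) \<le> real j * G" using g0 G by (simp add: ln_realpow)
    then show ?thesis using lnv unfolding distrib_right by linarith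
  qed
  have lnL: "ln (real (lucas k)) = ln (real D / real v) + ln (real g ^ l - 1) + ln (real g ^ m - 1) + ln (real g ^ n - 1)"
  proof -
    have "real D / real v > 0" using D v(1) by simp
    then show ?thesis unfolding lucas_eq D_def[symmetric] v(2)[symmetric]
      using gps gn by (simp only: ln_mult_pos mult_pos_pos)
  qed
  have lnu: "ln (x * y / real v) = ln (x / real v) + ln y" if "x > 0" "y > 0" for x y
    using that v(1) by (simp add: ln_mult ln_div)
  have pows: "real g ^ j - 1 \<le> real g ^ j" for j by simp
  have Dv': "real D \<le> real v" using Dv by simp
  show "real l \<le> 3500000 * real L ^ 3 * G * 6 + 34 / 10"
    if c: "521 / 10000 * (real n / 6) + 121 / 100 \<le> exp (98 / 1000 * real L - 31 / 10)"
  proof (rule linear_form_estimate[OF n D v(1) _ _ _ _ L c])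
    show "l \<le> n" using le by linarith
    show "2 * ln (real v) + max 0 (ln (real D / real v)) \<le> 6 * G"
      using height[of D 0] D Dv' by simp
    have "real (l + m + n) * G = real l * G + real m * G + real n * G" by (simp add: distrib_right)
    then show "\<bar>ln (real (lucas k)) - real (l + m + n) * G - ln (real D / real v)\<bar> \<le> 6 / real g ^ l"
      using ln_power_minus_one'[of l l] ln_power_minus_one'[of l m] ln_power_minus_one'[of l n] pos le
      unfolding lnL by linarith
  qed simp
  define u2 where "u2 = D * (g ^ l - 1)"
  have u2: "u2 \<ge> 1" "real u2 = real D * (real g ^ l - 1)"
    using D gpn[OF pos(2)] by (simp_all add: u2_def del: of_nat_diff)
  have u2v: "real u2 \<le> real v * real g ^ l"
    unfolding u2(2) using Dv' gps(1) by (intro mult_mono) auto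
  have ln2: "ln (real u2 / real v) = ln (real D / real v) + ln (real g ^ l - 1)"
    unfolding u2(2) using D gps by (intro lnu) auto
  show "real m \<le> 3500000 * real L ^ 3 * G * (real l + 6) + 34 / 10"
    if c: "521 / 10000 * (real n / (real l + 6)) + 121 / 100 \<le> exp (98 / 1000 * real L - 31 / 10)"
  proof (rule linear_form_estimate[OF n u2(1) v(1) _ _ _ _ L c])
    show "m \<le> n" using le by linarith
    show "2 * ln (real v) + max 0 (ln (real u2 / real v)) \<le> (real l + 6) * G"
      by (rule height[OF u2(1) u2v])
    have "real (m + n) * G = real m * G + real n * G" by (simp add: distrib_right)
    moreover have "4 / real g ^ m \<le> 6 / real g ^ m" using g0 by (simp add: divide_right_mono)
    ultimately show "\<bar>ln (real (lucas k)) - real (m + n) * G - ln (real u2 / real v)\<bar> \<le> 6 / real g ^ m"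
      using ln_power_minus_one'[of m m] ln_power_minus_one'[of m n] pos le
      unfolding lnL ln2 by linarith
  qed simp
  define u3 where "u3 = u2 * (g ^ m - 1)"
  have u3: "u3 \<ge> 1" "real u3 = real u2 * (real g ^ m - 1)"
    using u2(1) gpn[OF pos(3)] by (simp_all add: u3_def del: of_nat_diff)
  have u3v: "real u3 \<le> real v * real g ^ (l + m)"
  proof -
    have "real u2 * (real g ^ m - 1) \<le> (real v * real g ^ l) * real g ^ m"
      using u2v gps by (intro mult_mono) auto
    then show ?thesis by (simp add: u3(2) power_add mult_ac)
  qed
  have ln3: "ln (real u3 / real v) = ln (real u2 / real v) + ln (real g ^ m - 1)"
    unfolding u3(2) using u2 gps by (intro lnu) auto
  show "real n \<le> 3500000 * real L ^ 3 * G * (real l + real m + 6) + 34 / 10"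
    if c: "521 / 10000 * (real n / (real l + real m + 6)) + 121 / 100 \<le> exp (98 / 1000 * real L - 31 / 10)"
  proof (rule linear_form_estimate[OF n u3(1) v(1) _ _ _ _ L c])
    show "2 * ln (real v) + max 0 (ln (real u3 / real v)) \<le> (real l + real m + 6) * G"
      using height[OF u3(1) u3v] by simp
    have "2 / real g ^ n \<le> 6 / real g ^ n" using g0 by (simp add: divide_right_mono)
    then show "\<bar>ln (real (lucas k)) - real n * G - ln (real u3 / real v)\<bar> \<le> 6 / real g ^ n"
      using ln_power_minus_one'[of n n] n unfolding lnL ln2 ln3 by linarith
  qed simp_all
qed

text \<open>The admissible \<open>L\<close> grows like the logarithm of \<open>w\<close>; the cube of this logarithm is absorbed
  by \<open>y\<^bsup>p / 6\<^esup> \<le> sqrt y\<close>, and \<open>ln g\<close> by the other factor \<open>sqrt y \<ge> c\<close>.\<close>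

lemma choose_L_scaled:
  fixes c y w w0 L0 :: real
  assumes c: "c \<ge> 1" "G \<le> 6932 / 10000 * c" and y: "c\<^sup>2 \<le> y" and w: "w \<le> w0 * y ^ p" "p \<le> 3"
    and L0: "w0 \<le> exp (98 / 1000 * (L0 - 1) - 31 / 10)" "L0 \<ge> 201"
  obtains L :: nat where "L \<ge> 200" "w \<le> exp (98 / 1000 * real L - 31 / 10)"
    "real L ^ 3 * G \<le> 6932 / 10000 * L0 ^ 3 * y"
proof -
  have "1 ^ 2 \<le> c\<^sup>2" using c by (intro power_mono) auto
  then have y1: "y \<ge> 1" using y by simp
  define z where "z = root 6 y"
  have z: "z \<ge> 1" "z ^ 6 = y" using y1 by (simp_all add: z_def)
  have "c\<^sup>2 \<le> (z ^ 3)\<^sup>2" using y unfolding z(2)[symmetric] by (simp flip: power_mult)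
  then have cz: "c \<le> z ^ 3" by (rule power2_le_imp_le) (use z in simp)
  have "w \<le> w0 * (z ^ p) ^ 6" using w(1) unfolding z(2)[symmetric] by (simp add: mult.commute flip: power_mult)
  moreover have "z ^ p \<ge> 1" using z by simp
  ultimately obtain L :: nat where L: "L \<ge> 200" "w \<le> exp (98 / 1000 * real L - 31 / 10)" "real L ^ 3 \<le> L0 ^ 3 * z ^ p"
    using choose_L L0 by blast
  have "real L ^ 3 \<le> L0 ^ 3 * z ^ 3"
    using L0(2) z w(2) by (intro order.trans[OF L(3)] mult_left_mono power_increasing) auto
  moreover have "G \<le> 6932 / 10000 * z ^ 3" using c(2) cz by linarith
  ultimately have "real L ^ 3 * G \<le> (L0 ^ 3 * z ^ 3) * (6932 / 10000 * z ^ 3)"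
    using G L0 z by (intro mult_mono) auto
  also have "\<dots> = 6932 / 10000 * L0 ^ 3 * (z ^ 3 * z ^ 3)" by simp
  also have "z ^ 3 * z ^ 3 = y" unfolding z(2)[symmetric] by (simp flip: power_add)
  finally show ?thesis using L that by blast
qed

section \<open>Explicit bounds for n, m and l\<close>

text \<open>If the bound fails, then y >= c^2, as \<open>choose_L_scaled\<close> requires, and the
  estimate for the resulting \<open>L\<close> contradicts the definition of y: 3500000 * 0.6932 *
  350^3 is below 12 * 10^13. The value L0 = 350 is fixed by 0.098 * 349 - 3.1 > 31 and 2.7^31 >=
  6264 * 10^9.\<close>

lemma n_bound_lm:
  assumes n: "n \<ge> 2" and c: "c \<ge> 1" "G \<le> 6932 / 10000 * c"
  shows "real n < 12 * 10 ^ 13 * c\<^sup>2 * (real l + real m + 6)"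
proof (rule ccontr)
  assume neg: "\<not> ?thesis"
  define H where "H = real l + real m + 6"
  have H: "H \<ge> 6" by (simp add: H_def)
  define y where "y = real n / H / (12 * 10 ^ 13)"
  have n': "real n = 12 * 10 ^ 13 * (y * H)" using H by (simp add: y_def)
  have y: "c\<^sup>2 \<le> y" using neg H unfolding H_def[symmetric] by (simp add: y_def le_divide_eq mult_ac)
  have "1 ^ 2 \<le> c\<^sup>2" using c by (intro power_mono) auto
  then have y1: "y \<ge> 1" using y by simp
  have yH: "6 \<le> H * y" using mult_mono[of 6 H 1 y] y1 H by simp
  have "521 / 10000 * (real n / H) + 121 / 100 \<le> 6264 * 10 ^ 9 * y ^ 1" using y1 H unfolding n' by simp
  moreover have "6264 * 10 ^ 9 \<le> exp (98 / 1000 * (350 - 1) - 31 / 10 :: real)"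
    by (rule order.trans[OF _ exp_1_power_ge[of 31]]) (simp_all add: power_divide)
  ultimately obtain L :: nat where L: "L \<ge> 200" "521 / 10000 * (real n / H) + 121 / 100 \<le> exp (98 / 1000 * real L - 31 / 10)"
    "real L ^ 3 * G \<le> 6932 / 10000 * 350 ^ 3 * y"
    using choose_L_scaled[OF c y, of _ "6264 * 10 ^ 9" 1 350] by auto
  have "real n \<le> 3500000 * (real L ^ 3 * G) * H + 34 / 10"
    using linear_form_estimates(3)[OF n L(1)] L(2) by (simp add: H_def mult.assoc)
  also have "\<dots> \<le> 3500000 * (6932 / 10000 * 350 ^ 3 * y) * H + 34 / 10"
    using L(3) H by (intro add_right_mono mult_right_mono mult_left_mono) auto
  also have "\<dots> = 104023325000000 * (y * H) + 34 / 10" by simp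
  also have "\<dots> < 12 * 10 ^ 13 * (y * H)" using yH by simp
  finally show False using n' by simp
qed

text \<open>The condition on \<open>L\<close> still involves n, which \<open>n_bound_lm\<close>
  bounds by a multiple of c^2 (m + H), hence of y^2 H. This is why p = 2 and a larger L0
  occur.\<close>

lemma m_bound_l:
  assumes n: "n \<ge> 2" and c: "c \<ge> 1" "G \<le> 6932 / 10000 * c"
  shows "real m < 10 ^ 15 * c\<^sup>2 * (real l + 6)"
proof (rule ccontr)
  assume neg: "\<not> ?thesis"
  define H where "H = real l + 6"
  have H: "H \<ge> 6" by (simp add: H_def)
  define y where "y = real m / H / 10 ^ 15"
  have m': "real m = 10 ^ 15 * (y * H)" using H by (simp add: y_def)
  have y: "c\<^sup>2 \<le> y" using neg H unfolding H_def[symmetric] by (simp add: y_def le_divide_eq mult_ac)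
  have "1 ^ 2 \<le> c\<^sup>2" using c by (intro power_mono) auto
  then have y1: "y \<ge> 1" using y by simp
  have yH: "6 \<le> H * y" using mult_mono[of 6 H 1 y] y1 H by simp
  have "real n \<le> 12 * 10 ^ 13 * c\<^sup>2 * (real m + H)" using less_imp_le[OF n_bound_lm[OF n c]] by (simp only: H_def add_ac)
  also have "\<dots> \<le> 12 * 10 ^ 13 * y * (10 ^ 15 * (y * H) + y * H)"
    unfolding m' using y y1 H mult_right_mono[of 1 y H] by (intro mult_mono add_mono) auto
  also have "\<dots> \<le> 13 * 10 ^ 28 * y ^ 2 * H" using y1 H by (simp add: power2_eq_square)
  finally have "real n / H \<le> 13 * 10 ^ 28 * y ^ 2" using H by (simp add: divide_le_eq)
  moreover have "y ^ 2 \<ge> 1" using y1 by simp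
  ultimately have "521 / 10000 * (real n / H) + 121 / 100 \<le> 68 * 10 ^ 26 * y ^ 2" by simp
  moreover have "68 * 10 ^ 26 \<le> exp (98 / 1000 * (700 - 1) - 31 / 10 :: real)"
    by (rule order.trans[OF _ exp_1_power_ge[of 65]]) (simp_all add: power_divide)
  ultimately obtain L :: nat where L: "L \<ge> 200" "521 / 10000 * (real n / H) + 121 / 100 \<le> exp (98 / 1000 * real L - 31 / 10)"
    "real L ^ 3 * G \<le> 6932 / 10000 * 700 ^ 3 * y"
    using choose_L_scaled[OF c y, of _ "68 * 10 ^ 26" 2 700] by auto
  have "real m \<le> 3500000 * (real L ^ 3 * G) * H + 34 / 10"
    using linear_form_estimates(2)[OF n L(1)] L(2) by (simp add: H_def mult.assoc)
  also have "\<dots> \<le> 3500000 * (6932 / 10000 * 700 ^ 3 * y) * H + 34 / 10"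
    using L(3) H by (intro add_right_mono mult_right_mono mult_left_mono) auto
  also have "\<dots> = 832186600000000 * (y * H) + 34 / 10" by simp
  also have "\<dots> < 10 ^ 15 * (y * H)" using yH by simp
  finally show False using m' by simp
qed

lemma n_bound_l:
  assumes n: "n \<ge> 2" and c: "c \<ge> 1" "G \<le> 6932 / 10000 * c"
  shows "real n \<le> 13 * 10 ^ 28 * c ^ 4 * (real l + 6)"
proof -
  define H where "H = real l + 6"
  have H: "H \<ge> 6" by (simp add: H_def)
  have "1 ^ 2 \<le> c\<^sup>2" using c by (intro power_mono) auto
  then have c2: "c\<^sup>2 \<ge> 1" by simp
  have "real n \<le> 12 * 10 ^ 13 * c\<^sup>2 * (real m + H)" using less_imp_le[OF n_bound_lm[OF n c]] by (simp only: H_def add_ac)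
  also have "\<dots> \<le> 12 * 10 ^ 13 * c\<^sup>2 * (10 ^ 15 * c\<^sup>2 * H + c\<^sup>2 * H)"
    using m_bound_l[OF n c] mult_right_mono[OF c2, of H] H unfolding H_def[symmetric]
    by (intro mult_mono add_mono) auto
  also have "\<dots> = (12 * 10 ^ 13 * (10 ^ 15 + 1)) * c ^ 4 * H" by (simp add: algebra_simps flip: power_add)
  also have "\<dots> \<le> 13 * 10 ^ 28 * c ^ 4 * H" using H c by (intro mult_right_mono) auto
  finally show ?thesis by (simp add: H_def)
qed

text \<open>Now n is at most a multiple of c^4 (l + 6), hence of y^3, so p = 3.\<close>

lemma l_bound:
  assumes n: "n \<ge> 2" and c: "c \<ge> 1" "G \<le> 6932 / 10000 * c"
  shows "real l + 6 < 2 * 10 ^ 16 * c\<^sup>2"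
proof (rule ccontr)
  assume neg: "\<not> ?thesis"
  define y where "y = (real l + 6) / (2 * 10 ^ 16)"
  have l': "real l + 6 = 2 * 10 ^ 16 * y" by (simp add: y_def)
  have y: "c\<^sup>2 \<le> y" using neg by (simp add: y_def le_divide_eq mult_ac)
  have "1 ^ 2 \<le> c\<^sup>2" using c by (intro power_mono) auto
  then have y1: "y \<ge> 1" using y by simp
  have "c ^ 4 = (c\<^sup>2)\<^sup>2" by simp
  also have "\<dots> \<le> y\<^sup>2" using y by (intro power_mono) auto
  finally have "13 * 10 ^ 28 * c ^ 4 * (real l + 6) \<le> 13 * 10 ^ 28 * y\<^sup>2 * (2 * 10 ^ 16 * y)"
    unfolding l' using y1 by (intro mult_right_mono mult_left_mono) auto
  then have "real n \<le> 13 * 10 ^ 28 * y\<^sup>2 * (2 * 10 ^ 16 * y)" using n_bound_l[OF n c] by linarith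
  also have "\<dots> = 26 * 10 ^ 44 * y ^ 3" by (simp add: power2_eq_square power3_eq_cube)
  finally have "521 / 10000 * (real n / 6) + 121 / 100 \<le> 23 * 10 ^ 42 * y ^ 3" using one_le_power[OF y1, of 3] by simp
  moreover have "23 * 10 ^ 42 \<le> exp (98 / 1000 * (1070 - 1) - 31 / 10 :: real)"
    by (rule order.trans[OF _ exp_1_power_ge[of 101]]) (simp_all add: power_divide)
  ultimately obtain L :: nat where L: "L \<ge> 200" "521 / 10000 * (real n / 6) + 121 / 100 \<le> exp (98 / 1000 * real L - 31 / 10)"
    "real L ^ 3 * G \<le> 6932 / 10000 * 1070 ^ 3 * y"
    using choose_L_scaled[OF c y, of _ "23 * 10 ^ 42" 3 1070] by auto
  have "real l \<le> 3500000 * (real L ^ 3 * G) * 6 + 34 / 10"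
    using linear_form_estimates(1)[OF n L(1,2)] by (simp add: mult.assoc)
  also have "\<dots> \<le> 3500000 * (6932 / 10000 * 1070 ^ 3 * y) * 6 + 34 / 10"
    using L(3) by (intro add_right_mono mult_right_mono mult_left_mono) auto
  finally show False using l' y1 by simp
qed

lemma n_k_bounds: "real n < 7.73 * 10 ^ 47 * G ^ 9" "real k < 7.73 * 10 ^ 48 * G ^ 10"
proof -
  \<comment> \<open>Normalised so that c >= 1, which permits raising the exponent from 6 to 9;
    returning to \<open>G\<close> costs the factor (ln 2)^9, bounded below by 36/1000.\<close>
  define c where "c = G / ln 2"
  have l2: "ln 2 > (0 :: real)" by simp
  have cG: "G = ln 2 * c" by (simp add: c_def)
  have "ln 2 \<le> G" using g by simp
  then have c1: "c \<ge> 1" using l2 by (simp add: c_def le_divide_eq)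
  have c2: "G \<le> 6932 / 10000 * c" unfolding cG using ln_2_le c1 by (intro mult_right_mono) auto
  have "693 / 1000 * c \<le> G" unfolding cG using ln_2_ge c1 by (intro mult_right_mono) auto
  then have "(693 / 1000 * c) ^ 9 \<le> G ^ 9" using c1 by (intro power_mono) auto
  moreover have c9: "c ^ 9 \<ge> 1" using c1 by simp
  moreover have "(693 / 1000 * c) ^ 9 = (693 / 1000) ^ 9 * c ^ 9" by (rule power_mult_distrib)
  moreover have "(36 / 1000 :: real) \<le> (693 / 1000) ^ 9" by (simp add: power_divide)
  then have "36 / 1000 * c ^ 9 \<le> (693 / 1000) ^ 9 * c ^ 9" using c1 by (intro mult_right_mono) auto
  ultimately have G9: "36 / 1000 * c ^ 9 \<le> G ^ 9" by linarith
  have "real n \<le> 26 * 10 ^ 44 * c ^ 9"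
  proof (cases "n \<ge> 2")
    case True
    have "real n \<le> 13 * 10 ^ 28 * c ^ 4 * (real l + 6)" by (rule n_bound_l[OF True c1 c2])
    also have "\<dots> \<le> 13 * 10 ^ 28 * c ^ 4 * (2 * 10 ^ 16 * c\<^sup>2)"
      using l_bound[OF True c1 c2] by (intro mult_left_mono) auto
    also have "\<dots> = 26 * 10 ^ 44 * c ^ 6" by (simp flip: power_add)
    also have "\<dots> \<le> 26 * 10 ^ 44 * c ^ 9" using c1 by (intro mult_left_mono power_increasing) auto
    finally show ?thesis .
  next
    \<comment> \<open>The estimates above need n >= 2; n = 1 is trivial.\<close>
    case False
    then have "real n \<le> 1" by simp
    then show ?thesis using c9 by simp
  qed
  then show n: "real n < 7.73 * 10 ^ 47 * G ^ 9" using G9 c9 by simp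
  have "693 / 1000 \<le> real n * G" using mult_mono[of 1 "real n" "693 / 1000" G] G pos le by simp
  then have "real k < 10 * (real n * G)" using k_bounds(1) by linarith
  also have "\<dots> \<le> 10 * ((7.73 * 10 ^ 47 * G ^ 9) * G)"
    using n G by (intro mult_left_mono mult_right_mono) auto
  also have "\<dots> = 7.73 * 10 ^ 48 * G ^ 10" by (simp add: eval_nat_numeral)
  finally show "real k < 7.73 * 10 ^ 48 * G ^ 10" .
qed

end

theorem theorem1p2:
  fixes g k d1 d2 d3 l m n :: nat
  assumes "g \<ge> 2"
    and "k \<ge> 1" and "l \<ge> 1" and "m \<ge> 1" and "n \<ge> 1"
    and "1 \<le> d1" and "d1 \<le> g - 1"
    and "1 \<le> d2" and "d2 \<le> g - 1"
    and "1 \<le> d3" and "d3 \<le> g - 1"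
    and "l \<le> m" and "m \<le> n"
    and "lucas k = repdigit g d1 l * repdigit g d2 m * repdigit g d3 n"
  shows "real n < 7.73 * 10 ^ 47 * (ln (real g)) ^ 9
       \<and> real k < 7.73 * 10 ^ 48 * (ln (real g)) ^ 10"
proof -
  interpret lucas_product g k d1 d2 d3 l m n
    using assms by unfold_locales auto
  show ?thesis using n_k_bounds by blast
qed

end
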